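(* For a multigraph $G$ the following are equivalent: (i) $\mathrm{rd}(G)\le 1$; (ii) $\lambda(G)\le1$; (iii) $G$ has no minor isomorphic to $K_4$ or to $K_3^=$.
   Context: A multigraph is a finite undirected graph that may contain parallel edges but no loops. $K_3^=$ is the triangle with every edge doubled (two parallel edges between each pair of its three vertices). Minors are in the usual sense (loops arising from contraction are deleted). A tensegrity realization of $G$ in $\mathbb{R}^m$ is $(G,\sigma,p)$ with $\sigma:E(G)\to\{+,-\}$, $p:V(G)\to\mathbb{R}^m$ (not necessarily injective). A deformation is $(G,\sigma,q)$, $q:V(G)\to\mathbb{R}^m$, with $\|q(i)-q(j)\|\le\|p(i)-p(j)\|$ for edges $ij$ with $\sigma=+$ and $\ge$ for edges with $\sigma=-$. $G$ is $d$-realizable if every tensegrity realization of $G$ has a deformation whose point set has affine span of dimension at most $d$; $\mathrm{rd}(G)$ is the least $d\ge0$ with $G$ $d$-realizable. With $V(G)=\{1,\dots,n\}$, standard basis $\mathbf{e}_i$, $L_{G,\omega}=\sum_{e}\omega(e)(\mathbf{e}_i-\mathbf{e}_j)(\mathbf{e}_i-\mathbf{e}_j)^\top$ ($i,j$ endpoints of $e$); $\omega$ is an equilibrium stress if $\sum_{e \text{ joins } i,j}\omega(e)(p(j)-p(i))=0$ for each vertex $i$, strictly proper if $\sigma(e)\omega(e)>0$ for all $e$. $(G,\sigma,p)$ with points affinely spanning $\mathbb{R}^d$ is $d$-dimensional super stable if (i) some strictly proper equilibrium stress has $L_{G,\omega}\succeq0$, $\dim\ker L_{G,\omega}=d+1$,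 and (ii) no nonzero symmetric $d\times d$ matrix $S$ has $(p(j)-p(i))^\top S(p(j)-p(i))=0$ for all edges $ij$. $\lambda(G)$: for connected $G$, the maximum $d$ with a $d$-dimensional super stable realization; in general the maximum over connected components. *)

theory Defs
  imports Complex_Main "Jordan_Normal_Form.Matrix_Kernel" "Jordan_Normal_Form.VS_Connect"
begin

section \<open>Multigraphs\<close>

text \<open>Edges have their own identity and are mapped to their set of endpoints, so distinct edges
  may be parallel. There are no loops since an edge has exactly two endpoints. The null graph
  (no vertices) is allowed.\<close>

record ('v, 'e) mgraph =
  verts :: "'v set"
  edges :: "'e set"
  ends :: "'e \<Rightarrow> 'v set"

definition multigraph :: "('v, 'e) mgraph \<Rightarrow> bool" where
  "multigraph G \<longleftrightarrow> finite (verts G) \<and> finite (edges G) \<and>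
     (\<forall>e\<in>edges G. ends G e \<subseteq> verts G \<and> card (ends G e) = 2)"

definition mgraph_iso :: "('v, 'e) mgraph \<Rightarrow> ('w, 'f) mgraph \<Rightarrow> bool" where
  "mgraph_iso G H \<longleftrightarrow> (\<exists>f g. bij_betw f (verts G) (verts H) \<and> bij_betw g (edges G) (edges H) \<and>
     (\<forall>e\<in>edges G. ends H (g e) = f ` ends G e))"

definition delete_edge :: "'e \<Rightarrow> ('v, 'e) mgraph \<Rightarrow> ('v, 'e) mgraph" where
  "delete_edge e G = G\<lparr>edges := edges G - {e}\<rparr>"

definition delete_vertex :: "'v \<Rightarrow> ('v, 'e) mgraph \<Rightarrow> ('v, 'e) mgraph" where
  "delete_vertex v G = G\<lparr>verts := verts G - {v}, edges := {e \<in> edges G. v \<notin> ends G e}\<rparr>"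

text \<open>Contraction of an edge joining \<open>u\<close> and \<open>v\<close>: the vertex \<open>v\<close> is merged into \<open>u\<close>. The contracted
  edge and all edges parallel to it, which would become loops, are deleted; other parallel edges
  that arise are kept.\<close>

definition contract :: "'v \<Rightarrow> 'v \<Rightarrow> ('v, 'e) mgraph \<Rightarrow> ('v, 'e) mgraph" where
  "contract u v G = G\<lparr>verts := verts G - {v}, edges := {e \<in> edges G. ends G e \<noteq> {u, v}},
     ends := (\<lambda>e. (\<lambda>x. if x = v then u else x) ` ends G e)\<rparr>"

inductive minor_step :: "('v, 'e) mgraph \<Rightarrow> ('v, 'e) mgraph \<Rightarrow> bool" where
  "e \<in> edges G \<Longrightarrow> minor_step G (delete_edge e G)"
| "v \<in> verts G \<Longrightarrow> minor_step G (delete_vertex v G)"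
| "e \<in> edges G \<Longrightarrow> ends G e = {u, v} \<Longrightarrow> u \<noteq> v \<Longrightarrow> minor_step G (contract u v G)"

definition has_minor :: "('v, 'e) mgraph \<Rightarrow> ('w, 'f) mgraph \<Rightarrow> bool" where
  "has_minor G H \<longleftrightarrow> (\<exists>G'. minor_step\<^sup>*\<^sup>* G G' \<and> mgraph_iso G' H)"

definition K4 :: "(nat, nat set) mgraph" where
  "K4 = \<lparr>verts = {..<4}, edges = {X. X \<subseteq> {..<4} \<and> card X = 2}, ends = (\<lambda>X. X)\<rparr>"

text \<open>The triangle with every edge doubled.\<close>

definition doubled_K3 :: "(nat, nat set \<times> bool) mgraph" where
  "doubled_K3 = \<lparr>verts = {..<3}, edges = {X. X \<subseteq> {..<3} \<and> card X = 2} \<times> UNIV, ends = fst\<rparr>"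

definition adjacent :: "('v, 'e) mgraph \<Rightarrow> 'v \<Rightarrow> 'v \<Rightarrow> bool" where
  "adjacent G u v \<longleftrightarrow> (\<exists>e\<in>edges G. ends G e = {u, v})"

definition induced :: "('v, 'e) mgraph \<Rightarrow> 'v set \<Rightarrow> ('v, 'e) mgraph" where
  "induced G X = G\<lparr>verts := X, edges := {e \<in> edges G. ends G e \<subseteq> X}\<rparr>"

definition components :: "('v, 'e) mgraph \<Rightarrow> ('v, 'e) mgraph set" where
  "components G = (\<lambda>v. induced G {u. (adjacent G)\<^sup>*\<^sup>* v u}) ` verts G"


section \<open>Tensegrities and realizable dimension\<close>

text \<open>Points of $\mathbb{R}^m$ are the elements of \<open>carrier_vec m\<close>, because the dimension \<open>m\<close> is quantified
  inside the definitions below.\<close>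

definition vec_dist :: "real vec \<Rightarrow> real vec \<Rightarrow> real" where
  "vec_dist x y = sqrt ((x - y) \<bullet> (x - y))"

text \<open>Only meant for finite \<open>P\<close>. The affine span of the empty set is empty.\<close>

definition affine_span :: "nat \<Rightarrow> real vec set \<Rightarrow> real vec set" where
  "affine_span m P = {finsum_vec TYPE(real) m (\<lambda>x. c x \<cdot>\<^sub>v x) P | c. (\<Sum>x\<in>P. c x) = 1}"

text \<open>Dimension of an affine subspace, i.e. of its space of directions. The empty set gets
  dimension 0 instead of the customary -1; this is harmless for bounds \<open>\<le> d\<close> with \<open>d \<ge> 0\<close>.\<close>

definition affine_dim :: "nat \<Rightarrow> real vec set \<Rightarrow> nat" where
  "affine_dim m A = vectorspace.dim class_ring
     (LinearCombinations.module.span_vs class_ring (module_vec TYPE(real) m)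
       {x - y | x y. x \<in> A \<and> y \<in> A})"

text \<open>The signs \<open>+\<close> and \<open>-\<close> are the real numbers \<open>1\<close> and \<open>-1\<close>.\<close>

definition realization ::
  "nat \<Rightarrow> ('v, 'e) mgraph \<Rightarrow> ('e \<Rightarrow> real) \<Rightarrow> ('v \<Rightarrow> real vec) \<Rightarrow> bool" where
  "realization m G \<sigma> p \<longleftrightarrow>
     (\<forall>e\<in>edges G. \<sigma> e \<in> {1, -1}) \<and> (\<forall>v\<in>verts G. p v \<in> carrier_vec m)"

definition deformation ::
  "nat \<Rightarrow> ('v, 'e) mgraph \<Rightarrow> ('e \<Rightarrow> real) \<Rightarrow> ('v \<Rightarrow> real vec) \<Rightarrow> ('v \<Rightarrow> real vec) \<Rightarrow> bool" where
  "deformation m G \<sigma> p q \<longleftrightarrow> (\<forall>v\<in>verts G. q v \<in> carrier_vec m) \<and>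
     (\<forall>e\<in>edges G. \<forall>i j. ends G e = {i, j} \<longrightarrow>
        (\<sigma> e = 1 \<longrightarrow> vec_dist (q i) (q j) \<le> vec_dist (p i) (p j)) \<and>
        (\<sigma> e = -1 \<longrightarrow> vec_dist (q i) (q j) \<ge> vec_dist (p i) (p j)))"

definition realizable :: "nat \<Rightarrow> ('v, 'e) mgraph \<Rightarrow> bool" where
  "realizable d G \<longleftrightarrow> (\<forall>m \<sigma> p. realization m G \<sigma> p \<longrightarrow>
     (\<exists>q. deformation m G \<sigma> p q \<and> affine_dim m (affine_span m (q ` verts G)) \<le> d))"

definition rd :: "('v, 'e) mgraph \<Rightarrow> nat" where
  "rd G = (LEAST d. realizable d G)"


section \<open>Stresses, super stability and the parameter \<open>\<lambda>\<close>\<close>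

definition other_end :: "('v, 'e) mgraph \<Rightarrow> 'e \<Rightarrow> 'v \<Rightarrow> 'v" where
  "other_end G e i = the_elem (ends G e - {i})"

definition equilibrium_stress ::
  "nat \<Rightarrow> ('v, 'e) mgraph \<Rightarrow> ('v \<Rightarrow> real vec) \<Rightarrow> ('e \<Rightarrow> real) \<Rightarrow> bool" where
  "equilibrium_stress m G p \<omega> \<longleftrightarrow> (\<forall>i\<in>verts G.
     finsum_vec TYPE(real) m (\<lambda>e. \<omega> e \<cdot>\<^sub>v (p (other_end G e i) - p i)) {e \<in> edges G. i \<in> ends G e}
       = 0\<^sub>v m)"

definition strictly_proper :: "('v, 'e) mgraph \<Rightarrow> ('e \<Rightarrow> real) \<Rightarrow> ('e \<Rightarrow> real) \<Rightarrow> bool" where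
  "strictly_proper G \<sigma> \<omega> \<longleftrightarrow> (\<forall>e\<in>edges G. \<sigma> e * \<omega> e > 0)"

text \<open>The map \<open>l\<close> is a labelling of the vertices by \<open>0, \<dots>, n - 1\<close>, where \<open>n\<close> is their number. The vector
  of an edge with endpoints labelled \<open>i\<close> and \<open>j\<close> is the difference of the \<open>i\<close>-th and \<open>j\<close>-th unit
  vectors; the orientation (smaller label first) does not matter, since only products of two entries
  of this vector enter the Laplacian.\<close>

definition edge_vec :: "('v, 'e) mgraph \<Rightarrow> ('v \<Rightarrow> nat) \<Rightarrow> 'e \<Rightarrow> real vec" where
  "edge_vec G l e = unit_vec (card (verts G)) (Min (l ` ends G e))
                  - unit_vec (card (verts G)) (Max (l ` ends G e))"

definition laplacian :: "('v, 'e) mgraph \<Rightarrow> ('v \<Rightarrow> nat) \<Rightarrow> ('e \<Rightarrow> real) \<Rightarrow> real mat" where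
  "laplacian G l \<omega> = mat (card (verts G)) (card (verts G))
     (\<lambda>(a, b). \<Sum>e\<in>edges G. \<omega> e * (edge_vec G l e $ a * edge_vec G l e $ b))"

definition pos_semidef :: "real mat \<Rightarrow> bool" where
  "pos_semidef A \<longleftrightarrow> square_mat A \<and> A\<^sup>T = A \<and>
     (\<forall>x \<in> carrier_vec (dim_row A). x \<bullet> (A *\<^sub>v x) \<ge> 0)"

text \<open>Positive semidefiniteness and the dimension of the kernel do not depend on the labelling \<open>l\<close>.\<close>

definition super_stable ::
  "nat \<Rightarrow> ('v, 'e) mgraph \<Rightarrow> ('e \<Rightarrow> real) \<Rightarrow> ('v \<Rightarrow> real vec) \<Rightarrow> bool" where
  "super_stable d G \<sigma> p \<longleftrightarrow>
     realization d G \<sigma> p \<and>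
     affine_span d (p ` verts G) = carrier_vec d \<and>
     (\<exists>l \<omega>. bij_betw l (verts G) {..<card (verts G)} \<and>
        equilibrium_stress d G p \<omega> \<and> strictly_proper G \<sigma> \<omega> \<and>
        pos_semidef (laplacian G l \<omega>) \<and> kernel_dim (laplacian G l \<omega>) = d + 1) \<and>
     \<not> (\<exists>S \<in> carrier_mat d d. S\<^sup>T = S \<and> S \<noteq> 0\<^sub>m d d \<and>
        (\<forall>e\<in>edges G. \<forall>i j. ends G e = {i, j} \<longrightarrow> (p j - p i) \<bullet> (S *\<^sub>v (p j - p i)) = 0))"

text \<open>The maximum is over a finite nonempty set for connected \<open>G\<close>: kernel dimensions are at most the
  number of vertices, and a realization in dimension 0 with all signs \<open>+\<close> is super stable.\<close>

definition max_super_stable_dim :: "('v, 'e) mgraph \<Rightarrow> nat" where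
  "max_super_stable_dim G = Max {d. \<exists>\<sigma> p. super_stable d G \<sigma> p}"

text \<open>The only component of a connected \<open>G\<close> is \<open>G\<close> itself. A supremum of natural numbers is a
  maximum, except that the null graph, which has no components, gets the value 0.\<close>

definition graph_lambda :: "('v, 'e) mgraph \<Rightarrow> nat" where
  "graph_lambda G = (SUP C\<in>components G. max_super_stable_dim C)"

end

theory Submission
  imports "HOL-Analysis.L2_Norm" Defs
begin

text \<open>A graph without the two minors is realizable on the line by induction on the number of vertices. Since
  it has no \<open>K\<^sub>4\<close> minor, a longest-path argument yields a vertex \<open>v\<close> with at most two neighbours \<open>u\<close> and
  \<open>x\<close>. If only one edge joins \<open>v\<close> and \<open>x\<close>, it can be contracted. If both connections are multiple, then at
  most one edge \<open>yx\<close> leaves the component \<open>U\<close> of \<open>u\<close> in \<open>G - v - x\<close> towards \<open>x\<close>, for otherwise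
  \<open>{v}\<close>, \<open>U\<close>, \<open>{x}\<close> would give a doubled triangle. The embeddings of the two sides are then glued at
  \<open>v\<close>, possibly after a reflection; the distance from \<open>v\<close> to \<open>y\<close> is exact on one side because \<open>x\<close> was
  contracted into \<open>y\<close>.

  A super stable realization of dimension \<open>d \<ge> 2\<close> has no one-dimensional deformation: the energy of a
  deformation on a line vanishes, so its coordinate \<open>r\<close> is an affine function \<open>a \<bullet> p + c\<close> of the points, all
  edge lengths are preserved, and the symmetric matrix \<open>a a\<^sup>T - 1\<close> violates the second condition.

  Conversely, call three edges a resistance triple if, in the network of the other edges with suitable
  positive conductances, the transfer resistance between any two of them is negative. Both minors have
  such a triple, and it survives when edges are added (with small conductance) or contractions are
  undone (with large conductance). Giving the three edges suitable negative conductances makes the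
  Laplacian positive semidefinite of corank 3, and its kernel is a super stable realization in the plane.\<close>

section \<open>Minors\<close>

text \<open>An embedding into the line is built from triangle inequalities alone, so lengths are
  given by an arbitrary pseudometric instead of Euclidean distances. A contraction keeps the
  pseudometric and only redirects edges, possibly with new signs, and this makes the induction
  possible. Super stability is awkward to carry through minors, because the corank of a Laplacian is
  not stable under perturbation. A resistance triple replaces it by finitely many strict
  inequalities, which do survive. The number three fits in two ways. A symmetric 3 by 3 matrix with
  negative off-diagonal entries becomes diagonal after adding a rank-one matrix; the currents
  orthogonal to the vector of that rank-one matrix form a plane, and together with the constants
  they yield a kernel of dimension 3. Moreover, three edge vectors in general position determine a
  quadratic form in two variables, which gives the second condition of super stability.\<close>

lemma multigraphD:
  assumes "multigraph G"
  shows "finite (verts G)" "finite (edges G)"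
    and "e \<in> edges G \<Longrightarrow> ends G e \<subseteq> verts G" "e \<in> edges G \<Longrightarrow> card (ends G e) = 2"
    and "e \<in> edges G \<Longrightarrow> ends G e = {i, j} \<Longrightarrow> i \<noteq> j"
    and "e \<in> edges G \<Longrightarrow> ends G e = {i, j} \<Longrightarrow> i \<in> verts G \<and> j \<in> verts G"
  using assms by (auto simp: multigraph_def card_2_iff doubleton_eq_iff)

lemma edge_endsE:
  assumes "multigraph G" "e \<in> edges G"
  obtains i j where "ends G e = {i, j}" "i \<noteq> j" "i \<in> verts G" "j \<in> verts G"
  using assms multigraphD by (metis card_2_iff)

lemma edge_at_vertexE:
  assumes "multigraph G" "e \<in> edges G" "v \<in> ends G e"
  obtains w where "ends G e = {v, w}" "v \<noteq> w"
proof -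
  obtain i j where "ends G e = {i, j}" "i \<noteq> j" using edge_endsE[OF assms(1,2)] .
  then show thesis using that[of j] that[of i] assms(3) by (auto simp: insert_commute)
qed

lemma contract_simps [simp]:
  "verts (contract u v G) = verts G - {v}"
  "edges (contract u v G) = {e \<in> edges G. ends G e \<noteq> {u, v}}"
  "ends (contract u v G) e = (\<lambda>x. if x = v then u else x) ` ends G e"
  by (auto simp: contract_def)

lemma multigraph_delete_edge: "multigraph G \<Longrightarrow> multigraph (delete_edge e G)"
  by (auto simp: multigraph_def delete_edge_def)

lemma multigraph_delete_vertex: "multigraph G \<Longrightarrow> multigraph (delete_vertex v G)"
  by (auto simp: multigraph_def delete_vertex_def)

lemma multigraph_contract:
  assumes G: "multigraph G" and u: "u \<in> verts G" "u \<noteq> v"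
  shows "multigraph (contract u v G)"
  unfolding multigraph_def
proof (intro conjI ballI)
  fix e assume e: "e \<in> edges (contract u v G)"
  then obtain i j where ij: "ends G e = {i, j}" "i \<noteq> j" "i \<in> verts G" "j \<in> verts G"
    using edge_endsE[OF G, of e] by auto
  show "ends (contract u v G) e \<subseteq> verts (contract u v G)"
    using ij u by auto
  let ?r = "\<lambda>x. if x = v then u else x"
  have "{i, j} \<noteq> {u, v}" using e ij by auto
  then have "?r i \<noteq> ?r j" using ij u by auto
  then show "card (ends (contract u v G) e) = 2"
    unfolding contract_simps ij image_insert image_empty by (rule card_2_iff[THEN iffD2, OF exI, OF exI, OF conjI, OF refl])
qed (use multigraphD[OF G] in auto)

lemma multigraph_minor_step:
  assumes "minor_step G G'" "multigraph G"
  shows "multigraph G'"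
  using assms
proof cases
  case (3 e u v)
  then show ?thesis
    using assms(2) multigraphD(6)[OF assms(2)] by (auto intro!: multigraph_contract)
qed (use assms(2) in \<open>auto intro: multigraph_delete_edge multigraph_delete_vertex\<close>)

lemma multigraph_minor: "minor_step\<^sup>*\<^sup>* G G' \<Longrightarrow> multigraph G \<Longrightarrow> multigraph G'"
  by (induction rule: rtranclp_induct) (auto intro: multigraph_minor_step)

lemma has_minor_trans: "minor_step\<^sup>*\<^sup>* G G' \<Longrightarrow> has_minor G' H \<Longrightarrow> has_minor G H"
  unfolding has_minor_def by (meson rtranclp_trans)

section \<open>Subgraphs as minors\<close>

lemma delete_edges_minor:
  assumes "finite D" "D \<subseteq> edges G"
  shows "minor_step\<^sup>*\<^sup>* G (G\<lparr>edges := edges G - D\<rparr>)"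
  using assms
proof (induction D)
  case (insert e D)
  let ?G = "G\<lparr>edges := edges G - D\<rparr>"
  have "minor_step ?G (delete_edge e ?G)"
    using insert by (intro minor_step.intros(1)) auto
  moreover have "delete_edge e ?G = G\<lparr>edges := edges G - insert e D\<rparr>"
    by (intro mgraph.equality) (auto simp: delete_edge_def)
  ultimately show ?case using insert by (auto intro: rtranclp.rtrancl_into_rtrancl)
qed auto

lemma delete_vertices_minor:
  assumes "finite D" "D \<subseteq> verts G"
  shows "minor_step\<^sup>*\<^sup>* G (G\<lparr>verts := verts G - D, edges := {e \<in> edges G. ends G e \<inter> D = {}}\<rparr>)"
  using assms
proof (induction D)
  case (insert v D)
  let ?G = "G\<lparr>verts := verts G - D, edges := {e \<in> edges G. ends G e \<inter> D = {}}\<rparr>"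
  have "minor_step ?G (delete_vertex v ?G)"
    using insert by (intro minor_step.intros(2)) auto
  moreover have "delete_vertex v ?G
      = G\<lparr>verts := verts G - insert v D, edges := {e \<in> edges G. ends G e \<inter> insert v D = {}}\<rparr>"
    by (intro mgraph.equality) (auto simp: delete_vertex_def)
  ultimately show ?case using insert by (auto intro: rtranclp.rtrancl_into_rtrancl)
qed auto

lemma induced_simps [simp]:
  "verts (induced G W) = W"
  "edges (induced G W) = {e \<in> edges G. ends G e \<subseteq> W}"
  "ends (induced G W) = ends G"
  by (auto simp: induced_def)

lemma induced_minor:
  assumes G: "multigraph G" and W: "W \<subseteq> verts G"
  shows "minor_step\<^sup>*\<^sup>* G (induced G W)"
proof -
  have "G\<lparr>verts := verts G - (verts G - W), edges := {e \<in> edges G. ends G e \<inter> (verts G - W) = {}}\<rparr>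
      = induced G W"
    using W multigraphD(3)[OF G] by (intro mgraph.equality) (auto simp: induced_def)
  then show ?thesis
    using delete_vertices_minor[of "verts G - W" G] multigraphD(1)[OF G] by auto
qed

lemma subgraph_minor:
  assumes G: "multigraph G" and W: "W \<subseteq> verts G" and F: "F \<subseteq> edges G" "\<And>e. e \<in> F \<Longrightarrow> ends G e \<subseteq> W"
  shows "minor_step\<^sup>*\<^sup>* G (G\<lparr>verts := W, edges := F\<rparr>)"
proof -
  let ?H = "induced G W"
  have "?H\<lparr>edges := edges ?H - (edges ?H - F)\<rparr> = G\<lparr>verts := W, edges := F\<rparr>"
    using F by (intro mgraph.equality) (auto simp: induced_def)
  then have "minor_step\<^sup>*\<^sup>* ?H (G\<lparr>verts := W, edges := F\<rparr>)"
    using delete_edges_minor[of "edges ?H - F" ?H] multigraphD(2)[OF G] by auto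
  with induced_minor[OF G W] show ?thesis by simp
qed

section \<open>Connected branch sets and minor models\<close>

inductive grown :: "('v, 'e) mgraph \<Rightarrow> 'v set \<Rightarrow> bool" for G where
  single: "v \<in> verts G \<Longrightarrow> grown G {v}"
| add: "grown G W \<Longrightarrow> y \<in> W \<Longrightarrow> x \<notin> W \<Longrightarrow> e \<in> edges G \<Longrightarrow> ends G e = {y, x} \<Longrightarrow> grown G (insert x W)"

lemma grown_subset: "grown G W \<Longrightarrow> multigraph G \<Longrightarrow> W \<subseteq> verts G"
  by (induction rule: grown.induct) (auto dest: multigraphD(6))

text \<open>\<open>grown\<close> presents connected sets by the order in which vertices are
  attached, so that the vertex attached last can be contracted into its neighbour. The edges that
  built the rest avoid \<open>x\<close>, hence the contraction does not change them.\<close>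

lemma grown_contract:
  assumes "grown G W" "x \<notin> W"
  shows "grown (contract y x G) W"
  using assms
proof (induction rule: grown.induct)
  case (single v)
  then show ?case by (intro grown.single) auto
next
  case (add W z w e)
  then show ?case
    by (intro grown.add[of _ W z w e]) (auto simp: doubleton_eq_iff)
qed

text \<open>\<open>B\<close> gives the branch sets and \<open>g\<close> the chosen edges;
  \<open>g\<close> is injective because parallel edges of \<open>H\<close> need distinct edges of
  \<open>G\<close>.\<close>

definition minor_model ::
  "('v, 'e) mgraph \<Rightarrow> ('w, 'f) mgraph \<Rightarrow> ('w \<Rightarrow> 'v set) \<Rightarrow> ('f \<Rightarrow> 'e) \<Rightarrow> bool" where
  "minor_model G H B g \<longleftrightarrow>
     (\<forall>w\<in>verts H. grown G (B w)) \<and>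
     (\<forall>w\<in>verts H. \<forall>w'\<in>verts H. w \<noteq> w' \<longrightarrow> B w \<inter> B w' = {}) \<and>
     inj_on g (edges H) \<and> g ` edges H \<subseteq> edges G \<and>
     (\<forall>f\<in>edges H. \<exists>w w' a b. ends H f = {w, w'} \<and> w \<noteq> w' \<and> w \<in> verts H \<and> w' \<in> verts H \<and>
        ends G (g f) = {a, b} \<and> a \<in> B w \<and> b \<in> B w')"

text \<open>No contraction is left to perform: the chosen vertices and edges form a subgraph, and
  the inverses of \<open>h\<close> and \<open>g\<close> are the isomorphism.\<close>

lemma minor_model_singletons:
  assumes G: "multigraph G" and M: "minor_model G H B g"
    and h: "\<And>w. w \<in> verts H \<Longrightarrow> B w = {h w}"
  shows "has_minor G H"
proof -
  let ?W = "h ` verts H" and ?F = "g ` edges H"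
  let ?G = "G\<lparr>verts := ?W, edges := ?F\<rparr>"
  have gr: "grown G {h w}" if "w \<in> verts H" for w using M h that by (auto simp: minor_model_def)
  have inj: "inj_on h (verts H)" 
    using M h unfolding minor_model_def inj_on_def by (metis insert_disjoint(1) insertI1)
  have injg: "inj_on g (edges H)" using M by (auto simp: minor_model_def)
  have e: "ends G (g f) = h ` ends H f \<and> ends H f \<subseteq> verts H" if "f \<in> edges H" for f
  proof -
    obtain w w' a b where "ends H f = {w, w'}" "w \<in> verts H" "w' \<in> verts H"
        "ends G (g f) = {a, b}" "a \<in> B w" "b \<in> B w'"
      using M \<open>f \<in> edges H\<close> unfolding minor_model_def by meson
    then show ?thesis using h by auto
  qed
  have "minor_step\<^sup>*\<^sup>* G ?G"
  proof (rule subgraph_minor[OF G])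
    show "?W \<subseteq> verts G" using grown_subset[OF gr G] by auto
    show "?F \<subseteq> edges G" using M by (auto simp: minor_model_def)
    show "ends G x \<subseteq> ?W" if "x \<in> ?F" for x using that e by blast
  qed
  moreover have "mgraph_iso ?G H"
    unfolding mgraph_iso_def
  proof (intro exI conjI ballI)
    show "bij_betw (the_inv_into (verts H) h) (verts ?G) (verts H)"
      using inj by (simp add: bij_betw_the_inv_into inj_on_imp_bij_betw)
    show "bij_betw (the_inv_into (edges H) g) (edges ?G) (edges H)"
      using injg by (simp add: bij_betw_the_inv_into inj_on_imp_bij_betw)
    fix x assume "x \<in> edges ?G"
    then obtain f where f: "f \<in> edges H" "x = g f" by auto
    have "the_inv_into (verts H) h ` h ` ends H f = ends H f"
      using e[OF f(1)] inj by (force simp: image_image the_inv_into_f_f)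
    then show "ends H (the_inv_into (edges H) g x) = the_inv_into (verts H) h ` ends ?G x"
      using f e[OF f(1)] injg by (simp add: the_inv_into_f_f)
  qed
  ultimately show ?thesis unfolding has_minor_def by blast
qed

text \<open>Induction on the total size of the branch sets: in a branch set that is not a singleton,
  the vertex attached last is contracted into its neighbour.\<close>

lemma has_minor_if_model:
  assumes "multigraph G" "minor_model G H B g" "finite (verts H)"
  shows "has_minor G H"
  using assms
proof (induction "\<Sum>w\<in>verts H. card (B w)" arbitrary: G B rule: less_induct)
  case less
  note G = less.prems(1) and M = less.prems(2)
  show ?case
  proof (cases "\<forall>w\<in>verts H. \<exists>v. B w = {v}")
    case True
    then obtain h where "\<And>w. w \<in> verts H \<Longrightarrow> B w = {h w}" by metis
    then show ?thesis using minor_model_singletons[OF G M] by blast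
  next
    case False
    then obtain w0 where w0: "w0 \<in> verts H" "\<And>v. B w0 \<noteq> {v}" by blast
    have "grown G (B w0)" using M w0 by (auto simp: minor_model_def)
    then obtain W y x e where W: "B w0 = insert x W" "grown G W" "y \<in> W" "x \<notin> W"
        "e \<in> edges G" "ends G e = {y, x}"
      using w0(2) by (cases rule: grown.cases) auto
    let ?G = "contract y x G" and ?B = "B(w0 := W)"
    have st: "minor_step G ?G" using W by (intro minor_step.intros(3)[of e]) auto
    have finB: "finite (B w)" if "w \<in> verts H" for w
      using M that grown_subset[OF _ G] multigraphD(1)[OF G]
      by (metis minor_model_def finite_subset)
    have dis: "B w \<inter> B w' = {}" if "w \<in> verts H" "w' \<in> verts H" "w \<noteq> w'" for w w'
      using M that by (simp add: minor_model_def)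
    have nx: "x \<notin> B w" if "w \<in> verts H" "w \<noteq> w0" for w
      using dis[of w w0] that w0(1) W(1) by auto
    have ny: "y \<notin> B w" if "w \<in> verts H" "w \<noteq> w0" for w
      using dis[of w w0] that w0(1) W(1,3) by auto
    have "card (?B w0) < card (B w0)" using W finB[OF w0(1)] by (simp add: card_insert_disjoint)
    then have less': "(\<Sum>w\<in>verts H. card (?B w)) < (\<Sum>w\<in>verts H. card (B w))"
      using less.prems(3) w0 by (intro sum_strict_mono_ex1) (auto intro!: bexI[of _ w0])
    have "minor_model ?G H ?B g"
      unfolding minor_model_def
    proof (intro conjI ballI impI)
      fix w assume w: "w \<in> verts H"
      then show "grown ?G (?B w)"
        using M W nx by (auto simp: minor_model_def intro!: grown_contract)
      fix w' assume "w' \<in> verts H" "w \<noteq> w'"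
      then show "?B w \<inter> ?B w' = {}"
        using dis[of w w'] w W(1) by auto
    next
      show "inj_on g (edges H)" using M by (simp add: minor_model_def)
    next
      show "g ` edges H \<subseteq> edges ?G"
      proof
        fix z assume "z \<in> g ` edges H"
        then obtain f where f: "f \<in> edges H" "z = g f" by auto
        then obtain w w' a b where ww: "w \<noteq> w'" "w \<in> verts H" "w' \<in> verts H"
            "ends G (g f) = {a, b}" "a \<in> B w" "b \<in> B w'"
          using M unfolding minor_model_def by meson
        \<comment> \<open>Both \<open>x\<close> and \<open>y\<close> belong to \<open>B w0\<close>
          alone, whereas a chosen edge joins two branch sets, so the contraction does not delete
          it.\<close>
        then have "{a, b} \<noteq> {y, x}"
          using nx ny by (metis doubleton_eq_iff)
        then show "z \<in> edges ?G" using f ww M by (auto simp: minor_model_def)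
      qed
    next
      fix f assume "f \<in> edges H"
      then obtain w w' a b where ww: "ends H f = {w, w'}" "w \<noteq> w'" "w \<in> verts H" "w' \<in> verts H"
            "ends G (g f) = {a, b}" "a \<in> B w" "b \<in> B w'"
          using M unfolding minor_model_def by meson
      let ?r = "\<lambda>z. if z = x then y else z"
      have r: "?r c \<in> ?B v" if "c \<in> B v" "v \<in> verts H" for c v
        using that W nx by auto
      have "ends ?G (g f) = {?r a, ?r b}" using ww by auto
      then show "\<exists>w w' a b. ends H f = {w, w'} \<and> w \<noteq> w' \<and> w \<in> verts H \<and> w' \<in> verts H \<and>
        ends ?G (g f) = {a, b} \<and> a \<in> ?B w \<and> b \<in> ?B w'"
        using ww r by blast
    qed
    then have "has_minor ?G H"
      using less.hyps[OF less' multigraph_minor_step[OF st G]] less.prems(3) by blast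
    then show ?thesis using st has_minor_trans by blast
  qed
qed

definition linked :: "('v, 'e) mgraph \<Rightarrow> 'v set \<Rightarrow> 'v set \<Rightarrow> 'e \<Rightarrow> bool" where
  "linked G A B e \<longleftrightarrow> e \<in> edges G \<and> (\<exists>a\<in>A. \<exists>b\<in>B. ends G e = {a, b})"

text \<open>Disjoint bags make an edge reveal which two bags it joins. Edges chosen for different
  pairs of bags therefore differ automatically, and only parallel edges need separate care.\<close>

lemma linked_bags:
  assumes "linked G (B w) (B w') e" "w \<in> W" "w' \<in> W"
    and "\<And>v v'. v \<in> W \<Longrightarrow> v' \<in> W \<Longrightarrow> v \<noteq> v' \<Longrightarrow> B v \<inter> B v' = {}"
  shows "{v \<in> W. B v \<inter> ends G e \<noteq> {}} = {w, w'}"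
proof -
  obtain a b where ab: "a \<in> B w" "b \<in> B w'" "ends G e = {a, b}"
    using assms(1) by (auto simp: linked_def)
  have "v = w" if "v \<in> W" "a \<in> B v" for v using assms(4)[of v w] that ab assms(2) by blast
  moreover have "v = w'" if "v \<in> W" "b \<in> B v" for v using assms(4)[of v w'] that ab assms(3) by blast
  ultimately show ?thesis using ab(1,2) assms(2,3) unfolding ab(3) by blast
qed

lemma has_minor_if_linked:
  assumes G: "multigraph G" and fin: "finite (verts H)"
    and B: "\<And>w. w \<in> verts H \<Longrightarrow> grown G (B w)"
    and dis: "\<And>w w'. w \<in> verts H \<Longrightarrow> w' \<in> verts H \<Longrightarrow> w \<noteq> w' \<Longrightarrow> B w \<inter> B w' = {}"
    and link: "\<And>f. f \<in> edges H \<Longrightarrow> \<exists>w\<in>verts H. \<exists>w'\<in>verts H.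
      w \<noteq> w' \<and> ends H f = {w, w'} \<and> linked G (B w) (B w') (g f)"
    and par: "\<And>f f'. f \<in> edges H \<Longrightarrow> f' \<in> edges H \<Longrightarrow> ends H f = ends H f' \<Longrightarrow> g f = g f' \<Longrightarrow> f = f'"
  shows "has_minor G H"
proof -
  have eq: "{v \<in> verts H. B v \<inter> ends G (g f) \<noteq> {}} = ends H f" if f: "f \<in> edges H" for f
  proof -
    obtain w w' where w: "w \<in> verts H" "w' \<in> verts H" "ends H f = {w, w'}" "linked G (B w) (B w') (g f)"
      using link[OF f] by blast
    show ?thesis using linked_bags[of G B w w' "g f" "verts H"] w dis by auto
  qed
  have "minor_model G H B g"
    unfolding minor_model_def
  proof (intro conjI ballI impI)
    show "inj_on g (edges H)"
    proof (rule inj_onI)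
      fix f f' assume f: "f \<in> edges H" "f' \<in> edges H" "g f = g f'"
      then have "ends H f = ends H f'" using eq[of f] eq[of f'] by simp
      then show "f = f'" using par f by blast
    qed
    show "g ` edges H \<subseteq> edges G" using link unfolding linked_def by blast
    fix f assume "f \<in> edges H"
    then show "\<exists>w w' a b. ends H f = {w, w'} \<and> w \<noteq> w' \<and> w \<in> verts H \<and> w' \<in> verts H \<and>
        ends G (g f) = {a, b} \<and> a \<in> B w \<and> b \<in> B w'"
      using link unfolding linked_def by meson
  qed (use B dis in auto)
  then show ?thesis using has_minor_if_model[OF G _ fin] by blast
qed

lemma nat_pairE:
  assumes "card X = 2" "X \<subseteq> {..<k :: nat}"
  obtains i j where "X = {i, j}" "i < j" "j < k"
proof -
  obtain i j where "X = {i, j}" "i \<noteq> j" using assms(1) by (auto simp: card_2_iff)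
  then show thesis using that[of i j] that[of j i] assms(2) by (cases "i < j") (auto simp: insert_commute)
qed

lemma disjoint_nat_family:
  assumes "\<And>i j. i < j \<Longrightarrow> j < k \<Longrightarrow> B i \<inter> B j = {}" "i < k" "j < k" "i \<noteq> (j :: nat)"
  shows "B i \<inter> B j = {}"
  using assms(1)[of i j] assms(1)[of j i] assms(2-4) by (cases "i < j") auto

lemma has_K4_minor:
  assumes G: "multigraph G"
    and B: "\<And>i. i < 4 \<Longrightarrow> grown G (B i)"
    and dis: "\<And>i j. i < j \<Longrightarrow> j < 4 \<Longrightarrow> B i \<inter> B j = {}"
    and link: "\<And>i j. i < j \<Longrightarrow> j < (4 :: nat) \<Longrightarrow> \<exists>e. linked G (B i) (B j) e"
  shows "has_minor G K4"
proof -
  have "\<exists>e. \<exists>i<4. \<exists>j<4. i \<noteq> j \<and> X = {i, j} \<and> linked G (B i) (B j) e" if X: "X \<in> edges K4" for X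
  proof -
    obtain i j where ij: "X = {i, j}" "i < j" "j < 4" using X by (auto simp: K4_def elim: nat_pairE)
    obtain e where "linked G (B i) (B j) e" using link[OF ij(2,3)] by blast
    then show ?thesis using ij by (intro exI[of _ e] exI[of _ i] conjI exI[of _ j]) simp_all
  qed
  then obtain g where g: "\<And>X. X \<in> edges K4 \<Longrightarrow>
      \<exists>i<4. \<exists>j<4. i \<noteq> j \<and> X = {i, j} \<and> linked G (B i) (B j) (g X)" by metis
  have K: "verts K4 = {..<4}" "ends K4 = (\<lambda>X. X)" by (simp_all add: K4_def)
  show ?thesis
  proof (rule has_minor_if_linked[OF G, of _ B g])
    fix X assume "X \<in> edges K4"
    from g[OF this] show "\<exists>w\<in>verts K4. \<exists>w'\<in>verts K4.
        w \<noteq> w' \<and> ends K4 X = {w, w'} \<and> linked G (B w) (B w') (g X)"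
      unfolding K by blast
  qed (use B disjoint_nat_family[of 4 B] dis in \<open>auto simp: K\<close>)
qed

lemma has_doubled_K3_minor:
  assumes G: "multigraph G"
    and B: "\<And>i. i < 3 \<Longrightarrow> grown G (B i)"
    and dis: "\<And>i j. i < j \<Longrightarrow> j < 3 \<Longrightarrow> B i \<inter> B j = {}"
    and link: "\<And>i j. i < j \<Longrightarrow> j < (3 :: nat) \<Longrightarrow>
      \<exists>e e'. e \<noteq> e' \<and> linked G (B i) (B j) e \<and> linked G (B i) (B j) e'"
  shows "has_minor G doubled_K3"
proof -
  let ?E = "{X. X \<subseteq> {..<3 :: nat} \<and> card X = 2}"
  have "\<exists>e e'. e \<noteq> e' \<and>
      (\<exists>i<3. \<exists>j<3. i \<noteq> j \<and> X = {i, j} \<and> linked G (B i) (B j) e \<and> linked G (B i) (B j) e')"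
    if X: "X \<in> ?E" for X
  proof -
    obtain i j where ij: "X = {i, j}" "i < j" "j < 3" using X by (auto elim: nat_pairE)
    obtain e e' where "e \<noteq> e'" "linked G (B i) (B j) e" "linked G (B i) (B j) e'"
      using link[OF ij(2,3)] by blast
    then show ?thesis using ij by (intro exI[of _ e] exI[of _ e'] conjI exI[of _ i] exI[of _ j]) simp_all
  qed
  then obtain g1 g2 where g12: "\<And>X. X \<in> ?E \<Longrightarrow> g1 X \<noteq> g2 X \<and> (\<exists>i<3. \<exists>j<3. i \<noteq> j \<and> X = {i, j} \<and>
      linked G (B i) (B j) (g1 X) \<and> linked G (B i) (B j) (g2 X))" by metis
  define g where "g f = (if snd f then g1 (fst f) else g2 (fst f))" for f
  have K: "verts doubled_K3 = {..<3}" "edges doubled_K3 = ?E \<times> UNIV" "ends doubled_K3 = fst"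
    by (simp_all add: doubled_K3_def)
  show ?thesis
  proof (rule has_minor_if_linked[OF G, of _ B g])
    fix f assume f: "f \<in> edges doubled_K3"
    then have "fst f \<in> ?E" by (auto simp: K)
    from g12[OF this] show "\<exists>w\<in>verts doubled_K3. \<exists>w'\<in>verts doubled_K3.
        w \<noteq> w' \<and> ends doubled_K3 f = {w, w'} \<and> linked G (B w) (B w') (g f)"
      unfolding K g_def by (cases "snd f") auto
    fix f' assume "ends doubled_K3 f = ends doubled_K3 f'" "g f = g f'"
    moreover have "g1 (fst f) \<noteq> g2 (fst f)" using g12[OF \<open>fst f \<in> ?E\<close>] by blast
    ultimately show "f = f'" by (auto simp: K g_def prod_eq_iff split: if_splits)
  qed (use B disjoint_nat_family[of 3 B] dis in \<open>auto simp: K\<close>)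
qed

section \<open>Longest paths and minimum degree three\<close>

lemma adjacent_commute: "adjacent G u v \<longleftrightarrow> adjacent G v u"
  by (simp add: adjacent_def insert_commute)

lemma adjacentD:
  assumes "multigraph G" "adjacent G u v"
  shows "u \<noteq> v" "u \<in> verts G" "v \<in> verts G"
  using assms multigraphD(5,6)[OF assms(1)] by (auto simp: adjacent_def)

lemma adjacent_linked: "adjacent G a b \<Longrightarrow> a \<in> A \<Longrightarrow> b \<in> B \<Longrightarrow> \<exists>e. linked G A B e"
  by (auto simp: adjacent_def linked_def)

definition simple_path :: "('v, 'e) mgraph \<Rightarrow> nat \<Rightarrow> (nat \<Rightarrow> 'v) \<Rightarrow> bool" where
  "simple_path G n f \<longleftrightarrow> inj_on f {..<n} \<and> f ` {..<n} \<subseteq> verts G \<and>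
     (\<forall>t. Suc t < n \<longrightarrow> adjacent G (f t) (f (Suc t)))"

lemma grown_segment:
  assumes f: "simple_path G n f" and "p \<le> q" "q < n"
  shows "grown G (f ` {p..q})"
  using assms(2,3)
proof (induction q rule: dec_induct)
  case base
  then show ?case using f by (auto simp: simple_path_def intro!: grown.single)
next
  case (step q)
  have "f ` {p..Suc q} = insert (f (Suc q)) (f ` {p..q})"
    using step by (simp add: atLeastAtMostSuc_conv)
  moreover have "f (Suc q) \<notin> f ` {p..q}"
    using f step.prems inj_on_image_mem_iff[of f "{..<n}" "Suc q" "{p..q}"]
    by (force simp: simple_path_def)
  moreover obtain e where "e \<in> edges G" "ends G e = {f q, f (Suc q)}"
    using f step by (auto simp: simple_path_def adjacent_def)
  ultimately show ?case
    using step by (auto intro!: grown.add[of _ _ "f q" _ e])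
qed

text \<open>All neighbours of the start of a longest path lie on the path. Choose a chord from
  \<open>f 0\<close> to \<open>f i\<close> with \<open>i > 1\<close> least. A third neighbour of
  \<open>f 0\<close> lies beyond \<open>f i\<close>, and so does a third neighbour of
  \<open>f (i - 1)\<close>, which starts the path obtained by reversing the initial segment. Four
  consecutive segments of the path are then the branch sets.\<close>

lemma K4_minor_if_degrees_ge_3:
  assumes G: "multigraph G" and ne: "verts G \<noteq> {}"
    and deg: "\<And>v. v \<in> verts G \<Longrightarrow> card {u. adjacent G v u} \<ge> 3"
  shows "has_minor G K4"
proof -
  have other: "\<exists>u. adjacent G v u \<and> u \<noteq> a \<and> u \<noteq> b" if "v \<in> verts G" for v a b
  proof (rule ccontr)
    assume "\<not> ?thesis"
    then have "{u. adjacent G v u} \<subseteq> {a, b}" by auto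
    then have "card {u. adjacent G v u} \<le> card {a, b}" by (intro card_mono) auto
    also have "\<dots> \<le> 2" by (simp add: card_insert_if)
    finally show False using deg[OF that] by simp
  qed
  have bound: "n \<le> card (verts G)" if "simple_path G n f" for n f
    using that card_inj_on_le[of f "{..<n}" "verts G"] multigraphD(1)[OF G] by (auto simp: simple_path_def)
  obtain v0 where "v0 \<in> verts G" using ne by blast
  then have "\<exists>f. simple_path G 1 f" by (intro exI[of _ "\<lambda>_. v0"]) (auto simp: simple_path_def inj_on_def)
  then obtain n where n: "\<exists>f. simple_path G n f" and max: "\<And>k f. simple_path G k f \<Longrightarrow> k \<le> n" and n1: "n \<ge> 1"
    using Greatest_le_nat[of "\<lambda>n. \<exists>f. simple_path G n f" _ "card (verts G)"]
      GreatestI_nat[of "\<lambda>n. \<exists>f. simple_path G n f" _ "card (verts G)"] bound by metis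
  have nbr: "\<exists>t<n. u = f t" if f: "simple_path G n f" and u: "adjacent G (f 0) u" for f u
  proof (rule ccontr)
    assume no: "\<not> ?thesis"
    let ?f = "case_nat u f"
    have "simple_path G (Suc n) ?f"
      unfolding simple_path_def
    proof (intro conjI allI impI)
      show "inj_on ?f {..<Suc n}"
        using f no unfolding inj_on_def simple_path_def by (auto split: nat.splits)
      show "?f ` {..<Suc n} \<subseteq> verts G"
        using f adjacentD(3)[OF G u] by (fastforce simp: simple_path_def split: nat.splits)
      fix t assume "Suc t < Suc n"
      then show "adjacent G (?f t) (?f (Suc t))"
        using f u by (cases t) (auto simp: simple_path_def adjacent_commute)
    qed
    then show False using max by fastforce
  qed
  \<comment> \<open>The minimum ranges over all longest paths at once, since it is also applied to
    the reversed path \<open>h\<close>.\<close>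
  let ?P = "\<lambda>i. \<exists>f. simple_path G n f \<and> 1 < i \<and> i < n \<and> adjacent G (f 0) (f i)"
  have "\<exists>i. ?P i"
  proof -
    obtain f where f: "simple_path G n f" using n by blast
    then have "f 0 \<in> verts G" using n1 by (auto simp: simple_path_def)
    then obtain u where u: "adjacent G (f 0) u" "u \<noteq> f 1" using other by blast
    then obtain t where t: "t < n" "u = f t" using nbr[OF f] by blast
    then have "t \<noteq> 0" "t \<noteq> 1" using u adjacentD(1)[OF G u(1)] by metis+
    then show ?thesis using f u t by (intro exI[of _ t] exI[of _ f]) auto
  qed
  define i where "i = (LEAST i. ?P i)"
  have imin: "i \<le> k" if "?P k" for k unfolding i_def by (rule Least_le) (fact that)
  have "?P i" unfolding i_def by (rule LeastI_ex) fact
  then obtain f where f: "simple_path G n f" and i: "1 < i" "i < n" "adjacent G (f 0) (f i)" by blast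
  have inj: "inj_on f {..<n}" and fV: "\<And>t. t < n \<Longrightarrow> f t \<in> verts G"
    and adj: "\<And>t. Suc t < n \<Longrightarrow> adjacent G (f t) (f (Suc t))"
    using f by (auto simp: simple_path_def)
  obtain j where j: "i < j" "j < n" "adjacent G (f 0) (f j)"
  proof -
    obtain u where u: "adjacent G (f 0) u" "u \<noteq> f 1" "u \<noteq> f i" using other[of "f 0"] fV i by fastforce
    then obtain t where t: "t < n" "u = f t" using nbr[OF f] by blast
    then have "t \<noteq> 0" "t \<noteq> 1" "t \<noteq> i" using u adjacentD(1)[OF G u(1)] by metis+
    moreover from this have "i \<le> t" using u t f by (intro imin exI[of _ f]) auto
    ultimately show thesis using that[of t] u t by auto
  qed
  \<comment> \<open>Reversing the initial segment gives another longest path, which starts in \<open>f (i - 1)\<close>.\<close>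
  define h where "h t = (if t < i then f (i - 1 - t) else f t)" for t
  have h: "simple_path G n h"
    unfolding simple_path_def
  proof (intro conjI allI impI)
    have "inj_on (\<lambda>t. if t < i then i - 1 - t else t) {..<n}"
      using i by (auto simp: inj_on_def split: if_splits)
    then have "inj_on (f \<circ> (\<lambda>t. if t < i then i - 1 - t else t)) {..<n}"
      using i by (intro comp_inj_on inj_on_subset[OF inj]) auto
    then show "inj_on h {..<n}" by (rule inj_on_cong[THEN iffD1, rotated]) (auto simp: h_def)
    show "h ` {..<n} \<subseteq> verts G" using fV i by (auto simp: h_def)
    fix t assume t: "Suc t < n"
    consider "Suc t < i" | "Suc t = i" | "t \<ge> i" by linarith
    then show "adjacent G (h t) (h (Suc t))"
    proof cases
      case 1
      then have "i - 1 - t = Suc (i - 1 - Suc t)" by simp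
      then show ?thesis using adj[of "i - 1 - Suc t"] 1 i by (simp add: h_def adjacent_commute)
    next
      case 2
      then have "t < i" "i - 1 - t = 0" by auto
      then show ?thesis using 2 i by (simp add: h_def)
    qed (use adj t in \<open>auto simp: h_def\<close>)
  qed
  have h0: "h 0 = f (i - 1)" using i by (simp add: h_def)
  obtain a where a: "i < a" "a < n" "adjacent G (f (i - 1)) (f a)"
  proof -
    obtain u where u: "adjacent G (f (i - 1)) u" "u \<noteq> f (i - 2)" "u \<noteq> f i"
      using other[of "f (i - 1)"] fV i by fastforce
    then obtain t where t: "t < n" "u = h t" using nbr[OF h] h0 by auto
    have "t \<noteq> 0" using u t h0 adjacentD(1)[OF G u(1)] by metis
    moreover have "t \<noteq> 1" using u t i by (auto simp: h_def numeral_2_eq_2)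
    ultimately have "i \<le> t" using u t h h0 by (intro imin exI[of _ h]) auto
    moreover have "t \<noteq> i" using u t by (auto simp: h_def)
    ultimately show thesis using that[of t] u t by (auto simp: h_def)
  qed
  \<comment> \<open>\<open>f j\<close> is adjacent to \<open>f 0\<close>, and \<open>f a\<close> to
    \<open>f (i - 1)\<close>. Cutting at the smaller of the two indices puts both into the last
    segment and leaves \<open>f i\<close> in the third.\<close>
  define m where "m = min a j"
  define I where "I k = (if k = 0 then {0..i - 2} else if k = 1 then {i - 1..i - 1}
      else if k = 2 then {i..m - 1} else {m..max a j})" for k :: nat
  have m: "i < m" "m \<le> a" "m \<le> j" using a j by (auto simp: m_def)
  have sub: "I k \<subseteq> {..<n}" for k using m a j i by (auto simp: I_def)
  have in_image: "t \<in> I k \<Longrightarrow> f t \<in> f ` I k" for t k by blast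
  show ?thesis
  proof (rule has_K4_minor[OF G, of "\<lambda>k. f ` I k"])
    show "grown G (f ` I k)" for k
      using m a j i unfolding I_def by (auto simp del: atLeastAtMost_singleton intro!: grown_segment[OF f])
    fix k l :: nat assume kl: "k < l" "l < 4"
    then have "I k \<inter> I l = {}" using m i unfolding I_def by auto
    then show "f ` I k \<inter> f ` I l = {}"
      using inj_on_image_Int[OF inj, of "I k" "I l"] sub by simp
    consider "k = 0" "l = 1" | "k = 0" "l = 2" | "k = 0" "l = 3" | "k = 1" "l = 2" | "k = 1" "l = 3"
      | "k = 2" "l = 3" using kl by linarith
    then obtain s t where "s \<in> I k" "t \<in> I l" "adjacent G (f s) (f t)"
    proof cases
      case 1
      then show ?thesis using that[of "i - 2" "i - 1"] adj[of "i - 2"] i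
        by (simp add: I_def numeral_2_eq_2 Suc_diff_Suc)
    next
      case 2
      then show ?thesis using that[of 0 i] i m by (simp add: I_def)
    next
      case 3
      then show ?thesis using that[of 0 j] i j m by (simp add: I_def)
    next
      case 4
      then show ?thesis using that[of "i - 1" i] adj[of "i - 1"] i m by (simp add: I_def)
    next
      case 5
      then show ?thesis using that[of "i - 1" a] a m by (simp add: I_def)
    next
      case 6
      then show ?thesis using that[of "m - 1" m] adj[of "m - 1"] a m by (simp add: I_def)
    qed
    then show "\<exists>e. linked G (f ` I k) (f ` I l) e" using adjacent_linked in_image by metis
  qed
qed

section \<open>Embeddings of graphs into the line\<close>

text \<open>Distinct vertices may have distance 0, as placements need not be injective. The function
  lives on the whole type, so the same \<open>d\<close> serves all minors of a graph.\<close>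

definition pseudometric :: "('v \<Rightarrow> 'v \<Rightarrow> real) \<Rightarrow> bool" where
  "pseudometric d \<longleftrightarrow> (\<forall>x. d x x = 0) \<and> (\<forall>x y. d x y = d y x) \<and> (\<forall>x y z. d x z \<le> d x y + d y z)"

definition fits :: "bool \<Rightarrow> real \<Rightarrow> real \<Rightarrow> bool" where
  "fits b l x \<longleftrightarrow> (if b then x \<le> l else l \<le> x)"

definition line_embedding ::
  "('v, 'e) mgraph \<Rightarrow> ('e \<Rightarrow> bool) \<Rightarrow> ('v \<Rightarrow> 'v \<Rightarrow> real) \<Rightarrow> ('v \<Rightarrow> real) \<Rightarrow> bool" where
  "line_embedding G \<sigma> d s \<longleftrightarrow>
     (\<forall>e\<in>edges G. \<forall>i j. ends G e = {i, j} \<longrightarrow> fits (\<sigma> e) (d i j) \<bar>s i - s j\<bar>)"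

definition line_realizable :: "('v, 'e) mgraph \<Rightarrow> bool" where
  "line_realizable G \<longleftrightarrow> (\<forall>\<sigma> d. pseudometric d \<longrightarrow> (\<exists>s. line_embedding G \<sigma> d s))"

lemma pseudometricD:
  assumes "pseudometric d"
  shows "d x x = 0" "d x y = d y x" "d x z \<le> d x y + d y z" "0 \<le> d x y"
proof -
  show "d x x = 0" "d x y = d y x" "d x z \<le> d x y + d y z" for x y z
    using assms by (auto simp: pseudometric_def)
  then have "0 \<le> d x y + d x y" by metis
  then show "0 \<le> d x y" by simp
qed

lemma fits_sym: "pseudometric d \<Longrightarrow> fits b (d i j) \<bar>s i - s j\<bar> \<longleftrightarrow> fits b (d j i) \<bar>s j - s i\<bar>"
  by (metis abs_minus_commute pseudometricD(2))

lemma line_embeddingI: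
  assumes "multigraph G" "pseudometric d"
    and "\<And>e. e \<in> edges G \<Longrightarrow> \<exists>i j. ends G e = {i, j} \<and> fits (\<sigma> e) (d i j) \<bar>s i - s j\<bar>"
  shows "line_embedding G \<sigma> d s"
  unfolding line_embedding_def
proof (intro ballI allI impI)
  fix e i j assume e: "e \<in> edges G" "ends G e = {i, j}"
  then obtain i' j' where "{i', j'} = {i, j}" "fits (\<sigma> e) (d i' j') \<bar>s i' - s j'\<bar>"
    using assms(3)[OF e(1)] by metis
  then show "fits (\<sigma> e) (d i j) \<bar>s i - s j\<bar>"
    using fits_sym[OF assms(2)] by (metis doubleton_eq_iff)
qed

lemma line_embeddingD:
  "line_embedding G \<sigma> d s \<Longrightarrow> e \<in> edges G \<Longrightarrow> ends G e = {i, j} \<Longrightarrow> fits (\<sigma> e) (d i j) \<bar>s i - s j\<bar>"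
  by (auto simp: line_embedding_def)

text \<open>With \<open>v\<close> at distance exactly \<open>d v u0\<close> from \<open>u0\<close>,
  every edge at \<open>v\<close> is satisfied whatever its sign.\<close>

lemma line_realizable_pendant:
  assumes G: "multigraph G" and v: "v \<in> verts G" "\<And>u. adjacent G v u \<Longrightarrow> u = u0"
    and L: "line_realizable (delete_vertex v G)"
  shows "line_realizable G"
  unfolding line_realizable_def
proof (intro allI impI)
  fix \<sigma> and d :: "'a \<Rightarrow> 'a \<Rightarrow> real" assume d: "pseudometric d"
  then obtain s where s: "line_embedding (delete_vertex v G) \<sigma> d s"
    using L by (auto simp: line_realizable_def)
  let ?s = "s(v := s u0 + d v u0)"
  have "line_embedding G \<sigma> d ?s"
  proof (rule line_embeddingI[OF G d])
    fix e assume e: "e \<in> edges G"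
    show "\<exists>i j. ends G e = {i, j} \<and> fits (\<sigma> e) (d i j) \<bar>?s i - ?s j\<bar>"
    proof (cases "v \<in> ends G e")
      case True
      then obtain u where u: "ends G e = {v, u}" "v \<noteq> u"
        by (rule edge_at_vertexE[OF G e])
      then have "u = u0" using v(2) e by (auto simp: adjacent_def)
      then show ?thesis
        using u pseudometricD(4)[OF d] by (intro exI[of _ v] exI[of _ u]) (auto simp: fits_def)
    next
      case False
      obtain i j where ij: "ends G e = {i, j}" using edge_endsE[OF G e] by metis
      have "fits (\<sigma> e) (d i j) \<bar>s i - s j\<bar>"
        using False e ij by (intro line_embeddingD[OF s]) (auto simp: delete_vertex_def)
      moreover have "i \<noteq> v" "j \<noteq> v" using False ij by auto
      ultimately show ?thesis using ij by (intro exI[of _ i] exI[of _ j] conjI) simp_all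
    qed
  qed
  then show "\<exists>s. line_embedding G \<sigma> d s" by blast
qed

text \<open>Here \<open>A\<close> and \<open>B\<close> are the positions of the neighbours \<open>u\<close> and \<open>x\<close> of a vertex that was contracted
  into \<open>x\<close>, and \<open>t\<close> is the new position of that vertex. The set \<open>F\<close> consists of the edges to \<open>u\<close>.\<close>

lemma position_of_degree_two_vertex:
  fixes a b c :: real
  assumes tri: "c \<le> a + b" "a \<le> b + c" "b \<le> a + c" and F: "F \<noteq> {}"
  obtains \<sigma>' where
    "\<And>A B. (\<And>e. e \<in> F \<Longrightarrow> fits (\<sigma>' e) c \<bar>A - B\<bar>) \<Longrightarrow>
       \<exists>t. (\<forall>e\<in>F. fits (\<sigma> e) a \<bar>t - A\<bar>) \<and> fits \<beta> b \<bar>t - B\<bar>"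
proof (cases "(\<exists>e\<in>F. \<sigma> e) \<and> (\<exists>e\<in>F. \<not> \<sigma> e)")
  \<comment> \<open>Opposite signs on \<open>F\<close> force the distance of \<open>A\<close> and
    \<open>B\<close> to be exactly \<open>c\<close>, so \<open>t\<close> can lie at distance exactly
    \<open>a\<close> from \<open>A\<close>, towards \<open>B\<close> or away from it as
    \<open>\<beta>\<close> demands.\<close>
  case True
  show thesis
  proof (rule that[of \<sigma>])
    fix A B assume *: "\<And>e. e \<in> F \<Longrightarrow> fits (\<sigma> e) c \<bar>A - B\<bar>"
    then have c: "\<bar>A - B\<bar> = c" using True unfolding fits_def by (metis order_antisym)
    define \<epsilon> :: real where "\<epsilon> = (if \<beta> \<longleftrightarrow> A \<le> B then 1 else -1)"
    have "\<bar>A + \<epsilon> * a - A\<bar> = a" using tri by (auto simp: \<epsilon>_def)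
    moreover have "fits \<beta> b \<bar>A + \<epsilon> * a - B\<bar>"
      using tri c by (auto simp: \<epsilon>_def fits_def)
    ultimately show "\<exists>t. (\<forall>e\<in>F. fits (\<sigma> e) a \<bar>t - A\<bar>) \<and> fits \<beta> b \<bar>t - B\<bar>"
      by (intro exI[of _ "A + \<epsilon> * a"]) (auto simp: fits_def)
  qed
next
  case False
  then consider (plus) "\<forall>e\<in>F. \<sigma> e" | (minus) "\<forall>e\<in>F. \<not> \<sigma> e" by blast
  then show thesis
  proof cases
    \<comment> \<open>If \<open>\<beta>\<close> is an upper bound, the intervals around
      \<open>A\<close> and \<open>B\<close> meet because \<open>c \<le> a + b\<close>; otherwise
      \<open>t\<close> lies at distance \<open>a\<close> from \<open>A\<close> on the side away from
      \<open>B\<close>.\<close>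
    case plus
    show thesis
    proof (rule that[of "\<lambda>_. \<beta>"])
      fix A B assume *: "\<And>e. e \<in> F \<Longrightarrow> fits \<beta> c \<bar>A - B\<bar>"
      then have c: "fits \<beta> c \<bar>A - B\<bar>" using F by blast
      have "\<exists>t. \<bar>t - A\<bar> \<le> a \<and> fits \<beta> b \<bar>t - B\<bar>"
      proof (cases \<beta>)
        case True
        then have "\<bar>A - B\<bar> \<le> a + b" using c tri by (simp add: fits_def)
        then have "\<exists>t. \<bar>t - A\<bar> \<le> a \<and> \<bar>t - B\<bar> \<le> b"
          using tri by (intro exI[of _ "if A \<le> B then min B (A + a) else max B (A - a)"]) auto
        then show ?thesis using True by (simp add: fits_def)
      next
        case False
        then show ?thesis using c tri
          by (intro exI[of _ "if A \<le> B then A - a else A + a"]) (auto simp: fits_def)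
      qed
      then show "\<exists>t. (\<forall>e\<in>F. fits (\<sigma> e) a \<bar>t - A\<bar>) \<and> fits \<beta> b \<bar>t - B\<bar>"
        using plus by (auto simp: fits_def)
    qed
  next
    \<comment> \<open>Here \<open>t\<close> lies at distance exactly \<open>b\<close> from
      \<open>B\<close>, beyond \<open>B\<close> as seen from \<open>A\<close>, which suits either
      value of \<open>\<beta>\<close>.\<close>
    case minus
    show thesis
    proof (rule that[of "\<lambda>_. False"])
      fix A B assume *: "\<And>e. e \<in> F \<Longrightarrow> fits False c \<bar>A - B\<bar>"
      then have c: "c \<le> \<bar>A - B\<bar>" using F by (auto simp: fits_def)
      have "\<exists>t. a \<le> \<bar>t - A\<bar> \<and> fits \<beta> b \<bar>t - B\<bar>"
        using c tri by (intro exI[of _ "if A \<le> B then B + b else B - b"]) (auto simp: fits_def)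
      then show "\<exists>t. (\<forall>e\<in>F. fits (\<sigma> e) a \<bar>t - A\<bar>) \<and> fits \<beta> b \<bar>t - B\<bar>"
        using minus by (auto simp: fits_def)
    qed
  qed
qed

text \<open>The contraction turns the edges between \<open>u\<close> and \<open>v\<close> into edges
  between \<open>u\<close> and \<open>x\<close>. Their signs are replaced by
  \<open>\<sigma>'\<close>, chosen so that the resulting positions of \<open>u\<close> and
  \<open>x\<close> leave a place for \<open>v\<close>. Since \<open>e0\<close> is the only edge
  between \<open>v\<close> and \<open>x\<close>, just one sign constrains \<open>v\<close> relative
  to \<open>x\<close>.\<close>

lemma line_realizable_degree_two:
  assumes G: "multigraph G"
    and nbrs: "\<And>w. adjacent G v w \<longleftrightarrow> w = u \<or> w = x" and ux: "u \<noteq> x"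
    and e0: "e0 \<in> edges G" "ends G e0 = {x, v}"
      "\<And>e. e \<in> edges G \<Longrightarrow> ends G e = {x, v} \<Longrightarrow> e = e0"
    and L: "line_realizable (contract x v G)"
  shows "line_realizable G"
  unfolding line_realizable_def
proof (intro allI impI)
  fix \<sigma> and d :: "'a \<Rightarrow> 'a \<Rightarrow> real" assume d: "pseudometric d"
  note dD = pseudometricD[OF d]
  define F where "F = {e \<in> edges G. ends G e = {u, v}}"
  have vne: "v \<noteq> u" "v \<noteq> x" "x \<in> verts G"
    using adjacentD[OF G] nbrs by metis+
  have Fne: "F \<noteq> {}" using nbrs[of u] by (auto simp: F_def adjacent_def insert_commute)
  have "d u x \<le> d u v + d v x" "d u v \<le> d v x + d u x" "d v x \<le> d u v + d u x"
    using dD(2,3) by (metis add.commute)+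
  then obtain \<sigma>' where \<sigma>': "\<And>A B. (\<And>e. e \<in> F \<Longrightarrow> fits (\<sigma>' e) (d u x) \<bar>A - B\<bar>) \<Longrightarrow>
       \<exists>t. (\<forall>e\<in>F. fits (\<sigma> e) (d u v) \<bar>t - A\<bar>) \<and> fits (\<sigma> e0) (d v x) \<bar>t - B\<bar>"
    using position_of_degree_two_vertex[where F = F and \<sigma> = \<sigma> and \<beta> = "\<sigma> e0"] Fne by metis
  define \<tau> where "\<tau> e = (if e \<in> F then \<sigma>' e else \<sigma> e)" for e
  obtain s where s: "line_embedding (contract x v G) \<tau> d s"
    using L d by (auto simp: line_realizable_def)
  have "fits (\<sigma>' e) (d u x) \<bar>s u - s x\<bar>" if "e \<in> F" for e
  proof -
    have "{u, v} \<noteq> {x, v}" using ux vne by (auto simp: doubleton_eq_iff)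
    then have "e \<in> edges (contract x v G)" "ends (contract x v G) e = {u, x}"
      using that vne by (auto simp: F_def)
    from line_embeddingD[OF s this] show ?thesis using that by (simp add: \<tau>_def)
  qed
  from \<sigma>'[OF this] obtain t where
    t: "\<And>e. e \<in> F \<Longrightarrow> fits (\<sigma> e) (d u v) \<bar>t - s u\<bar>" "fits (\<sigma> e0) (d v x) \<bar>t - s x\<bar>" by blast
  let ?s = "s(v := t)"
  have "line_embedding G \<sigma> d ?s"
  proof (rule line_embeddingI[OF G d])
    fix e assume e: "e \<in> edges G"
    show "\<exists>i j. ends G e = {i, j} \<and> fits (\<sigma> e) (d i j) \<bar>?s i - ?s j\<bar>"
    proof (cases "v \<in> ends G e")
      case True
      then obtain w where w: "ends G e = {v, w}" "v \<noteq> w"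
        by (rule edge_at_vertexE[OF G e])
      then consider "w = u" | "w = x" using nbrs e by (auto simp: adjacent_def)
      then show ?thesis
      proof cases
        case 1
        then have "e \<in> F" using e w by (auto simp: F_def)
        then show ?thesis
          using t(1)[of e] 1 w vne dD(2)[of u v] by (intro exI[of _ v] exI[of _ u] conjI) simp_all
      next
        case 2
        then have "e = e0" using e0(3) e w by (simp add: insert_commute)
        then show ?thesis
          using t(2) 2 w vne by (intro exI[of _ v] exI[of _ x] conjI) simp_all
      qed
    next
      case False
      obtain i j where ij: "ends G e = {i, j}" using edge_endsE[OF G e] by metis
      have "fits (\<tau> e) (d i j) \<bar>s i - s j\<bar>"
        using False e ij by (intro line_embeddingD[OF s]) auto
      moreover have "e \<notin> F" using False by (auto simp: F_def)
      moreover have "i \<noteq> v" "j \<noteq> v" using False ij by auto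
      ultimately show ?thesis using ij by (intro exI[of _ i] exI[of _ j] conjI) (simp_all add: \<tau>_def)
    qed
  qed
  then show "\<exists>s. line_embedding G \<sigma> d s" by blast
qed

section \<open>Gluing line embeddings at a separating pair\<close>

lemma grown_insert_edge:
  assumes "multigraph G" "grown G W" "e \<in> edges G" "ends G e = {a, b}" "a \<in> W" "b \<notin> W"
  shows "grown G (insert b W)"
  using grown.add[OF assms(2,5,6,3,4)] .

text \<open>\<open>U\<close> is the vertex set of the component of \<open>u\<close> in
  \<open>G - S\<close>; an edge leaving \<open>U \<union> S\<close> from \<open>U\<close> would
  contradict maximality.\<close>

lemma maximal_grown_set:
  assumes G: "multigraph G" and u: "u \<in> verts G" "u \<notin> S"
  obtains U where "grown G U" "u \<in> U" "U \<inter> S = {}"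
    "\<And>e a b. e \<in> edges G \<Longrightarrow> ends G e = {a, b} \<Longrightarrow> a \<in> U \<Longrightarrow> b \<in> U \<union> S"
proof -
  let ?A = "{U. grown G U \<and> u \<in> U \<and> U \<inter> S = {}}"
  have "?A \<subseteq> Pow (verts G)" using grown_subset[OF _ G] by auto
  then have fin: "finite ?A" using multigraphD(1)[OF G] by (meson finite_Pow_iff finite_subset)
  have "{u} \<in> ?A" using u by (auto intro: grown.single)
  then have "?A \<noteq> {}" by (rule ex_in_conv[THEN iffD1, OF exI])
  from finite_has_maximal[OF fin this] obtain U
    where U: "U \<in> ?A" "\<forall>W\<in>?A. U \<subseteq> W \<longrightarrow> U = W" by (elim bexE)
  show thesis
  proof (rule that[of U])
    fix e a b assume e: "e \<in> edges G" "ends G e = {a, b}" "a \<in> U"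
    show "b \<in> U \<union> S"
    proof (rule ccontr)
      assume b: "b \<notin> U \<union> S"
      then have "insert b U \<in> ?A" using U(1) e by (auto intro: grown_insert_edge[OF G])
      then have "U = insert b U" using U(2) by (meson subset_insertI)
      then show False using b by blast
    qed
  qed (use U in auto)
qed

lemma fits_eq: "x = l \<Longrightarrow> fits b l x"
  by (simp add: fits_def)

text \<open>Hypothesis \<open>L1\<close> serves the case without an edge from \<open>U\<close> to
  \<open>x\<close>. Hypothesis \<open>L3\<close> serves the case of a single such edge, where
  \<open>x\<close> is merged into its end \<open>y\<close> on the side of \<open>U\<close>.\<close>

lemma line_realizable_glue:
  assumes G: "multigraph G" and U: "U \<subseteq> verts G" "v \<in> verts G" "v \<notin> U" "x \<in> verts G" "x \<notin> U" "x \<noteq> v"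
    and cut: "\<And>e a b. e \<in> edges G \<Longrightarrow> ends G e = {a, b} \<Longrightarrow> a \<in> U \<Longrightarrow> b \<in> U \<union> {v, x}"
    and e12: "e1 \<in> edges G" "e2 \<in> edges G" "e1 \<noteq> e2" "ends G e1 = {x, v}" "ends G e2 = {x, v}"
    and uniq: "\<And>e e'. linked G U {x} e \<Longrightarrow> linked G U {x} e' \<Longrightarrow> e = e'"
    and L1: "line_realizable (induced G (insert v U))"
    and L2: "line_realizable (induced G (verts G - U))"
    and L3: "\<And>e y. e \<in> edges G \<Longrightarrow> ends G e = {y, x} \<Longrightarrow> y \<in> U \<Longrightarrow>
      line_realizable (contract y x (induced G (insert x (insert v U))))"
  shows "line_realizable G"
  unfolding line_realizable_def
proof (intro allI impI)
  fix \<sigma> and d :: "'a \<Rightarrow> 'a \<Rightarrow> real" assume d: "pseudometric d"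
  note dD = pseudometricD[OF d]
  have edge_cases: "\<exists>i j. ends G e = {i, j} \<and>
      (i \<in> insert v U \<and> j \<in> insert v U \<or> i \<notin> U \<and> j \<notin> U \<and> i \<in> verts G \<and> j \<in> verts G \<or> i \<in> U \<and> j = x)"
    if e: "e \<in> edges G" for e
  proof -
    obtain i j where ij: "ends G e = {i, j}" "i \<in> verts G" "j \<in> verts G" using edge_endsE[OF G e] by metis
    have "ends G e = {j, i}" using ij by auto
    then show ?thesis using cut[OF e] ij U by (metis Un_iff insert_iff singletonD)
  qed
  \<comment> \<open>Both embeddings are translated to put \<open>v\<close> at 0, and the second may
    be reflected. Only an edge from \<open>U\<close> to \<open>x\<close> compares the two.\<close>
  have glue: "\<exists>s. line_embedding G \<sigma> d s"
    if s1: "\<And>e i j. e \<in> edges G \<Longrightarrow> ends G e = {i, j} \<Longrightarrow> i \<in> insert v U \<Longrightarrow> j \<in> insert v U \<Longrightarrow>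
        fits (\<sigma> e) (d i j) \<bar>s1 i - s1 j\<bar>"
      and s2: "\<And>e i j. e \<in> edges G \<Longrightarrow> ends G e = {i, j} \<Longrightarrow> i \<in> verts G - U \<Longrightarrow> j \<in> verts G - U \<Longrightarrow>
        fits (\<sigma> e) (d i j) \<bar>s2 i - s2 j\<bar>"
      and s12: "\<And>e y. e \<in> edges G \<Longrightarrow> ends G e = {y, x} \<Longrightarrow> y \<in> U \<Longrightarrow>
        fits (\<sigma> e) (d y x) \<bar>(s1 y - s1 v) - \<epsilon> * (s2 x - s2 v)\<bar>"
      and \<epsilon>: "\<bar>\<epsilon>\<bar> = 1"
    for s1 s2 :: "'a \<Rightarrow> real" and \<epsilon>
  proof -
    let ?s = "\<lambda>w. if w \<in> U then s1 w - s1 v else \<epsilon> * (s2 w - s2 v)"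
    have "line_embedding G \<sigma> d ?s"
    proof (rule line_embeddingI[OF G d])
      fix e assume e: "e \<in> edges G"
      then obtain i j where ij: "ends G e = {i, j}" and
        "i \<in> insert v U \<and> j \<in> insert v U \<or> i \<notin> U \<and> j \<notin> U \<and> i \<in> verts G \<and> j \<in> verts G \<or> i \<in> U \<and> j = x"
        using edge_cases by blast
      then have "fits (\<sigma> e) (d i j) \<bar>?s i - ?s j\<bar>"
      proof (elim disjE conjE)
        assume i: "i \<in> insert v U" "j \<in> insert v U"
        have "?s w = s1 w - s1 v" if "w \<in> insert v U" for w using that U(3) by auto
        then show ?thesis using s1[OF e ij i] i by simp
      next
        assume i: "i \<notin> U" "j \<notin> U" "i \<in> verts G" "j \<in> verts G"
        have "\<bar>\<epsilon> * (s2 i - s2 v) - \<epsilon> * (s2 j - s2 v)\<bar> = \<bar>s2 i - s2 j\<bar>"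
          using \<epsilon> by (metis abs_mult diff_diff_eq2 diff_add_cancel mult_1 right_diff_distrib)
        then show ?thesis using s2[OF e ij] i by simp
      next
        assume "i \<in> U" "j = x"
        then show ?thesis using s12 e ij U by simp
      qed
      then show "\<exists>i j. ends G e = {i, j} \<and> fits (\<sigma> e) (d i j) \<bar>?s i - ?s j\<bar>" using ij by blast
    qed
    then show ?thesis by blast
  qed
  show "\<exists>s. line_embedding G \<sigma> d s"
  proof (cases "\<exists>e0. linked G U {x} e0")
    case False
    obtain s1 s2 where "line_embedding (induced G (insert v U)) \<sigma> d s1"
        "line_embedding (induced G (verts G - U)) \<sigma> d s2"
      using L1 L2 d unfolding line_realizable_def by meson
    then show ?thesis using False
      by (intro glue[of s1 s2 1]) (auto simp: line_embedding_def linked_def)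
  next
    case True
    then obtain e0 y where e0: "e0 \<in> edges G" "y \<in> U" "ends G e0 = {y, x}" "linked G U {x} e0"
      by (auto simp: linked_def)
    \<comment> \<open>Opposite signs on the parallel edges \<open>e1\<close> and \<open>e2\<close>
      force exact distances: \<open>d x v\<close> in the second embedding and \<open>d y v\<close>
      in the contraction. An exact length also satisfies the original signs of both edges.\<close>
    define \<tau> where "\<tau> = \<sigma>(e1 := True, e2 := False)"
    have yne: "y \<noteq> v" "y \<noteq> x" using e0 U by auto
    obtain s2 where s2: "line_embedding (induced G (verts G - U)) \<tau> d s2"
      using L2 d unfolding line_realizable_def by blast
    let ?H = "contract y x (induced G (insert x (insert v U)))"
    obtain s1 where s1: "line_embedding ?H \<tau> d s1"
      using L3[OF e0(1,3,2)] d unfolding line_realizable_def by blast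
    have eH: "e \<in> edges ?H \<and> ends ?H e = {y, v}" if "e = e1 \<or> e = e2" for e
      using that e12 yne U by (auto simp: doubleton_eq_iff)
    have a: "\<bar>s1 y - s1 v\<bar> = d y v"
      using line_embeddingD[OF s1, of e1 y v] line_embeddingD[OF s1, of e2 y v] eH e12(3)
      by (simp add: \<tau>_def fits_def)
    have e2': "e \<in> edges (induced G (verts G - U)) \<and> ends (induced G (verts G - U)) e = {x, v}"
      if "e = e1 \<or> e = e2" for e
      using that e12 U by auto
    have b: "\<bar>s2 x - s2 v\<bar> = d x v"
      using line_embeddingD[OF s2, of e1 x v] line_embeddingD[OF s2, of e2 x v] e2' e12(3) U
      by (simp add: \<tau>_def fits_def)
    obtain \<epsilon> :: real where \<epsilon>: "\<bar>\<epsilon>\<bar> = 1" "fits (\<sigma> e0) (d y x) \<bar>(s1 y - s1 v) - \<epsilon> * (s2 x - s2 v)\<bar>"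
    proof
      \<comment> \<open>Depending on the reflection, \<open>y\<close> and \<open>x\<close> end up at
        the sum or at the absolute difference of \<open>d y v\<close> and \<open>d x v\<close>. The
        triangle inequality places \<open>d y x\<close> between these, so the sign of
        \<open>e0\<close> tells which one to take.\<close>
      define \<epsilon> :: real where "\<epsilon> = (if \<sigma> e0 \<longleftrightarrow> (s1 y - s1 v \<ge> 0 \<longleftrightarrow> s2 x - s2 v \<ge> 0) then 1 else -1)"
      show "\<bar>\<epsilon>\<bar> = 1" by (simp add: \<epsilon>_def)
      have "d y x \<le> d y v + d x v" "d y v \<le> d y x + d x v" "d x v \<le> d y x + d y v"
        using dD(2,3) by (metis add.commute)+
      then show "fits (\<sigma> e0) (d y x) \<bar>(s1 y - s1 v) - \<epsilon> * (s2 x - s2 v)\<bar>"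
        using a b by (auto simp: \<epsilon>_def fits_def)
    qed
    show ?thesis
    proof (rule glue[OF _ _ _ \<epsilon>(1)])
      fix e i j assume e: "e \<in> edges G" "ends G e = {i, j}" "i \<in> insert v U" "j \<in> insert v U"
      have "x \<notin> {i, j}" using e U by auto
      then have "e \<noteq> e1" "e \<noteq> e2" using e e12 by auto
      moreover have "fits (\<tau> e) (d i j) \<bar>s1 i - s1 j\<bar>"
        using \<open>x \<notin> {i, j}\<close> e by (intro line_embeddingD[OF s1]) auto
      ultimately show "fits (\<sigma> e) (d i j) \<bar>s1 i - s1 j\<bar>" by (simp add: \<tau>_def)
    next
      fix e i j assume e: "e \<in> edges G" "ends G e = {i, j}" "i \<in> verts G - U" "j \<in> verts G - U"
      show "fits (\<sigma> e) (d i j) \<bar>s2 i - s2 j\<bar>"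
      proof (cases "e = e1 \<or> e = e2")
        case True
        then have "{i, j} = {x, v}" using e e12 by auto
        then show ?thesis using b dD(2) by (intro fits_eq) (auto simp: doubleton_eq_iff abs_minus_commute)
      next
        case False
        then show ?thesis using line_embeddingD[OF s2, of e i j] e by (auto simp: \<tau>_def)
      qed
    next
      fix e y' assume e: "e \<in> edges G" "ends G e = {y', x}" "y' \<in> U"
      then have "e = e0" using uniq[OF _ e0(4)] by (auto simp: linked_def)
      then have "y' = y" using e e0 by (auto simp: doubleton_eq_iff)
      then show "fits (\<sigma> e) (d y' x) \<bar>(s1 y' - s1 v) - \<epsilon> * (s2 x - s2 v)\<bar>"
        using \<epsilon>(2) \<open>e = e0\<close> by simp
    qed
  qed
qed

theorem line_realizable_if_no_minor:
  assumes "multigraph G" "\<not> has_minor G K4" "\<not> has_minor G doubled_K3"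
  shows "line_realizable G"
  using assms
proof (induction "card (verts G)" arbitrary: G rule: less_induct)
  case less
  note G = less.prems(1)
  have fin: "finite (verts G)" using multigraphD(1)[OF G] .
  have IH: "line_realizable H" if "minor_step\<^sup>*\<^sup>* G H" "card (verts H) < card (verts G)" for H
    using less.hyps[OF that(2) multigraph_minor[OF that(1) G]] has_minor_trans[OF that(1), of K4]
      has_minor_trans[OF that(1), of doubled_K3] less.prems by blast
  show ?case
  proof (cases "verts G = {}")
    case True
    then have "edges G = {}" using edge_endsE[OF G] by blast
    then show ?thesis by (auto simp: line_realizable_def line_embedding_def)
  next
    case False
    then obtain v where v: "v \<in> verts G" "card {u. adjacent G v u} < 3"
      using K4_minor_if_degrees_ge_3[OF G] less.prems(2) by (meson not_le)
    have finN: "finite {u. adjacent G v u}"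
      by (rule finite_subset[OF _ fin]) (auto dest: adjacentD[OF G])
    have card_minus: "card (verts G - {w}) < card (verts G)" if "w \<in> verts G" for w
      using that fin by (meson card_Diff1_less)
    show ?thesis
    proof (cases "\<exists>u0. \<forall>u. adjacent G v u \<longrightarrow> u = u0")
      case True
      have "line_realizable (delete_vertex v G)"
        using v minor_step.intros(2)[OF v(1)] card_minus[OF v(1)] by (intro IH) (auto simp: delete_vertex_def)
      then show ?thesis using line_realizable_pendant[OF G v(1)] True by blast
    next
      case False
      then obtain u x where ux: "adjacent G v u" "adjacent G v x" "u \<noteq> x" by metis
      then have "card {u, x} = 2" "{u, x} \<subseteq> {u. adjacent G v u}" by auto
      then have "{u. adjacent G v u} = {u, x}" using v(2) finN by (intro card_seteq[symmetric]) auto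
      then have nbrs: "adjacent G v w \<longleftrightarrow> w = u \<or> w = x" for w by auto
      have contr: "line_realizable G"
        if "\<And>w. adjacent G v w \<longleftrightarrow> w = y \<or> w = z" "y \<noteq> z" "e0 \<in> edges G" "ends G e0 = {z, v}"
          "\<And>e. e \<in> edges G \<Longrightarrow> ends G e = {z, v} \<Longrightarrow> e = e0" for y z e0
      proof (rule line_realizable_degree_two[OF G that])
        have "z \<noteq> v" using that(1) adjacentD(1)[OF G] by metis
        then show "line_realizable (contract z v G)"
          using that v card_minus[OF v(1)] by (intro IH) (auto intro!: minor_step.intros(3))
      qed
      obtain eu ex where eu: "eu \<in> edges G" "ends G eu = {u, v}" and ex: "ex \<in> edges G" "ends G ex = {x, v}"
        using ux by (auto simp: adjacent_def insert_commute)
      show ?thesis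
      proof (cases "(\<forall>e\<in>edges G. ends G e = {u, v} \<longrightarrow> e = eu) \<or> (\<forall>e\<in>edges G. ends G e = {x, v} \<longrightarrow> e = ex)")
        case True
        then show ?thesis using contr[of u x ex] contr[of x u eu] nbrs ux(3) eu ex by blast
      next
        case False
        then obtain eu' ex' where eu': "eu' \<in> edges G" "ends G eu' = {u, v}" "eu' \<noteq> eu"
          and ex': "ex' \<in> edges G" "ends G ex' = {x, v}" "ex' \<noteq> ex" by blast
        have vne: "v \<noteq> u" "v \<noteq> x" "u \<in> verts G" "x \<in> verts G"
          using ux adjacentD[OF G] by metis+
        obtain U where U: "grown G U" "u \<in> U" "U \<inter> {v, x} = {}"
          "\<And>e a b. e \<in> edges G \<Longrightarrow> ends G e = {a, b} \<Longrightarrow> a \<in> U \<Longrightarrow> b \<in> U \<union> {v, x}"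
          using maximal_grown_set[OF G vne(3), of "{v, x}"] vne ux(3) by auto
        have UV: "U \<subseteq> verts G" using grown_subset[OF U(1) G] .
        have uniq: "e = e'" if "linked G U {x} e" "linked G U {x} e'" for e e'
        proof (rule ccontr)
          assume ne: "e \<noteq> e'"
          let ?B = "\<lambda>i :: nat. if i = 0 then {v} else if i = 1 then U else {x}"
          have "has_minor G doubled_K3"
          proof (rule has_doubled_K3_minor[OF G, of ?B])
            show "grown G (?B i)" for i using U(1) v vne by (auto intro: grown.single)
            fix i j :: nat assume ij: "i < j" "j < 3"
            then consider "i = 0" "j = 1" | "i = 0" "j = 2" | "i = 1" "j = 2" by linarith
            note c = this
            from c show "?B i \<inter> ?B j = {}" by cases (use U(3) vne in auto)
            from c show "\<exists>e e'. e \<noteq> e' \<and> linked G (?B i) (?B j) e \<and> linked G (?B i) (?B j) e'"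
            proof cases
              case 1
              then show ?thesis using eu eu' U(2) by (intro exI[of _ eu] exI[of _ eu']) (auto simp: linked_def)
            next
              case 2
              then show ?thesis using ex ex' by (intro exI[of _ ex] exI[of _ ex']) (auto simp: linked_def)
            next
              case 3
              then show ?thesis using that ne by (intro exI[of _ e] exI[of _ e']) auto
            qed
          qed
          then show False using less.prems(3) by blast
        qed
        have vx: "v \<notin> U" "x \<notin> U" using U(3) by auto
        show ?thesis
        proof (rule line_realizable_glue[OF G UV v(1) vx(1) vne(4) vx(2) vne(2)[symmetric] U(4)
              ex(1) ex'(1) ex'(3)[symmetric] ex(2) ex'(2) uniq])
          have "insert v U \<subset> verts G" using UV v vne vx by auto
          then show "line_realizable (induced G (insert v U))"
            using induced_minor[OF G, of "insert v U"] psubset_card_mono[OF fin] by (intro IH) auto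
          have "verts G - U \<subset> verts G" using U(2) vne by auto
          then show "line_realizable (induced G (verts G - U))"
            using induced_minor[OF G, of "verts G - U"] psubset_card_mono[OF fin] by (intro IH) auto
          fix e y assume e: "e \<in> edges G" "ends G e = {y, x}" "y \<in> U"
          let ?W = "insert x (insert v U)"
          have "minor_step\<^sup>*\<^sup>* G (induced G ?W)"
            using UV v vne by (intro induced_minor[OF G]) auto
          moreover have "minor_step (induced G ?W) (contract y x (induced G ?W))"
            using e vx by (intro minor_step.intros(3)[of e]) auto
          moreover have "card (?W - {x}) < card (verts G)"
            using UV v vne vx by (intro psubset_card_mono[OF fin]) auto
          ultimately show "line_realizable (contract y x (induced G ?W))"
            by (intro IH) (auto intro: rtranclp.rtrancl_into_rtrancl)
        qed auto
      qed
    qed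
  qed
qed

section \<open>Electrical networks\<close>

definition linear_functional :: "(('v \<Rightarrow> real) \<Rightarrow> real) \<Rightarrow> bool" where
  "linear_functional \<psi> \<longleftrightarrow> (\<forall>f g a. \<psi> (\<lambda>x. f x + a * g x) = \<psi> f + a * \<psi> g)"

lemma linear_functionalD: "linear_functional \<psi> \<Longrightarrow> \<psi> (\<lambda>x. f x + a * g x) = \<psi> f + a * \<psi> g"
  by (simp add: linear_functional_def)

lemma linear_functional_sub:
  "linear_functional \<psi> \<Longrightarrow> linear_functional \<chi> \<Longrightarrow> linear_functional (\<lambda>f. \<psi> f - a * \<chi> f)"
  by (simp add: linear_functional_def algebra_simps)

lemma weighted_square_nonneg: "0 < w \<Longrightarrow> 0 \<le> w * x * (x :: real)"
  by (metis less_imp_le mult.assoc mult_nonneg_nonneg zero_le_square)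

text \<open>Potentials are functions on the whole vertex type, so solvability is proved without
  assuming finite dimension: a functional is represented by the form unless it is nonzero on the
  common kernel of the squares. In the induction, a new square is a rank-one update of the
  form.\<close>

lemma sum_of_squares_alternative:
  assumes "finite I" "\<And>i. i \<in> I \<Longrightarrow> linear_functional (\<phi> i)" "\<And>i. i \<in> I \<Longrightarrow> w i > (0 :: real)"
    and "linear_functional \<psi>"
  shows "(\<exists>f. \<forall>g. (\<Sum>i\<in>I. w i * \<phi> i f * \<phi> i g) = \<psi> g) \<or> (\<exists>g. (\<forall>i\<in>I. \<phi> i g = 0) \<and> \<psi> g \<noteq> 0)"
  using assms
proof (induction I arbitrary: \<psi>)
  case empty
  then show ?case by auto
next
  case (insert e I)
  let ?B = "\<lambda>f g. \<Sum>i\<in>I. w i * \<phi> i f * \<phi> i g"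
  have lin: "linear_functional (\<phi> i)" if "i \<in> insert e I" for i using insert.prems(1) that .
  have B: "?B (\<lambda>x. f x + a * k x) g = ?B f g + a * ?B k g" for f a k g
    using linear_functionalD[OF lin] by (simp add: algebra_simps sum.distrib sum_distrib_left)
  have B': "(\<Sum>i\<in>insert e I. w i * \<phi> i f * \<phi> i g) = w e * \<phi> e f * \<phi> e g + ?B f g" for f g
    using insert.hyps by simp
  have IH: "(\<exists>f. \<forall>g. ?B f g = \<chi> g) \<or> (\<exists>g. (\<forall>i\<in>I. \<phi> i g = 0) \<and> \<chi> g \<noteq> 0)"
    if "linear_functional \<chi>" for \<chi>
    using insert.IH[of \<chi>] insert.prems that by auto
  have we: "w e > 0" using insert.prems by simp
  have Bker: "?B f g = 0" if "\<forall>i\<in>I. \<phi> i f = 0" for f g using that by simp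
  have Bker': "?B f g = 0" if "\<forall>i\<in>I. \<phi> i g = 0" for f g using that by simp
  from IH[OF lin[of e]] consider (range) h where "\<And>g. ?B h g = \<phi> e g"
    | (ker) k where "\<forall>i\<in>I. \<phi> i k = 0" "\<phi> e k \<noteq> 0" by auto
  then show ?case
  proof cases
    case range
    from IH[OF insert.prems(3)] show ?thesis
    proof
      assume "\<exists>f. \<forall>g. ?B f g = \<psi> g"
      then obtain f where f: "\<And>g. ?B f g = \<psi> g" by blast
      have "\<phi> e h \<ge> 0"
        unfolding range[of h, symmetric] using insert.prems(2) by (intro sum_nonneg weighted_square_nonneg) auto
      then have nz: "1 + w e * \<phi> e h > 0" using we by (simp add: add_pos_nonneg)
      \<comment> \<open>The Sherman-Morrison coefficient: the correction along \<open>h\<close>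
        cancels the contribution of the new square.\<close>
      define c where "c = w e * \<phi> e f / (1 + w e * \<phi> e h)"
      have "c + w e * c * \<phi> e h = c * (1 + w e * \<phi> e h)" by (simp add: algebra_simps)
      then have c: "c + w e * c * \<phi> e h = w e * \<phi> e f" using nz by (simp add: c_def)
      let ?f = "\<lambda>x. f x + (- c) * h x"
      have "w e * \<phi> e ?f * \<phi> e g + ?B ?f g = \<psi> g" for g
      proof -
        have "w e * \<phi> e ?f * \<phi> e g + ?B ?f g = \<psi> g + (w e * \<phi> e f - (c + w e * c * \<phi> e h)) * \<phi> e g"
          unfolding B f range linear_functionalD[OF lin[of e, simplified]] by (simp add: algebra_simps)
        then show ?thesis using c by simp
      qed
      then show ?thesis unfolding B' by blast
    next
      assume "\<exists>g. (\<forall>i\<in>I. \<phi> i g = 0) \<and> \<psi> g \<noteq> 0"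
      then obtain g where g: "\<forall>i\<in>I. \<phi> i g = 0" "\<psi> g \<noteq> 0" by blast
      then have "\<phi> e g = 0" using range[of g] Bker' by simp
      then show ?thesis using g by (intro disjI2 exI[of _ g]) simp
    qed
  next
    case ker
    \<comment> \<open>Subtracting \<open>\<beta> * \<phi> e\<close> makes the functional vanish on
      \<open>k\<close>. The subtracted part is supplied by the new square, since moving along
      \<open>k\<close> adjusts \<open>\<phi> e\<close> without affecting the old form.\<close>
    define \<beta> where "\<beta> = \<psi> k / \<phi> e k"
    have "linear_functional (\<lambda>g. \<psi> g - \<beta> * \<phi> e g)"
      using insert.prems(3) lin by (intro linear_functional_sub) auto
    from IH[OF this] show ?thesis
    proof
      assume "\<exists>f. \<forall>g. ?B f g = \<psi> g - \<beta> * \<phi> e g"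
      then obtain f where f: "\<And>g. ?B f g = \<psi> g - \<beta> * \<phi> e g" by blast
      define c where "c = (\<beta> / w e - \<phi> e f) / \<phi> e k"
      let ?f = "\<lambda>x. f x + c * k x"
      have "\<phi> e ?f = \<beta> / w e"
        unfolding linear_functionalD[OF lin[of e, simplified]] using ker(2) by (simp add: c_def)
      moreover have "?B ?f g = ?B f g" for g unfolding B using Bker[OF ker(1)] by simp
      ultimately have "w e * \<phi> e ?f * \<phi> e g + ?B ?f g = \<psi> g" for g
        using f we by simp
      then show ?thesis unfolding B' by blast
    next
      assume "\<exists>g. (\<forall>i\<in>I. \<phi> i g = 0) \<and> \<psi> g - \<beta> * \<phi> e g \<noteq> 0"
      then obtain g where g: "\<forall>i\<in>I. \<phi> i g = 0" "\<psi> g - \<beta> * \<phi> e g \<noteq> 0" by blast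
      define a where "a = - \<phi> e g / \<phi> e k"
      let ?g = "\<lambda>x. g x + a * k x"
      have "\<phi> i ?g = 0" if "i \<in> I" for i
        using linear_functionalD[OF lin[of i]] g ker that by simp
      moreover have "\<phi> e ?g = 0"
        unfolding linear_functionalD[OF lin[of e, simplified]] using ker by (simp add: a_def)
      moreover have "\<psi> ?g \<noteq> 0"
        unfolding linear_functionalD[OF insert.prems(3)] using g ker by (simp add: a_def \<beta>_def field_simps)
      ultimately show ?thesis by (intro disjI2 exI[of _ ?g]) simp
    qed
  qed
qed

section \<open>Dirichlet forms of oriented networks and unit currents\<close>

definition energy :: "('e \<Rightarrow> 'v) \<Rightarrow> ('e \<Rightarrow> 'v) \<Rightarrow> ('e \<Rightarrow> real) \<Rightarrow> 'e set \<Rightarrow> ('v \<Rightarrow> real) \<Rightarrow> ('v \<Rightarrow> real) \<Rightarrow> real" where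
  "energy t h w E f g = (\<Sum>e\<in>E. w e * (f (t e) - f (h e)) * (g (t e) - g (h e)))"

lemma linear_functional_difference: "linear_functional (\<lambda>f. f a - f b)"
  by (simp add: linear_functional_def algebra_simps)

lemma energy_commute: "energy t h w E f g = energy t h w E g f"
  by (simp add: energy_def mult_ac)

lemma energy_add_scaled: "energy t h w E (\<lambda>x. f x + a * k x) g = energy t h w E f g + a * energy t h w E k g"
  unfolding energy_def sum_distrib_left sum.distrib[symmetric]
  by (rule sum.cong) (simp_all add: algebra_simps)

lemma linear_functional_energy: "linear_functional (energy t h w E f)"
  unfolding linear_functional_def by (metis energy_commute energy_add_scaled)

lemma energy_insert:
  "finite E \<Longrightarrow> e \<notin> E \<Longrightarrow> energy t h w (insert e E) f g
     = w e * (f (t e) - f (h e)) * (g (t e) - g (h e)) + energy t h w E f g"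
  by (simp add: energy_def)

lemma energy_cong:
  assumes "\<And>e. e \<in> E \<Longrightarrow> f (t e) - f (h e) = f' (t' e) - f' (h' e)"
    and "\<And>e. e \<in> E \<Longrightarrow> g (t e) - g (h e) = g' (t' e) - g' (h' e)" "\<And>e. e \<in> E \<Longrightarrow> w e = w' e"
  shows "energy t h w E f g = energy t' h' w' E f' g'"
  using assms by (simp add: energy_def cong: sum.cong)

lemma energy_nonneg: "(\<And>e. e \<in> E \<Longrightarrow> w e > 0) \<Longrightarrow> energy t h w E f f \<ge> 0"
  unfolding energy_def by (intro sum_nonneg weighted_square_nonneg)

lemma energy_eq_0D:
  assumes "finite E" "\<And>e. e \<in> E \<Longrightarrow> w e > 0" "energy t h w E f f = 0" "e \<in> E"
  shows "f (t e) = f (h e)"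
proof -
  have "w e * (f (t e) - f (h e)) * (f (t e) - f (h e)) = 0"
    using assms sum_nonneg_eq_0_iff[of E "\<lambda>e. w e * (f (t e) - f (h e)) * (f (t e) - f (h e))"]
    unfolding energy_def by (simp add: weighted_square_nonneg)
  then show ?thesis using assms(2)[OF assms(4)] by simp
qed

text \<open>In the outcome \<open>range\<close> the network connects \<open>a\<close> and
  \<open>b\<close>, and \<open>k\<close> drives a unit current between them; in the outcome
  \<open>kernel\<close> it does not, and \<open>k\<close> separates their components.\<close>

lemma energy_alternative:
  fixes t h :: "'e \<Rightarrow> 'v"
  assumes "finite E" "\<And>e. e \<in> E \<Longrightarrow> w e > 0"
  obtains (range) k where "\<And>g. energy t h w E k g = g a - g b"
    | (kernel) k :: "'v \<Rightarrow> real" where "\<And>e. e \<in> E \<Longrightarrow> k (t e) = k (h e)" "k a \<noteq> k b"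
proof -
  have "(\<exists>k. \<forall>g. energy t h w E k g = g a - g b) \<or>
      (\<exists>k :: 'v \<Rightarrow> real. (\<forall>e\<in>E. k (t e) - k (h e) = 0) \<and> k a - k b \<noteq> 0)"
    unfolding energy_def
    by (rule sum_of_squares_alternative[where \<phi> = "\<lambda>e k. k (t e) - k (h e)" and \<psi> = "\<lambda>k. k a - k b"]) (use assms in \<open>auto simp: linear_functional_difference\<close>)
  then show thesis using range kernel by (metis right_minus_eq)
qed

text \<open>The potential \<open>f d\<close> drives a unit current between the ends of the edge \<open>d\<close> through the network
  \<open>E - D\<close> with conductances \<open>w\<close>, and \<open>f d (t d') - f d (h d')\<close> is the transfer resistance between \<open>d\<close>
  and \<open>d'\<close>.\<close>

definition resistance_triple ::
  "('e \<Rightarrow> 'v) \<Rightarrow> ('e \<Rightarrow> 'v) \<Rightarrow> ('e \<Rightarrow> real) \<Rightarrow> 'e set \<Rightarrow> 'e set \<Rightarrow> ('e \<Rightarrow> 'v \<Rightarrow> real) \<Rightarrow> bool" where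
  "resistance_triple t h w E D f \<longleftrightarrow> finite E \<and> D \<subseteq> E \<and> card D = 3 \<and> (\<forall>e\<in>E - D. w e > 0) \<and>
     (\<forall>d\<in>D. \<forall>g. energy t h w (E - D) (f d) g = g (t d) - g (h d)) \<and>
     (\<forall>d\<in>D. \<forall>d'\<in>D. d \<noteq> d' \<longrightarrow> f d (t d') - f d (h d') < 0)"

lemma eventually_negative:
  assumes "finite D" "\<And>d. d \<in> D \<Longrightarrow> (c d \<longlongrightarrow> (0 :: real)) F"
    and "\<And>d d'. d \<in> D \<Longrightarrow> d' \<in> D \<Longrightarrow> d \<noteq> d' \<Longrightarrow> x d d' < (0 :: real)"
  shows "eventually (\<lambda>T. \<forall>d\<in>D. \<forall>d'\<in>D. d \<noteq> d' \<longrightarrow> x d d' - c d T * y d' < 0) F"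
proof (intro eventually_ball_finite ballI assms(1))
  fix d d' assume d: "d \<in> D" "d' \<in> D"
  show "eventually (\<lambda>T. d \<noteq> d' \<longrightarrow> x d d' - c d T * y d' < 0) F"
  proof (cases "d = d'")
    case False
    have "((\<lambda>T. x d d' - c d T * y d') \<longlongrightarrow> x d d' - 0 * y d') F"
      using assms(2)[OF d(1)] by (intro tendsto_intros)
    then show ?thesis using assms(3)[OF d False] by (auto dest!: order_tendstoD(2)[of _ _ _ 0] elim: eventually_mono)
  qed simp
qed

text \<open>The common frame for adding an edge and for undoing a contraction: the new edge gets
  conductance \<open>T\<close>, and the potentials are corrected along one fixed \<open>k\<close>.
  The corrections vanish in the limit along the filter \<open>F\<close>, so the strict inequalities
  hold for some \<open>T\<close>.\<close>

lemma resistance_triple_perturb: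
  assumes fin: "finite E" "e \<notin> E" and D: "D \<subseteq> E" "card D = 3" "\<And>e. e \<in> E - D \<Longrightarrow> w e > 0"
    and F: "F \<noteq> bot" "eventually (\<lambda>T. T > 0) F"
    and c: "\<And>d. d \<in> D \<Longrightarrow> (c d \<longlongrightarrow> (0 :: real)) F"
    and neg: "\<And>d d'. d \<in> D \<Longrightarrow> d' \<in> D \<Longrightarrow> d \<noteq> d' \<Longrightarrow> f d (t d') - f d (h d') < 0"
    and rep: "\<And>d T g. d \<in> D \<Longrightarrow> T > 0 \<Longrightarrow>
      energy t h w (E - D) (\<lambda>x. f d x - c d T * k x) g
        + T * ((f d (t e) - c d T * k (t e)) - (f d (h e) - c d T * k (h e))) * (g (t e) - g (h e))
        = g (t d) - g (h d)"
  shows "\<exists>w' f'. resistance_triple t h w' (insert e E) D f'"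
proof -
  have finD: "finite D" using D fin finite_subset by blast
  have "eventually (\<lambda>T. T > 0 \<and> (\<forall>d\<in>D. \<forall>d'\<in>D. d \<noteq> d' \<longrightarrow>
      (f d (t d') - f d (h d')) - c d T * (k (t d') - k (h d')) < 0)) F"
    using F(2) eventually_negative[where D = D and c = c and F = F and x = "\<lambda>d d'. f d (t d') - f d (h d')"
      and y = "\<lambda>d'. k (t d') - k (h d')", OF finD c neg]
    by (intro eventually_conj) auto
  then obtain T where T: "T > 0" "\<And>d d'. d \<in> D \<Longrightarrow> d' \<in> D \<Longrightarrow> d \<noteq> d' \<Longrightarrow>
      (f d (t d') - f d (h d')) - c d T * (k (t d') - k (h d')) < 0"
    using eventually_happens F(1) by blast
  let ?w = "w(e := T)"
  have eq: "insert e E - D = insert e (E - D)" using fin D by auto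
  have en: "energy t h ?w (E - D) f' g = energy t h w (E - D) f' g" for f' g
    using fin by (intro energy_cong) auto
  have "resistance_triple t h ?w (insert e E) D (\<lambda>d x. f d x - c d T * k x)"
    unfolding resistance_triple_def eq
  proof (intro conjI ballI allI impI)
    fix d g assume d: "d \<in> D"
    show "energy t h ?w (insert e (E - D)) (\<lambda>x. f d x - c d T * k x) g = g (t d) - g (h d)"
      using rep[OF d T(1), of g] fin by (subst energy_insert) (auto simp: en)
  next
    fix d d' assume "d \<in> D" "d' \<in> D" "d \<noteq> d'"
    from T(2)[OF this] show "f d (t d') - c d T * k (t d') - (f d (h d') - c d T * k (h d')) < 0"
      by (simp add: algebra_simps)
  qed (use fin D T in auto)
  then show ?thesis by blast
qed

text \<open>The correction of the potentials tends to 0 with the conductance of the new edge. If the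
  new edge joins two components of the network, the potentials can be shifted so that it carries no
  current.\<close>

lemma resistance_triple_add_edge:
  fixes t h :: "'e \<Rightarrow> 'v"
  assumes R: "resistance_triple t h w E D f" and e: "e \<notin> E"
  shows "\<exists>w' f'. resistance_triple t h w' (insert e E) D f'"
proof -
  have fin: "finite E" and D: "D \<subseteq> E" "card D = 3" "\<And>e. e \<in> E - D \<Longrightarrow> w e > 0"
    and rep: "\<And>d g. d \<in> D \<Longrightarrow> energy t h w (E - D) (f d) g = g (t d) - g (h d)"
    and neg: "\<And>d d'. d \<in> D \<Longrightarrow> d' \<in> D \<Longrightarrow> d \<noteq> d' \<Longrightarrow> f d (t d') - f d (h d') < 0"
    using R by (auto simp: resistance_triple_def)
  let ?\<phi> = "\<lambda>g. g (t e) - g (h e)"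
  have en: "energy t h w (E - D) (\<lambda>x. f d x - c * k x) g
      = energy t h w (E - D) (f d) g - c * energy t h w (E - D) k g" for d c k g
    using energy_add_scaled[of t h w "E - D" "f d" "- c" k g] by simp
  have fin': "finite (E - D)" using fin by simp
  show ?thesis
  proof (rule energy_alternative[where E = "E - D" and w = w, OF fin' D(3), where t = t and h = h and a = "t e" and b = "h e"])
    fix k assume k: "\<And>g. energy t h w (E - D) k g = ?\<phi> g"
    have \<rho>: "?\<phi> k \<ge> 0" using energy_nonneg[where E = "E - D" and w = w and t = t and h = h and f = k] D(3) k by simp
    \<comment> \<open>Sherman-Morrison again; \<open>?\<phi> k\<close> is the effective resistance
      between the ends of \<open>e\<close>.\<close>
    define c where "c d T = T * ?\<phi> (f d) / (1 + T * ?\<phi> k)" for d T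
    have c: "c d T + T * c d T * ?\<phi> k = T * ?\<phi> (f d)" if "T > 0" for d T
    proof -
      have "1 + T * ?\<phi> k > 0" using that \<rho> by (simp add: add_pos_nonneg)
      moreover have "c d T + T * c d T * ?\<phi> k = c d T * (1 + T * ?\<phi> k)" by (simp add: algebra_simps)
      ultimately show ?thesis by (simp add: c_def)
    qed
    show ?thesis
    proof (rule resistance_triple_perturb[OF fin e D, where F = "at_right 0" and c = c and f = f and k = k])
      fix d assume "d \<in> D"
      have "(c d \<longlongrightarrow> 0 * ?\<phi> (f d) / (1 + 0 * ?\<phi> k)) (at_right 0)"
        unfolding c_def by (intro tendsto_intros) auto
      then show "(c d \<longlongrightarrow> 0) (at_right 0)" by simp
    next
      fix d T g assume d: "d \<in> D" and T: "(T :: real) > 0"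
      have "energy t h w (E - D) (\<lambda>x. f d x - c d T * k x) g
        + T * ((f d (t e) - c d T * k (t e)) - (f d (h e) - c d T * k (h e))) * ?\<phi> g
        = g (t d) - g (h d) + (T * ?\<phi> (f d) - (c d T + T * c d T * ?\<phi> k)) * ?\<phi> g"
        unfolding en rep[OF d] k by (simp add: algebra_simps)
      then show "energy t h w (E - D) (\<lambda>x. f d x - c d T * k x) g
        + T * ((f d (t e) - c d T * k (t e)) - (f d (h e) - c d T * k (h e))) * ?\<phi> g
        = g (t d) - g (h d)" using c[OF T] by simp
    qed (use neg in \<open>auto simp: eventually_at_right_less\<close>)
  next
    fix k :: "'v \<Rightarrow> real" assume k: "\<And>e. e \<in> E - D \<Longrightarrow> k (t e) = k (h e)" and ne: "k (t e) \<noteq> k (h e)"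
    have ker: "energy t h w (E - D) k g = 0" for g using k by (simp add: energy_def)
    \<comment> \<open>A unit current flows between the ends of \<open>d\<close>, so they lie in one
      component of the network and \<open>k\<close> cannot separate them.\<close>
    have kd: "k (t d) - k (h d) = 0" if "d \<in> D" for d
      using rep[OF that, of k] ker energy_commute by metis
    \<comment> \<open>The shift by a multiple of \<open>k\<close> equalizes the potential at the
      ends of \<open>e\<close>, so that \<open>e\<close> carries no current for any
      \<open>T\<close>.\<close>
    define a where "a d = ?\<phi> (f d) / ?\<phi> k" for d
    let ?f = "\<lambda>d x. f d x - a d * k x"
    have zero: "?\<phi> (?f d) = 0" for d
    proof -
      have "?\<phi> (?f d) = ?\<phi> (f d) - a d * ?\<phi> k" by (simp add: algebra_simps)
      then show ?thesis using ne by (simp add: a_def)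
    qed
    show ?thesis
    proof (rule resistance_triple_perturb[OF fin e D, where F = "at_right 0" and c = "\<lambda>_ _. 0" and f = ?f and k = k])
      fix d d' assume d: "d \<in> D" "d' \<in> D" "d \<noteq> d'"
      have "?f d (t d') - ?f d (h d') = f d (t d') - f d (h d') - a d * (k (t d') - k (h d'))"
        by (simp add: algebra_simps)
      then show "?f d (t d') - ?f d (h d') < 0" using neg[OF d] kd[OF d(2)] by simp
    next
      fix d T g assume d: "d \<in> D"
      have "energy t h w (E - D) (?f d) g = g (t d) - g (h d)"
        unfolding en ker rep[OF d] by simp
      then show "energy t h w (E - D) (\<lambda>x. ?f d x - 0 * k x) g
        + T * ((?f d (t e) - 0 * k (t e)) - (?f d (h e) - 0 * k (h e))) * ?\<phi> g
        = g (t d) - g (h d)"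
        using zero[of d] by simp
    qed (auto simp: eventually_at_right_less)
  qed
qed

lemma resistance_triple_add_edges:
  assumes "resistance_triple t h w E D f" "finite F"
  shows "\<exists>w' f'. resistance_triple t h w' (E \<union> F) D f'"
  using assms(2)
proof (induction F)
  case empty
  then show ?case using assms(1) by auto
next
  case (insert e F)
  then obtain w' f' where R: "resistance_triple t h w' (E \<union> F) D f'" by blast
  then show ?case
    using resistance_triple_add_edge[OF R, of e] by (cases "e \<in> E \<union> F") (auto simp: insert_absorb)
qed

text \<open>The contraction is the limit of infinite conductance of \<open>e\<close>. The lifted
  potential \<open>F d\<close> leaves an imbalance \<open>s d\<close> between \<open>u\<close> and
  \<open>v\<close>; the correction that routes this current through \<open>e\<close> vanishes as
  \<open>T\<close> grows.\<close>

lemma resistance_triple_uncontract: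
  fixes u v :: 'v
  defines "\<pi> \<equiv> \<lambda>x. if x = v then u else x"
  assumes R: "resistance_triple (\<pi> \<circ> t) (\<pi> \<circ> h) w E D f" and e: "e \<notin> E" "{t e, h e} = {u, v}" "u \<noteq> v"
  shows "\<exists>w' f'. resistance_triple t h w' (insert e E) D f'"
proof -
  have fin: "finite E" and D: "D \<subseteq> E" "card D = 3" "\<And>e. e \<in> E - D \<Longrightarrow> w e > 0"
    and rep: "\<And>d g. d \<in> D \<Longrightarrow> energy (\<pi> \<circ> t) (\<pi> \<circ> h) w (E - D) (f d) g = g (\<pi> (t d)) - g (\<pi> (h d))"
    and neg: "\<And>d d'. d \<in> D \<Longrightarrow> d' \<in> D \<Longrightarrow> d \<noteq> d' \<Longrightarrow> f d (\<pi> (t d')) - f d (\<pi> (h d')) < 0"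
    using R by (auto simp: resistance_triple_def)
  have fin': "finite (E - D)" using fin by simp
  let ?b = "\<lambda>g. g u - g v" and ?\<delta> = "\<lambda>x. if x = u then 1 else 0 :: real"
  have b: "(x (t e) - x (h e)) * (y (t e) - y (h e)) = ?b x * ?b y" for x y :: "'v \<Rightarrow> real"
    using e(2) by (auto simp: doubleton_eq_iff algebra_simps)
  define F where "F d = f d \<circ> \<pi>" for d
  have bF: "?b (F d) = 0" for d by (simp add: F_def \<pi>_def)
  define s where "s d = energy t h w (E - D) (F d) ?\<delta> - (?\<delta> (t d) - ?\<delta> (h d))" for d
  \<comment> \<open>The defect of \<open>F d\<close> vanishes on functions that are equal at \<open>u\<close> and \<open>v\<close>,
    so it is a multiple of \<open>\<lambda>g. g u - g v\<close>.\<close>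
  have rep': "energy t h w (E - D) (F d) g = g (t d) - g (h d) + s d * ?b g" if d: "d \<in> D" for d g
  proof -
    define g' where "g' x = g x + (- ?b g) * ?\<delta> x" for x
    have "g' u = g' v" using e(3) by (simp add: g'_def)
    then have inv: "g' (\<pi> x) = g' x" for x by (simp add: \<pi>_def)
    have "energy t h w (E - D) (F d) g' = energy (\<pi> \<circ> t) (\<pi> \<circ> h) w (E - D) (f d) g'"
      by (intro energy_cong) (auto simp: F_def inv)
    also have "\<dots> = g' (t d) - g' (h d)" using rep[OF d] inv by simp
    finally have "energy t h w (E - D) (F d) g + (- ?b g) * energy t h w (E - D) (F d) ?\<delta>
        = g' (t d) - g' (h d)"
      unfolding g'_def linear_functionalD[OF linear_functional_energy] .
    then show ?thesis by (simp add: s_def g'_def algebra_simps)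
  qed
  have en: "energy t h w (E - D) (\<lambda>x. F d x - c * k x) g
      = energy t h w (E - D) (F d) g - c * energy t h w (E - D) k g" for d c k g
    using energy_add_scaled[of t h w "E - D" "F d" "- c" k g] by simp
  have neg': "F d (t d') - F d (h d') < 0" if "d \<in> D" "d' \<in> D" "d \<noteq> d'" for d d'
    using neg[OF that] by (simp add: F_def)
  have goal_eq: "T * ((F d (t e) - c * k (t e)) - (F d (h e) - c * k (h e))) * (g (t e) - g (h e))
      = - T * c * ?b k * ?b g" for T d c k g
  proof -
    have "((F d (t e) - c * k (t e)) - (F d (h e) - c * k (h e))) * (g (t e) - g (h e))
      = ?b (\<lambda>x. F d x - c * k x) * ?b g" by (rule b)
    also have "\<dots> = - c * ?b k * ?b g" using bF[of d] by (simp add: algebra_simps)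
    finally show ?thesis by (simp add: mult.assoc)
  qed
  show ?thesis
  proof (rule energy_alternative[where E = "E - D" and w = w, OF fin' D(3), where t = t and h = h and a = u and b = v])
    fix k assume k: "\<And>g. energy t h w (E - D) k g = ?b g"
    have "?b k \<noteq> 0"
    proof
      assume "?b k = 0"
      then have "k (t e) = k (h e)" if "e \<in> E - D" for e
        using energy_eq_0D[where E = "E - D" and w = w and t = t and h = h and f = k and e = e] fin' D(3) k that by simp
      then have "energy t h w (E - D) k ?\<delta> = 0" by (simp add: energy_def)
      then show False using k[of ?\<delta>] e(3) by simp
    qed
    moreover have "?b k \<ge> 0" using energy_nonneg[where E = "E - D" and w = w and t = t and h = h and f = k] D(3) k by simp
    ultimately have \<rho>: "?b k > 0" by simp
    \<comment> \<open>The imbalance is shared between \<open>e\<close> and the rest of the network,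
      whose effective resistance between \<open>u\<close> and \<open>v\<close> is
      \<open>?b k\<close>.\<close>
    define c where "c d T = s d / (1 + T * ?b k)" for d T
    show ?thesis
    proof (rule resistance_triple_perturb[OF fin e(1) D, where F = at_top and c = c and f = F and k = k])
      fix d
      have "filterlim (\<lambda>T. ?b k * T) at_top at_top"
        by (intro filterlim_tendsto_pos_mult_at_top[OF tendsto_const \<rho>] filterlim_ident)
      then have "filterlim (\<lambda>T. 1 + T * ?b k) at_top at_top"
        by (intro filterlim_tendsto_add_at_top[OF tendsto_const]) (simp add: mult.commute)
      then have "filterlim (\<lambda>T. 1 + T * ?b k) at_infinity at_top"
        by (rule filterlim_mono[OF _ at_top_le_at_infinity order_refl])
      then show "(c d \<longlongrightarrow> 0) at_top"
        unfolding c_def by (intro tendsto_divide_0[OF tendsto_const])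
    next
      fix d T g assume d: "d \<in> D" and T: "(T :: real) > 0"
      have "1 + T * ?b k > 0" using T \<rho> by (simp add: add_pos_pos)
      then have "c d T * (1 + T * ?b k) = s d" by (simp add: c_def)
      then have "s d * ?b g = c d T * ?b g + T * c d T * ?b k * ?b g" by (simp add: algebra_simps flip: \<open>c d T * (1 + T * ?b k) = s d\<close>)
      then show "energy t h w (E - D) (\<lambda>x. F d x - c d T * k x) g
        + T * ((F d (t e) - c d T * k (t e)) - (F d (h e) - c d T * k (h e))) * (g (t e) - g (h e))
        = g (t d) - g (h d)"
        unfolding goal_eq en rep'[OF d] k by simp
    qed (use neg' in \<open>auto simp: eventually_gt_at_top\<close>)
  next
    fix k :: "'v \<Rightarrow> real" assume k: "\<And>e. e \<in> E - D \<Longrightarrow> k (t e) = k (h e)" and ne: "k u \<noteq> k v"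
    have ker: "energy t h w (E - D) k g = 0" for g using k by (simp add: energy_def)
    \<comment> \<open>Without \<open>e\<close> the network does not connect \<open>u\<close> and
      \<open>v\<close>, so the whole imbalance passes through \<open>e\<close>, at a potential drop
      proportional to \<open>1 / T\<close>.\<close>
    define c where "c d T = s d / ?b k / T" for d T
    show ?thesis
    proof (rule resistance_triple_perturb[OF fin e(1) D, where F = at_top and c = c and f = F and k = k])
      fix d
      show "(c d \<longlongrightarrow> 0) at_top"
        unfolding c_def
        by (intro tendsto_divide_0[OF tendsto_const]) (rule filterlim_mono[OF filterlim_ident at_top_le_at_infinity order_refl])
    next
      fix d T g assume d: "d \<in> D" and T: "(T :: real) > 0"
      have "T * c d T * ?b k = s d" using T ne by (simp add: c_def)
      then show "energy t h w (E - D) (\<lambda>x. F d x - c d T * k x) g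
        + T * ((F d (t e) - c d T * k (t e)) - (F d (h e) - c d T * k (h e))) * (g (t e) - g (h e))
        = g (t d) - g (h d)"
        unfolding goal_eq en rep'[OF d] ker by simp
    qed (use neg' in \<open>auto simp: eventually_gt_at_top\<close>)
  qed
qed

section \<open>Resistance triples and minors\<close>

definition orientation :: "('v, 'e) mgraph \<Rightarrow> ('e \<Rightarrow> 'v) \<Rightarrow> ('e \<Rightarrow> 'v) \<Rightarrow> bool" where
  "orientation G t h \<longleftrightarrow> (\<forall>e\<in>edges G. ends G e = {t e, h e})"

lemma orientation_exists:
  assumes "multigraph G"
  obtains t h where "orientation G t h"
proof -
  have "\<forall>e\<in>edges G. \<exists>p. ends G e = {fst p, snd p}"
    using edge_endsE[OF assms] by (metis fst_conv snd_conv)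
  then obtain p where "\<forall>e\<in>edges G. ends G e = {fst (p e), snd (p e)}" by metis
  then show thesis using that[of "fst \<circ> p" "snd \<circ> p"] by (simp add: orientation_def)
qed

definition has_resistance_triple :: "('v, 'e) mgraph \<Rightarrow> bool" where
  "has_resistance_triple G \<longleftrightarrow>
     (\<exists>t h w D f. orientation G t h \<and> resistance_triple t h w (edges G) D f)"

lemma has_resistance_tripleI:
  "orientation G t h \<Longrightarrow> resistance_triple t h w (edges G) D f \<Longrightarrow> has_resistance_triple G"
  unfolding has_resistance_triple_def by blast

lemma resistance_triple_cong:
  assumes "\<And>e. e \<in> E \<Longrightarrow> t e = t' e" "\<And>e. e \<in> E \<Longrightarrow> h e = h' e"
    and "resistance_triple t h w E D f"
  shows "resistance_triple t' h' w E D f"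
proof -
  have D: "D \<subseteq> E" using assms(3) by (simp add: resistance_triple_def)
  have "energy t h w (E - D) f' g = energy t' h' w (E - D) f' g" for f' g
    using assms(1,2) by (intro energy_cong) auto
  moreover have "t d = t' d \<and> h d = h' d" if "d \<in> D" for d using assms(1,2) D that by blast
  ultimately show ?thesis using assms(3) unfolding resistance_triple_def by auto
qed

lemma has_resistance_triple_subgraph:
  assumes G: "multigraph G" and sub: "edges H \<subseteq> edges G" "\<And>e. e \<in> edges H \<Longrightarrow> ends H e = ends G e"
    and H: "has_resistance_triple H"
  shows "has_resistance_triple G"
proof -
  obtain t h w D f where th: "orientation H t h" and R: "resistance_triple t h w (edges H) D f"
    using H unfolding has_resistance_triple_def by blast
  obtain t0 h0 where th0: "orientation G t0 h0" using orientation_exists[OF G] .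
  define t' h' where "t' e = (if e \<in> edges H then t e else t0 e)"
    and "h' e = (if e \<in> edges H then h e else h0 e)" for e
  have "resistance_triple t' h' w (edges H) D f"
    by (rule resistance_triple_cong[OF _ _ R]) (simp_all add: t'_def h'_def)
  from resistance_triple_add_edges[OF this, of "edges G"] multigraphD(2)[OF G] sub(1)
  obtain w' f' where "resistance_triple t' h' w' (edges G) D f'" by (auto simp: Un_absorb1)
  moreover have "orientation G t' h'"
    using th th0 sub by (auto simp: orientation_def t'_def h'_def)
  ultimately show ?thesis by (rule has_resistance_tripleI[rotated])
qed

text \<open>Edges parallel to \<open>e0\<close> disappear in the contraction; once \<open>e0\<close>
  has been restored, they are put back as additional edges.\<close>

lemma has_resistance_triple_uncontract:
  assumes G: "multigraph G" and e0: "e0 \<in> edges G" "ends G e0 = {u, v}" "u \<noteq> v"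
    and H: "has_resistance_triple (contract u v G)"
  shows "has_resistance_triple G"
proof -
  let ?\<pi> = "\<lambda>x. if x = v then u else x"
  define E where "E = edges (contract u v G)"
  obtain t h w D f where th: "orientation (contract u v G) t h" and R: "resistance_triple t h w E D f"
    using H unfolding has_resistance_triple_def E_def by blast
  \<comment> \<open>Every surviving edge is oriented so that the contraction carries its orientation
    to that of the given triple.\<close>
  have "\<exists>p. ends G e = {fst p, snd p} \<and> (e \<in> E \<longrightarrow> ?\<pi> (fst p) = t e \<and> ?\<pi> (snd p) = h e)"
    if e: "e \<in> edges G" for e
  proof -
    obtain i j where ij: "ends G e = {i, j}" using edge_endsE[OF G e] by metis
    show ?thesis
    proof (cases "e \<in> E")
      case True
      then have "ends (contract u v G) e = {t e, h e}" using th unfolding orientation_def E_def by blast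
      then have "{?\<pi> i, ?\<pi> j} = {t e, h e}" unfolding contract_simps ij image_insert image_empty .
      then consider "?\<pi> i = t e" "?\<pi> j = h e" | "?\<pi> i = h e" "?\<pi> j = t e" by (auto simp only: doubleton_eq_iff)
      then show ?thesis
      proof cases
        case 1
        then show ?thesis using ij by (intro exI[of _ "(i, j)"]) (auto split: if_splits)
      next
        case 2
        then show ?thesis using ij by (intro exI[of _ "(j, i)"]) (auto split: if_splits)
      qed
    qed (use ij in \<open>auto intro!: exI[of _ "(i, j)"]\<close>)
  qed
  then obtain p where p: "\<And>e. e \<in> edges G \<Longrightarrow> ends G e = {fst (p e), snd (p e)}"
      "\<And>e. e \<in> E \<Longrightarrow> e \<in> edges G \<Longrightarrow> ?\<pi> (fst (p e)) = t e \<and> ?\<pi> (snd (p e)) = h e"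
    by metis
  define T where "T = fst \<circ> p"
  define H where "H = snd \<circ> p"
  have EG: "E \<subseteq> edges G" by (auto simp: E_def)
  have "t e = (?\<pi> \<circ> T) e" "h e = (?\<pi> \<circ> H) e" if "e \<in> E" for e
    using p(2)[OF that] EG that unfolding T_def H_def o_apply by auto
  then have R': "resistance_triple (?\<pi> \<circ> T) (?\<pi> \<circ> H) w E D f"
    by (rule resistance_triple_cong[OF _ _ R])
  have "e0 \<notin> E" "{T e0, H e0} = {u, v}" using e0 p(1)[OF e0(1)] by (auto simp: E_def T_def H_def)
  from resistance_triple_uncontract[OF R' this e0(3)]
  obtain w' f' where "resistance_triple T H w' (insert e0 E) D f'" by (elim exE)
  from resistance_triple_add_edges[OF this, of "edges G"] multigraphD(2)[OF G] e0(1) EG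
  obtain w' f' where "resistance_triple T H w' (edges G) D f'" by (auto simp: Un_absorb1 insert_absorb)
  moreover have "orientation G T H" using p(1) by (simp add: orientation_def T_def H_def)
  ultimately show ?thesis by (rule has_resistance_tripleI[rotated])
qed

lemma has_resistance_triple_minor:
  assumes "minor_step\<^sup>*\<^sup>* G G'" "multigraph G" "has_resistance_triple G'"
  shows "has_resistance_triple G"
  using assms
proof (induction rule: converse_rtranclp_induct)
  case (step G H)
  then have H: "has_resistance_triple H" using multigraph_minor_step by blast
  from step.hyps(1) show ?case
  proof cases
    case (1 e)
    then show ?thesis
      using H step.prems(1) by (intro has_resistance_triple_subgraph[of G H]) (auto simp: delete_edge_def)
  next
    case (2 v)
    then show ?thesis
      using H step.prems(1) by (intro has_resistance_triple_subgraph[of G H]) (auto simp: delete_vertex_def)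
  next
    case (3 e u v)
    then show ?thesis
      using H step.prems(1) by (intro has_resistance_triple_uncontract[of G e u v]) auto
  qed
qed

lemma has_resistance_triple_iso:
  assumes G: "multigraph G" and iso: "mgraph_iso G H" and H: "has_resistance_triple H"
  shows "has_resistance_triple G"
proof -
  obtain \<phi> \<gamma> where \<phi>: "bij_betw \<phi> (verts G) (verts H)" and \<gamma>: "bij_betw \<gamma> (edges G) (edges H)"
    and ends: "\<And>e. e \<in> edges G \<Longrightarrow> ends H (\<gamma> e) = \<phi> ` ends G e"
    using iso unfolding mgraph_iso_def by metis
  obtain t h w D f where th: "orientation H t h" and R: "resistance_triple t h w (edges H) D f"
    using H unfolding has_resistance_triple_def by blast
  define \<alpha> where "\<alpha> = the_inv_into (verts G) \<phi>"
  have \<alpha>: "\<alpha> (\<phi> x) = x" if "x \<in> verts G" for x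
    using that \<phi> by (simp add: \<alpha>_def the_inv_into_f_f bij_betw_def)
  define D' where "D' = {e \<in> edges G. \<gamma> e \<in> D}"
  have DH: "D \<subseteq> edges H" using R by (simp add: resistance_triple_def)
  have D': "bij_betw \<gamma> D' D"
  proof -
    have "\<gamma> ` D' = D" using \<gamma> DH by (auto simp: D'_def bij_betw_def)
    then show ?thesis using \<gamma> by (auto simp: bij_betw_def D'_def intro: inj_on_subset)
  qed
  have ED': "bij_betw \<gamma> (edges G - D') (edges H - D)"
  proof -
    have "\<gamma> ` (edges G - D') = edges H - D" using \<gamma> by (auto simp: D'_def bij_betw_def)
    then show ?thesis using \<gamma> by (auto simp: bij_betw_def intro: inj_on_subset)
  qed
  define T where "T = \<alpha> \<circ> t \<circ> \<gamma>"
  define K where "K = \<alpha> \<circ> h \<circ> \<gamma>"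
  have th': "\<phi> (T e) = t (\<gamma> e) \<and> \<phi> (K e) = h (\<gamma> e) \<and> ends G e = {T e, K e}" if e: "e \<in> edges G" for e
  proof -
    obtain i j where ij: "ends G e = {i, j}" "i \<in> verts G" "j \<in> verts G" using edge_endsE[OF G e] by metis
    have "\<gamma> e \<in> edges H" using \<gamma> e by (auto simp: bij_betw_def)
    then have "{t (\<gamma> e), h (\<gamma> e)} = {\<phi> i, \<phi> j}"
      using ends[OF e] th ij by (simp add: orientation_def)
    then consider "t (\<gamma> e) = \<phi> i" "h (\<gamma> e) = \<phi> j" | "t (\<gamma> e) = \<phi> j" "h (\<gamma> e) = \<phi> i"
      by (auto simp only: doubleton_eq_iff)
    then show ?thesis by cases (use ij \<alpha> in \<open>auto simp: T_def K_def\<close>)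
  qed
  have "resistance_triple T K (w \<circ> \<gamma>) (edges G) D' (\<lambda>d. f (\<gamma> d) \<circ> \<phi>)"
    unfolding resistance_triple_def
  proof (intro conjI ballI allI impI)
    show "finite (edges G)" using multigraphD(2)[OF G] .
    show "D' \<subseteq> edges G" by (auto simp: D'_def)
    show "card D' = 3" using bij_betw_same_card[OF D'] R by (simp add: resistance_triple_def)
    fix e assume "e \<in> edges G - D'"
    then show "0 < (w \<circ> \<gamma>) e" using R ED' by (auto simp: resistance_triple_def bij_betw_def)
  next
    fix d g assume d: "d \<in> D'"
    have "energy T K (w \<circ> \<gamma>) (edges G - D') (f (\<gamma> d) \<circ> \<phi>) g
      = (\<Sum>e\<in>edges G - D'. w (\<gamma> e) * (f (\<gamma> d) (t (\<gamma> e)) - f (\<gamma> d) (h (\<gamma> e))) *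
          ((g \<circ> \<alpha>) (t (\<gamma> e)) - (g \<circ> \<alpha>) (h (\<gamma> e))))"
      unfolding energy_def by (rule sum.cong) (use th' in \<open>auto simp: T_def K_def\<close>)
    also have "\<dots> = energy t h w (edges H - D) (f (\<gamma> d)) (g \<circ> \<alpha>)"
      unfolding energy_def
      by (rule sum.reindex_bij_betw[OF ED', of "\<lambda>e. w e * (f (\<gamma> d) (t e) - f (\<gamma> d) (h e)) *
          ((g \<circ> \<alpha>) (t e) - (g \<circ> \<alpha>) (h e))"])
    also have "\<dots> = g (T d) - g (K d)"
      using R d D' by (auto simp: resistance_triple_def bij_betw_def T_def K_def D'_def)
    finally show "energy T K (w \<circ> \<gamma>) (edges G - D') (f (\<gamma> d) \<circ> \<phi>) g = g (T d) - g (K d)" .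
  next
    fix d d' assume d: "d \<in> D'" "d' \<in> D'" "d \<noteq> d'"
    then have "\<gamma> d \<noteq> \<gamma> d'" "\<gamma> d \<in> D" "\<gamma> d' \<in> D" using D' by (auto simp: bij_betw_def inj_on_def)
    then show "(f (\<gamma> d) \<circ> \<phi>) (T d') - (f (\<gamma> d) \<circ> \<phi>) (K d') < 0"
      using R th' d by (auto simp: resistance_triple_def D'_def)
  qed
  moreover have "orientation G T K" using th' by (simp add: orientation_def)
  ultimately show ?thesis by (rule has_resistance_tripleI[rotated])
qed

text \<open>The triangle is oriented cyclically, so that all three transfer resistances are negative.\<close>

definition triangle_tail :: "nat set \<Rightarrow> nat" where
  "triangle_tail X = (if X = {0, 2} then 2 else Min X)"

definition triangle_head :: "nat set \<Rightarrow> nat" where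
  "triangle_head X = (if X = {0, 2} then 0 else Max X)"

definition triangle_edges :: "nat set set" where
  "triangle_edges = {{0, 1}, {1, 2}, {0, 2}}"

text \<open>A dipole is, up to a factor, the potential of its own current in both networks below.
  With unit conductances and potential 0 at the centre, the star acts as the identity on its other
  vertices; the triangle acts as 3 times the identity on functions of sum 0.\<close>

definition dipole :: "nat set \<Rightarrow> nat \<Rightarrow> real" where
  "dipole X x = of_bool (x = triangle_tail X) - of_bool (x = triangle_head X)"

lemma triangle_edges_eq: "{X. X \<subseteq> {..<3 :: nat} \<and> card X = 2} = triangle_edges"
proof -
  have "X \<in> triangle_edges" if "X \<subseteq> {..<3}" "card X = 2" for X :: "nat set"
  proof -
    obtain i j where "X = {i, j}" "i \<noteq> j" using \<open>card X = 2\<close> by (auto simp: card_2_iff)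
    moreover from this have "i < 3" "j < 3" using \<open>X \<subseteq> {..<3}\<close> by auto
    moreover from this have "i = 0 \<or> i = 1 \<or> i = 2" "j = 0 \<or> j = 1 \<or> j = 2" by auto
    ultimately show ?thesis by (auto simp: triangle_edges_def doubleton_eq_iff)
  qed
  then show ?thesis by (auto simp: triangle_edges_def)
qed

lemma K4_edges_eq: "{X. X \<subseteq> {..<4 :: nat} \<and> card X = 2} = triangle_edges \<union> {{0, 3}, {1, 3}, {2, 3}}"
proof -
  have "X \<in> triangle_edges \<union> {{0, 3}, {1, 3}, {2, 3}}" if "X \<subseteq> {..<4}" "card X = 2" for X :: "nat set"
  proof -
    obtain i j where "X = {i, j}" "i \<noteq> j" using \<open>card X = 2\<close> by (auto simp: card_2_iff)
    moreover from this have "i < 4" "j < 4" using \<open>X \<subseteq> {..<4}\<close> by auto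
    moreover from this have "i = 0 \<or> i = 1 \<or> i = 2 \<or> i = 3" "j = 0 \<or> j = 1 \<or> j = 2 \<or> j = 3" by auto
    ultimately show ?thesis by (auto simp: triangle_edges_def doubleton_eq_iff)
  qed
  moreover have "X \<subseteq> {..<4} \<and> card X = 2" if "X \<in> triangle_edges \<union> {{0, 3}, {1, 3}, {2, 3}}"
    for X :: "nat set"
    using that unfolding triangle_edges_def by auto
  ultimately show ?thesis by blast
qed

lemma triangle_ends:
  "triangle_tail {0, 1} = 0" "triangle_head {0, 1} = 1"
  "triangle_tail {1, 2} = 1" "triangle_head {1, 2} = 2"
  "triangle_tail {0, 2} = 2" "triangle_head {0, 2} = 0"
  "triangle_tail {0, 3} = 0" "triangle_head {0, 3} = 3"
  "triangle_tail {1, 3} = 1" "triangle_head {1, 3} = 3"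
  "triangle_tail {2, 3} = 2" "triangle_head {2, 3} = 3"
  by (auto simp: triangle_tail_def triangle_head_def doubleton_eq_iff)

lemma dipole_negative:
  assumes "d \<in> triangle_edges" "d' \<in> triangle_edges" "d \<noteq> d'"
  shows "dipole d (triangle_tail d') - dipole d (triangle_head d') = -1"
  using assms unfolding triangle_edges_def dipole_def by (auto simp: triangle_ends simp del: One_nat_def)

lemma card_triangle_edges: "card triangle_edges = 3"
  by (auto simp: triangle_edges_def doubleton_eq_iff card_insert_if)

text \<open>The triangle 0, 1, 2 is the triple and the star at 3 is the network.\<close>

lemma K4_has_resistance_triple: "has_resistance_triple K4"
proof -
  have E: "edges K4 = triangle_edges \<union> {{0, 3}, {1, 3}, {2, 3}}" by (simp add: K4_def K4_edges_eq)
  have "triangle_edges \<inter> {{0, 3}, {1, 3}, {2, 3}} = {}"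
    by (simp add: triangle_edges_def doubleton_eq_iff)
  then have eq: "edges K4 - triangle_edges = {{0, 3}, {1, 3}, {2, 3}}" unfolding E by blast
  have "resistance_triple triangle_tail triangle_head (\<lambda>_. 1) (edges K4) triangle_edges dipole"
    unfolding resistance_triple_def
  proof (intro conjI ballI allI impI)
    fix d g assume "d \<in> triangle_edges"
    moreover have "energy triangle_tail triangle_head (\<lambda>_. 1) (edges K4 - triangle_edges) f g
        = (f 0 - f 3) * (g 0 - g 3) + (f 1 - f 3) * (g 1 - g 3) + (f 2 - f 3) * (g 2 - g 3)" for f
      unfolding eq energy_def by (simp add: triangle_ends doubleton_eq_iff del: One_nat_def)
    ultimately show "energy triangle_tail triangle_head (\<lambda>_. 1) (edges K4 - triangle_edges) (dipole d) g
        = g (triangle_tail d) - g (triangle_head d)"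
      unfolding triangle_edges_def dipole_def by (auto simp: triangle_ends simp del: One_nat_def)
    next
    show "finite (edges K4)" "triangle_edges \<subseteq> edges K4" unfolding E by (auto simp: triangle_edges_def)
  next
    fix d d' assume "d \<in> triangle_edges" "d' \<in> triangle_edges" "d \<noteq> d'"
    then show "dipole d (triangle_tail d') - dipole d (triangle_head d') < 0"
      using dipole_negative[of d d'] by simp
  qed (simp_all add: card_triangle_edges)
  moreover have "orientation K4 triangle_tail triangle_head"
    unfolding orientation_def E by (auto simp: K4_def triangle_edges_def triangle_ends simp del: One_nat_def)
  ultimately show ?thesis by (rule has_resistance_tripleI[rotated])
qed

text \<open>One copy of each edge belongs to the triple and the other copies form the network. The
  conductance 1/3 offsets the factor 3 of the triangle on dipoles.\<close>

lemma doubled_K3_has_resistance_triple: "has_resistance_triple doubled_K3"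
proof -
  let ?t = "triangle_tail \<circ> fst" and ?h = "triangle_head \<circ> fst" and ?D = "triangle_edges \<times> {True}"
  have E: "edges doubled_K3 = triangle_edges \<times> UNIV" by (simp add: doubled_K3_def triangle_edges_eq)
  have eq: "edges doubled_K3 - ?D = (\<lambda>X. (X, False)) ` triangle_edges" unfolding E by auto
  have en: "energy ?t ?h (\<lambda>_. 1 / 3) (edges doubled_K3 - ?D) f g
      = ((f 0 - f 1) * (g 0 - g 1) + (f 1 - f 2) * (g 1 - g 2) + (f 2 - f 0) * (g 2 - g 0)) / 3" for f g
  proof -
    have "energy ?t ?h (\<lambda>_. 1 / 3) (edges doubled_K3 - ?D) f g
      = energy triangle_tail triangle_head (\<lambda>_. 1 / 3) triangle_edges f g"
      unfolding eq energy_def by (subst sum.reindex) (auto simp: inj_on_def)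
    also have "\<dots> = ((f 0 - f 1) * (g 0 - g 1) + (f 1 - f 2) * (g 1 - g 2) + (f 2 - f 0) * (g 2 - g 0)) / 3"
      unfolding triangle_edges_def energy_def
      by (simp add: triangle_ends doubleton_eq_iff add_divide_distrib del: One_nat_def)
    finally show ?thesis .
  qed
  have "resistance_triple ?t ?h (\<lambda>_. 1 / 3) (edges doubled_K3) ?D (\<lambda>d. dipole (fst d))"
    unfolding resistance_triple_def
  proof (intro conjI ballI allI impI)
    fix d g assume "d \<in> ?D"
    then have "fst d \<in> triangle_edges" by auto
    then have "(f 0 - f 1) * (g 0 - g 1) + (f 1 - f 2) * (g 1 - g 2) + (f 2 - f 0) * (g 2 - g 0)
        = 3 * (g (?t d) - g (?h d))" if "f = dipole (fst d)" for f
      using that unfolding triangle_edges_def dipole_def o_apply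
      by (elim insertE emptyE) (simp_all add: triangle_ends del: One_nat_def)
    from this[OF refl] show "energy ?t ?h (\<lambda>_. 1 / 3) (edges doubled_K3 - ?D) (dipole (fst d)) g
        = g (?t d) - g (?h d)"
      unfolding en by simp
  next
    fix d d' assume "d \<in> ?D" "d' \<in> ?D" "d \<noteq> d'"
    then have "dipole (fst d) (?t d') - dipole (fst d) (?h d') = -1"
      unfolding o_apply by (intro dipole_negative) auto
    then show "dipole (fst d) (?t d') - dipole (fst d) (?h d') < 0"
      by simp
  next
    show "card ?D = 3" using card_triangle_edges by (simp add: card_cartesian_product)
  qed (auto simp: E triangle_edges_def)
  moreover have "orientation doubled_K3 ?t ?h"
    unfolding orientation_def E by (auto simp: doubled_K3_def triangle_edges_def triangle_ends simp del: One_nat_def)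
  ultimately show ?thesis by (rule has_resistance_tripleI[rotated])
qed

lemma has_resistance_triple_if_minor:
  assumes "multigraph G" "has_minor G K4 \<or> has_minor G doubled_K3"
  shows "has_resistance_triple G"
  using assms has_resistance_triple_minor has_resistance_triple_iso multigraph_minor
    K4_has_resistance_triple doubled_K3_has_resistance_triple
  unfolding has_minor_def by metis

section \<open>Dimensions of subspaces and kernels of Laplacians\<close>

abbreviation real_space :: "nat \<Rightarrow> (real, real vec) module" where
  "real_space n \<equiv> module_vec TYPE(real) n"

definition subspace_dim :: "nat \<Rightarrow> real vec set \<Rightarrow> nat" where
  "subspace_dim n W = vectorspace.dim class_ring (real_space n\<lparr>carrier := W\<rparr>)"

text \<open>Stated for an indexed family, so that a repeated vector counts as a dependence, which
  independence of the set of its members would not detect.\<close>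

definition independent_family :: "nat \<Rightarrow> nat \<Rightarrow> (nat \<Rightarrow> real vec) \<Rightarrow> bool" where
  "independent_family n k b \<longleftrightarrow>
     (\<forall>c. (\<forall>a<n. (\<Sum>i<k. c i * b i $ a) = 0) \<longrightarrow> (\<forall>i<k. c i = 0))"

text \<open>Independence inside \<open>W\<close> agrees with independence in the whole space, where
  it bounds cardinalities; hence a maximal independent subset of \<open>W\<close> exists and is a
  finite basis.\<close>

lemma subspace_fin_dim:
  assumes "submodule class_ring W (real_space n)"
  shows "vectorspace class_ring (real_space n\<lparr>carrier := W\<rparr>)"
    and "vectorspace.fin_dim class_ring (real_space n\<lparr>carrier := W\<rparr>)"
proof -
  interpret vec_space "TYPE(real)" n .
  have WV: "W \<subseteq> carrier_vec n" using submodule.subset[OF assms] by (simp add: module_vec_simps)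
  have "subspace class_ring W V"
    using assms vectorspace_axioms by (simp add: subspace_def)
  then show vs: "vectorspace class_ring (V\<lparr>carrier := W\<rparr>)" by (rule subspace_is_vs)
  interpret W: vectorspace class_ring "V\<lparr>carrier := W\<rparr>" by (rule vs)
  have li: "W.lin_dep S \<longleftrightarrow> lin_dep S" if "S \<subseteq> W" for S
    by (rule span_li_not_depend(2)[OF that assms])
  have "\<exists>A. finite A \<and> maximal A (\<lambda>S. S \<subseteq> W \<and> W.lin_indpt S)"
  proof (rule maximal_exists[of _ dim "{}"])
    fix A assume A: "A \<subseteq> W \<and> W.lin_indpt A"
    then show "finite A \<and> card A \<le> dim"
      using li[of A] WV li_le_dim[OF fin_dim, of A] by auto
  qed (auto simp: W.lin_dep_def)
  then obtain A where A: "finite A" "maximal A (\<lambda>S. S \<subseteq> W \<and> W.lin_indpt S)" by blast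
  then have "W.basis A" using W.max_li_is_basis by simp
  then show "W.fin_dim" using A(1) unfolding W.fin_dim_def W.basis_def by blast
qed

lemma independent_family_le_dim:
  assumes W: "submodule class_ring W (real_space n)"
    and b: "\<And>i. i < k \<Longrightarrow> b i \<in> W" and ind: "independent_family n k b"
  shows "k \<le> subspace_dim n W"
proof -
  interpret vec_space "TYPE(real)" n .
  interpret W: vectorspace class_ring "V\<lparr>carrier := W\<rparr>" by (rule subspace_fin_dim(1)[OF W])
  have WV: "W \<subseteq> carrier_vec n" using submodule.subset[OF W] by (simp add: module_vec_simps)
  let ?A = "b ` {..<k}"
  have inj: "inj_on b {..<k}"
  proof (rule inj_onI, rule ccontr)
    fix i j assume ij: "i \<in> {..<k}" "j \<in> {..<k}" "b i = b j" "i \<noteq> j"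
    let ?c = "\<lambda>l. if l = i then 1 else if l = j then -1 else 0 :: real"
    have "(\<Sum>l<k. ?c l * b l $ a) = 0" for a
    proof -
      have "(\<Sum>l<k. ?c l * b l $ a) = (\<Sum>l\<in>{i, j}. ?c l * b l $ a)"
        using ij(1,2) by (intro sum.mono_neutral_right) auto
      also have "\<dots> = b i $ a - b j $ a" using ij(4) by simp
      finally show ?thesis unfolding ij(3) by simp
    qed
    then have "?c i = 0" using ind[unfolded independent_family_def, rule_format, of ?c i] ij(1) by blast
    then show False by simp
  qed
  have "lin_indpt ?A"
  proof (rule finite_lin_indpt2)
    fix a assume a: "lincomb a ?A = 0\<^sub>v n"
    have "(\<Sum>i<k. a (b i) * b i $ r) = 0" if "r < n" for r
    proof -
      have "(\<Sum>x\<in>?A. a x * x $ r) = 0"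
        using arg_cong[OF a, of "\<lambda>v. v $ r"] that b WV by (subst (asm) lincomb_index) auto
      then show ?thesis by (simp add: sum.reindex[OF inj])
    qed
    then have "\<forall>i<k. a (b i) = 0"
      using ind[unfolded independent_family_def, rule_format, of "\<lambda>i. a (b i)"] by blast
    then show "\<forall>v\<in>?A. a v = 0" by auto
  qed (use b WV in auto)
  then have "W.lin_indpt ?A"
    using span_li_not_depend(2)[OF _ W, of ?A] b by auto
  then have "card ?A \<le> W.dim"
    using W.li_le_dim(2)[OF subspace_fin_dim(2)[OF W], of ?A] b by auto
  then show ?thesis by (simp add: subspace_dim_def card_image[OF inj])
qed

lemma sum_in_subspace:
  fixes k :: nat
  assumes W: "submodule class_ring W (real_space n)" and b: "\<And>i. i < k \<Longrightarrow> b i \<in> W"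
  shows "vec n (\<lambda>a. \<Sum>i<k. c i * b i $ a) \<in> W"
  using b
proof (induction k)
  case 0
  have "vec n (\<lambda>a. \<Sum>i<0. c i * b i $ a) = 0\<^sub>v n" by auto
  then show ?case using submodule.zero_closed[OF W] by (simp add: module_vec_simps)
next
  case (Suc k)
  let ?x = "vec n (\<lambda>a. \<Sum>i<k. c i * b i $ a)"
  have WV: "W \<subseteq> carrier_vec n" using submodule.subset[OF W] by (simp add: module_vec_simps)
  have "?x \<in> W" "c k \<cdot>\<^sub>v b k \<in> W"
    using Suc submodule.smult_closed[OF W, of "c k" "b k"] by (auto simp: module_vec_simps)
  then have "?x + c k \<cdot>\<^sub>v b k \<in> W"
    using submodule.m_closed[OF W] by (simp add: module_vec_simps)
  moreover have "vec n (\<lambda>a. \<Sum>i<Suc k. c i * b i $ a) = ?x + c k \<cdot>\<^sub>v b k"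
    using WV Suc.prems[of k] by (intro eq_vecI) auto
  ultimately show ?case by simp
qed

lemma generating_family_ge_dim:
  fixes k :: nat
  assumes W: "submodule class_ring W (real_space n)"
    and b: "\<And>i. i < k \<Longrightarrow> b i \<in> W"
    and gen: "\<And>x. x \<in> W \<Longrightarrow> \<exists>c. \<forall>a<n. x $ a = (\<Sum>i<k. c i * b i $ a)"
  shows "subspace_dim n W \<le> k"
proof -
  interpret vec_space "TYPE(real)" n .
  interpret W: vectorspace class_ring "V\<lparr>carrier := W\<rparr>" by (rule subspace_fin_dim(1)[OF W])
  have WV: "W \<subseteq> carrier_vec n" using submodule.subset[OF W] by (simp add: module_vec_simps)
  let ?A = "b ` {..<k}"
  have AW: "?A \<subseteq> W" using b by auto
  have sub: "submodule class_ring (span ?A) V" using AW WV by (intro span_is_submodule) auto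
  have "x \<in> span ?A" if x: "x \<in> W" for x
  proof -
    obtain c where "\<And>a. a < n \<Longrightarrow> x $ a = (\<Sum>i<k. c i * b i $ a)" using gen[OF x] by blast
    then have "x = vec n (\<lambda>a. \<Sum>i<k. c i * b i $ a)" using x WV by (intro eq_vecI) auto
    moreover have "b i \<in> span ?A" if "i < k" for i
      using AW WV that in_own_span[of ?A] by auto
    ultimately show ?thesis using sum_in_subspace[OF sub, of k b c] by simp
  qed
  moreover have "W.span ?A = span ?A" by (rule span_li_not_depend(1)[OF AW W])
  moreover have "W.span ?A \<subseteq> W" using W.span_is_subset2[of ?A] AW by simp
  ultimately have "W.span ?A = W" by blast
  then have "W.dim \<le> card ?A" using W.gen_ge_dim[of ?A] AW by simp
  also have "\<dots> \<le> k" using card_image_le[of "{..<k}" b] by simp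
  finally show ?thesis by (simp add: subspace_dim_def)
qed

text \<open>If \<open>x\<close> were not generated, appending it would give \<open>k + 1\<close>
  independent vectors in \<open>W\<close>.\<close>

lemma independent_family_generates:
  assumes W: "submodule class_ring W (real_space n)"
    and b: "\<And>i. i < k \<Longrightarrow> b i \<in> W" and ind: "independent_family n k b"
    and dim: "subspace_dim n W = k" and x: "x \<in> W"
  shows "\<exists>c. \<forall>a<n. x $ a = (\<Sum>i<k. c i * b i $ a)"
proof (rule ccontr)
  assume no: "\<not> ?thesis"
  let ?b = "b(k := x)"
  have "independent_family n (Suc k) ?b"
    unfolding independent_family_def
  proof (intro allI impI)
    fix c i assume c: "\<forall>a<n. (\<Sum>i<Suc k. c i * ?b i $ a) = 0" and i: "i < Suc k"
    have eq: "(\<Sum>i<k. c i * b i $ a) + c k * x $ a = 0" if "a < n" for a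
      using c that by simp
    have "c k = 0"
    proof (rule ccontr)
      assume "c k \<noteq> 0"
      have "x $ a = (\<Sum>i<k. (- c i / c k) * b i $ a)" if "a < n" for a
      proof -
        have "(\<Sum>i<k. (- c i / c k) * b i $ a) = - (\<Sum>i<k. c i * b i $ a) / c k"
          by (simp add: sum_negf sum_divide_distrib)
        also have "\<dots> = x $ a" using eq[OF that] \<open>c k \<noteq> 0\<close> by (simp add: field_simps add_eq_0_iff)
        finally show ?thesis by simp
      qed
      then have "\<exists>c. \<forall>a<n. x $ a = (\<Sum>i<k. c i * b i $ a)"
        by (intro exI[of _ "\<lambda>i. - c i / c k"]) simp
      with no show False ..
    qed
    moreover from this have "c j = 0" if "j < k" for j
      using ind[unfolded independent_family_def, rule_format, of c j] eq that by simp
    ultimately show "c i = 0" using i by (cases "i = k") auto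
  qed
  moreover have "?b i \<in> W" if "i < Suc k" for i using that b x by (auto simp: less_Suc_eq)
  ultimately have "Suc k \<le> subspace_dim n W" by (intro independent_family_le_dim[OF W])
  then show False using dim by simp
qed

lemma mat_kernel_submodule:
  fixes A :: "real mat"
  assumes "A \<in> carrier_mat r n"
  shows "submodule class_ring (mat_kernel A) (real_space n)" "kernel_dim A = subspace_dim n (mat_kernel A)"
proof -
  interpret kernel r n A by unfold_locales fact
  show "submodule class_ring (mat_kernel A) (real_space n)"
    unfolding submodule_def
    by (insert NC.module_axioms mult_add_distrib_mat_vec[OF A] mult_mat_vec[OF A] mat_kernel[OF A],
        auto simp: module_vec_simps class_ring_simps)
  show "kernel_dim A = subspace_dim n (mat_kernel A)"
    using assms by (simp add: kernel_dim_def subspace_dim_def)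
qed

section \<open>The Laplacian matrix as a form on vertex functions\<close>

lemma energy_cong_verts:
  assumes "multigraph G" "orientation G t h"
    and "\<And>v. v \<in> verts G \<Longrightarrow> f v = f' v" "\<And>v. v \<in> verts G \<Longrightarrow> g v = g' v"
  shows "energy t h w (edges G) f g = energy t h w (edges G) f' g'"
proof (rule energy_cong)
  fix e assume e: "e \<in> edges G"
  then have "t e \<in> verts G" "h e \<in> verts G"
    using multigraphD(3)[OF assms(1) e] assms(2) by (auto simp: orientation_def)
  then show "f (t e) - f (h e) = f' (t e) - f' (h e)" "g (t e) - g (h e) = g' (t e) - g' (h e)"
    using assms(3,4) by simp_all
qed simp

text \<open>Super stability speaks of a matrix indexed by labels, the network arguments of a form on
  vertex functions. Here semidefiniteness and kernels are transferred between the two; the weights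
  \<open>\<omega>\<close> may have either sign.\<close>

locale labelled_graph =
  fixes G :: "('v, 'e) mgraph" and l :: "'v \<Rightarrow> nat" and \<omega> :: "'e \<Rightarrow> real"
    and t h :: "'e \<Rightarrow> 'v"
  assumes multigraph: "multigraph G" and l: "bij_betw l (verts G) {..<card (verts G)}"
    and orientation: "orientation G t h"
begin

abbreviation "N \<equiv> card (verts G)"
abbreviation "L \<equiv> laplacian G l \<omega>"
abbreviation "form \<equiv> energy t h \<omega> (edges G)"

definition to_fun :: "real vec \<Rightarrow> 'v \<Rightarrow> real" where
  "to_fun x v = x $ l v"

definition to_vec :: "('v \<Rightarrow> real) \<Rightarrow> real vec" where
  "to_vec f = vec N (\<lambda>a. f (the_inv_into (verts G) l a))"

lemma l_less: "v \<in> verts G \<Longrightarrow> l v < N"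
  using l by (auto simp: bij_betw_def)

lemma to_vec_carrier [simp]: "to_vec f \<in> carrier_vec N"
  by (simp add: to_vec_def)

lemma to_fun_to_vec: "v \<in> verts G \<Longrightarrow> to_fun (to_vec f) v = f v"
  using l l_less by (simp add: to_fun_def to_vec_def the_inv_into_f_f bij_betw_def)

lemma to_vec_index: "v \<in> verts G \<Longrightarrow> to_vec f $ l v = f v"
  using to_fun_to_vec by (simp add: to_fun_def)

lemma index_verts: "a < N \<Longrightarrow> \<exists>v\<in>verts G. a = l v"
  using l by (auto simp: bij_betw_def)

lemma L_carrier: "L \<in> carrier_mat N N"
  by (simp add: laplacian_def)

lemma L_transpose: "L\<^sup>T = L"
  by (rule eq_matI) (auto simp: laplacian_def mult.commute)

text \<open>The edge vector is oriented by labels, \<open>t\<close> and \<open>h\<close>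
  arbitrarily; a product of two differences does not see the orientation.\<close>

lemma edge_vec_product:
  assumes e: "e \<in> edges G"
  shows "(\<Sum>a<N. edge_vec G l e $ a * x $ a) * (\<Sum>a<N. edge_vec G l e $ a * y $ a)
    = (to_fun x (t e) - to_fun x (h e)) * (to_fun y (t e) - to_fun y (h e))"
proof -
  have ends: "ends G e = {t e, h e}" using orientation e by (simp add: orientation_def)
  then have V: "t e \<in> verts G" "h e \<in> verts G" using multigraphD(3)[OF multigraph e] by auto
  have unit: "(\<Sum>a<N. (unit_vec N i - unit_vec N j) $ a * x $ a) = x $ i - x $ j"
    if "i < N" "j < N" for i j and x :: "real vec"
  proof -
    have "(\<Sum>a<N. (unit_vec N i - unit_vec N j) $ a * x $ a)
      = (\<Sum>a<N. (if a = i then x $ a else 0) - (if a = j then x $ a else 0))"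
      using that by (intro sum.cong) auto
    then show ?thesis using that by (simp add: sum_subtractf)
  qed
  have ev: "edge_vec G l e = unit_vec N (min (l (t e)) (l (h e))) - unit_vec N (max (l (t e)) (l (h e)))"
    by (simp add: edge_vec_def ends)
  show ?thesis
  proof (cases "l (t e) \<le> l (h e)")
    case True
    then show ?thesis
      using unit[OF l_less[OF V(1)] l_less[OF V(2)]] by (simp add: ev to_fun_def)
  next
    case False
    then have ev': "edge_vec G l e = unit_vec N (l (h e)) - unit_vec N (l (t e))" by (simp add: ev)
    show ?thesis
      unfolding ev' unit[OF l_less[OF V(2)] l_less[OF V(1)]] to_fun_def by (simp add: algebra_simps)
  qed
qed

lemma laplacian_form:
  assumes x: "x \<in> carrier_vec N" and y: "y \<in> carrier_vec N"
  shows "y \<bullet> (L *\<^sub>v x) = form (to_fun x) (to_fun y)"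
proof -
  let ?e = "\<lambda>e a. edge_vec G l e $ a"
  have "y \<bullet> (L *\<^sub>v x) = (\<Sum>a<N. y $ a * (\<Sum>b<N. (\<Sum>e\<in>edges G. \<omega> e * (?e e a * ?e e b)) * x $ b))"
    using x y by (simp add: scalar_prod_def laplacian_def atLeast0LessThan)
  also have "\<dots> = (\<Sum>a<N. \<Sum>b<N. \<Sum>e\<in>edges G. \<omega> e * ((?e e b * x $ b) * (?e e a * y $ a)))"
    by (simp add: sum_distrib_left sum_distrib_right mult_ac)
  also have "\<dots> = (\<Sum>a<N. \<Sum>e\<in>edges G. \<Sum>b<N. \<omega> e * ((?e e b * x $ b) * (?e e a * y $ a)))"
    by (intro sum.cong refl sum.swap)
  also have "\<dots> = (\<Sum>e\<in>edges G. \<Sum>a<N. \<Sum>b<N. \<omega> e * ((?e e b * x $ b) * (?e e a * y $ a)))"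
    by (rule sum.swap)
  also have "\<dots> = (\<Sum>e\<in>edges G. \<omega> e * ((\<Sum>b<N. ?e e b * x $ b) * (\<Sum>a<N. ?e e a * y $ a)))"
    by (simp add: sum_product sum_distrib_left sum_distrib_right mult_ac)
  also have "\<dots> = form (to_fun x) (to_fun y)"
    unfolding energy_def by (intro sum.cong refl) (simp add: edge_vec_product mult.assoc)
  finally show ?thesis .
qed

lemma form_to_vec: "form (to_fun (to_vec f)) (to_fun (to_vec g)) = form f g"
  by (rule energy_cong_verts[OF multigraph orientation]) (simp_all add: to_fun_to_vec)

lemma pos_semidef_iff: "pos_semidef L \<longleftrightarrow> (\<forall>f. form f f \<ge> 0)"
proof
  assume "pos_semidef L"
  then have "to_vec f \<bullet> (L *\<^sub>v to_vec f) \<ge> 0" for f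
    using L_carrier by (auto simp: pos_semidef_def)
  then show "\<forall>f. form f f \<ge> 0" by (simp add: laplacian_form form_to_vec)
next
  assume "\<forall>f. form f f \<ge> 0"
  then show "pos_semidef L"
    using L_carrier L_transpose by (auto simp: pos_semidef_def laplacian_form)
qed

lemma mat_kernel_iff: "x \<in> mat_kernel L \<longleftrightarrow> x \<in> carrier_vec N \<and> (\<forall>g. form (to_fun x) g = 0)"
proof
  assume "x \<in> mat_kernel L"
  then have x: "x \<in> carrier_vec N" "L *\<^sub>v x = 0\<^sub>v N" using mat_kernelD[OF L_carrier] by auto
  have "form (to_fun x) g = 0" for g
  proof -
    have "form (to_fun x) g = form (to_fun x) (to_fun (to_vec g))"
      by (rule energy_cong_verts[OF multigraph orientation]) (simp_all add: to_fun_to_vec)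
    also have "\<dots> = 0" using laplacian_form[OF x(1), of "to_vec g"] x(2) by simp
    finally show ?thesis .
  qed
  then show "x \<in> carrier_vec N \<and> (\<forall>g. form (to_fun x) g = 0)" using x by blast
next
  assume x: "x \<in> carrier_vec N \<and> (\<forall>g. form (to_fun x) g = 0)"
  have "(L *\<^sub>v x) $ a = 0" if a: "a < N" for a
  proof -
    have "unit_vec N a \<bullet> (L *\<^sub>v x) = 0" using laplacian_form[of x "unit_vec N a"] x by simp
    moreover have "L *\<^sub>v x \<in> carrier_vec N" using L_carrier x by auto
    ultimately show ?thesis using a by simp
  qed
  then have "L *\<^sub>v x = 0\<^sub>v N" using L_carrier by (intro eq_vecI) auto
  then show "x \<in> mat_kernel L" using mat_kernelI[OF L_carrier] x by blast
qed

lemma to_vec_kernel: "(\<And>g. form f g = 0) \<Longrightarrow> to_vec f \<in> mat_kernel L"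
proof -
  assume f: "\<And>g. form f g = 0"
  have "form (to_fun (to_vec f)) g = form f g" for g
    by (rule energy_cong_verts[OF multigraph orientation]) (simp_all add: to_fun_to_vec)
  then show ?thesis using f by (simp add: mat_kernel_iff)
qed

lemma independent_to_vec:
  assumes "\<And>c. (\<And>v. v \<in> verts G \<Longrightarrow> (\<Sum>i<k. c i * u i v) = 0) \<Longrightarrow> \<forall>i<k. c i = 0"
  shows "independent_family N k (\<lambda>i. to_vec (u i))"
  unfolding independent_family_def
proof (intro allI impI)
  fix c i assume c: "\<forall>a<N. (\<Sum>i<k. c i * to_vec (u i) $ a) = 0" and i: "i < k"
  have "(\<Sum>i<k. c i * u i v) = 0" if "v \<in> verts G" for v
    using c[rule_format, OF l_less[OF that]] by (simp add: to_vec_index[OF that])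
  then show "c i = 0" using assms i by blast
qed

lemma kernel_dim_le_card: "kernel_dim L \<le> N"
proof -
  interpret kernel N N L using L_carrier by unfold_locales
  show ?thesis unfolding mat_kernel_submodule(2)[OF L_carrier]
  proof -
    have sub: "submodule class_ring (mat_kernel L) (real_space N)"
      by (rule mat_kernel_submodule(1)[OF L_carrier])
    obtain A where A: "finite A" "Ker.basis A"
      using subspace_fin_dim[OF sub] vectorspace.finite_basis_exists by blast
    have "A \<subseteq> mat_kernel L" "Ker.lin_indpt A" using A(2) by (auto simp: Ker.basis_def)
    then have "NC.lin_indpt A" "A \<subseteq> carrier_vec N"
      using lindep_same mat_kernel_carrier[OF L_carrier] by auto
    then have "card A \<le> N" using NC.li_le_dim(2)[OF NC.fin_dim, of A] NC.dim_is_n by simp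
    then show "subspace_dim N (mat_kernel L) \<le> N"
      using Ker.dim_basis[OF A] by (simp add: subspace_dim_def)
  qed
qed

lemma kernel_dim_eqI:
  assumes ker: "\<And>i g. i < k \<Longrightarrow> form (u i) g = 0"
    and ind: "\<And>c. (\<And>v. v \<in> verts G \<Longrightarrow> (\<Sum>i<k. c i * u i v) = 0) \<Longrightarrow> \<forall>i<k. c i = 0"
    and gen: "\<And>f. (\<And>g. form f g = 0) \<Longrightarrow> \<exists>c. \<forall>v\<in>verts G. f v = (\<Sum>i<k. c i * u i v)"
  shows "kernel_dim L = k"
  unfolding mat_kernel_submodule(2)[OF L_carrier]
proof (rule antisym)
  note sub = mat_kernel_submodule(1)[OF L_carrier]
  show "k \<le> subspace_dim N (mat_kernel L)"
    by (rule independent_family_le_dim[OF sub _ independent_to_vec[where u = u, OF ind]]) (simp_all add: to_vec_kernel ker)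
  show "subspace_dim N (mat_kernel L) \<le> k"
  proof (rule generating_family_ge_dim[OF sub, of k "\<lambda>i. to_vec (u i)"])
    fix x assume "x \<in> mat_kernel L"
    then have "\<And>g. form (to_fun x) g = 0" by (simp add: mat_kernel_iff)
    from gen[OF this] obtain c where c: "\<And>v. v \<in> verts G \<Longrightarrow> to_fun x v = (\<Sum>i<k. c i * u i v)" by blast
    have "x $ a = (\<Sum>i<k. c i * to_vec (u i) $ a)" if "a < N" for a
    proof -
      obtain v where v: "v \<in> verts G" "a = l v" using index_verts[OF \<open>a < N\<close>] by blast
      show ?thesis using c[OF v(1)] by (simp add: v(2) to_vec_index[OF v(1)] to_fun_def)
    qed
    then show "\<exists>c. \<forall>a<N. x $ a = (\<Sum>i<k. c i * to_vec (u i) $ a)" by (intro exI[of _ c]) simp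
  qed (simp add: to_vec_kernel ker)
qed

lemma kernel_dim_generates:
  assumes dim: "kernel_dim L = k" and ker: "\<And>i g. i < k \<Longrightarrow> form (u i) g = 0"
    and ind: "\<And>c. (\<And>v. v \<in> verts G \<Longrightarrow> (\<Sum>i<k. c i * u i v) = 0) \<Longrightarrow> \<forall>i<k. c i = 0"
    and f: "\<And>g. form f g = 0"
  shows "\<exists>c. \<forall>v\<in>verts G. f v = (\<Sum>i<k. c i * u i v)"
proof -
  note sub = mat_kernel_submodule(1)[OF L_carrier]
  have "\<exists>c. \<forall>a<N. to_vec f $ a = (\<Sum>i<k. c i * to_vec (u i) $ a)"
  proof (rule independent_family_generates[OF sub _ independent_to_vec[where u = u, OF ind]])
    show "subspace_dim N (mat_kernel L) = k" using dim mat_kernel_submodule(2)[OF L_carrier] by simp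
  qed (simp_all add: to_vec_kernel ker f)
  then obtain c where c: "\<And>a. a < N \<Longrightarrow> to_vec f $ a = (\<Sum>i<k. c i * to_vec (u i) $ a)" by blast
  have "f v = (\<Sum>i<k. c i * u i v)" if "v \<in> verts G" for v
    using c[OF l_less[OF that]] by (simp add: to_vec_index[OF that])
  then show ?thesis by blast
qed

end

section \<open>Equilibrium stresses and affine spans\<close>

lemma sum_indicator:
  fixes g :: "'a \<Rightarrow> real"
  assumes "finite A" "i \<in> A"
  shows "(\<Sum>j\<in>A. (if j = i then 1 else 0) * g j) = g i"
proof -
  have "(\<Sum>j\<in>A. (if j = i then 1 else 0) * g j) = (\<Sum>j\<in>A. if j = i then g j else 0)"
    by (intro sum.cong) auto
  then show ?thesis using assms by simp
qed

text \<open>Summation by parts: every edge contributes once at each of its two ends.\<close>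

lemma energy_by_vertices:
  assumes G: "multigraph G" and th: "orientation G t h"
  shows "energy t h \<omega> (edges G) f g
    = - (\<Sum>i\<in>verts G. g i * (\<Sum>e\<in>{e \<in> edges G. i \<in> ends G e}. \<omega> e * (f (other_end G e i) - f i)))"
proof -
  have "(\<Sum>i\<in>verts G. g i * (\<Sum>e\<in>{e \<in> edges G. i \<in> ends G e}. \<omega> e * (f (other_end G e i) - f i)))
    = (\<Sum>i\<in>verts G. \<Sum>e\<in>{e \<in> edges G. i \<in> ends G e}. g i * (\<omega> e * (f (other_end G e i) - f i)))"
    by (simp add: sum_distrib_left)
  also have "\<dots> = (\<Sum>e\<in>edges G. \<Sum>i\<in>{i \<in> verts G. i \<in> ends G e}. g i * (\<omega> e * (f (other_end G e i) - f i)))"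
    using multigraphD(1,2)[OF G] by (rule sum.swap_restrict)
  also have "\<dots> = (\<Sum>e\<in>edges G. - (\<omega> e * (f (t e) - f (h e)) * (g (t e) - g (h e))))"
  proof (rule sum.cong[OF refl])
    fix e assume e: "e \<in> edges G"
    then have ends: "ends G e = {t e, h e}" using th by (simp add: orientation_def)
    have ne: "t e \<noteq> h e" using multigraphD(5)[OF G e ends] .
    have set: "{i \<in> verts G. i \<in> ends G e} = {t e, h e}" using multigraphD(3)[OF G e] ends by auto
    have "other_end G e (t e) = h e" "other_end G e (h e) = t e"
      using ne by (simp_all add: other_end_def ends insert_Diff_if)
    then show "(\<Sum>i\<in>{i \<in> verts G. i \<in> ends G e}. g i * (\<omega> e * (f (other_end G e i) - f i)))
        = - (\<omega> e * (f (t e) - f (h e)) * (g (t e) - g (h e)))"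
      unfolding set using ne by (simp add: algebra_simps)
  qed
  also have "\<dots> = - energy t h \<omega> (edges G) f g" by (simp add: energy_def sum_negf)
  finally show ?thesis by simp
qed

text \<open>The weighted sum at a vertex is, up to sign, the form tested with the indicator of that
  vertex. Equilibrium thus says that every coordinate of \<open>p\<close> lies in the radical of the
  form.\<close>

lemma equilibrium_stress_iff:
  assumes G: "multigraph G" and th: "orientation G t h"
    and p: "\<And>v. v \<in> verts G \<Longrightarrow> p v \<in> carrier_vec m"
  shows "equilibrium_stress m G p \<omega> \<longleftrightarrow> (\<forall>c<m. \<forall>g. energy t h \<omega> (edges G) (\<lambda>v. p v $ c) g = 0)"
proof -
  let ?E = "\<lambda>i. {e \<in> edges G. i \<in> ends G e}"
  let ?S = "\<lambda>i. finsum_vec TYPE(real) m (\<lambda>e. \<omega> e \<cdot>\<^sub>v (p (other_end G e i) - p i)) (?E i)"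
  have other: "other_end G e i \<in> verts G" if ei: "e \<in> edges G" "i \<in> ends G e" for e i
  proof -
    obtain w where w: "ends G e = {i, w}" "i \<noteq> w" by (rule edge_at_vertexE[OF G ei])
    then have "other_end G e i = w" by (simp add: other_end_def insert_Diff_if)
    then show ?thesis using w multigraphD(3)[OF G ei(1)] by auto
  qed
  have closed: "(\<lambda>e. \<omega> e \<cdot>\<^sub>v (p (other_end G e i) - p i)) \<in> ?E i \<rightarrow> carrier_vec m" if "i \<in> verts G" for i
    using p other that by auto
  have index: "?S i $ c = (\<Sum>e\<in>?E i. \<omega> e * (p (other_end G e i) $ c - p i $ c))"
    if i: "i \<in> verts G" and c: "c < m" for i c
  proof -
    have "?S i $ c = (\<Sum>e\<in>?E i. (\<omega> e \<cdot>\<^sub>v (p (other_end G e i) - p i)) $ c)"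
      using multigraphD(2)[OF G] c closed[OF i] by (intro index_finsum_vec) auto
    also have "\<dots> = (\<Sum>e\<in>?E i. \<omega> e * (p (other_end G e i) $ c - p i $ c))"
      using p[OF i] p[OF other] c by (intro sum.cong refl) auto
    finally show ?thesis .
  qed
  have "?S i = 0\<^sub>v m \<longleftrightarrow> (\<forall>c<m. (\<Sum>e\<in>?E i. \<omega> e * (p (other_end G e i) $ c - p i $ c)) = 0)"
    if i: "i \<in> verts G" for i
  proof
    assume "?S i = 0\<^sub>v m"
    then show "\<forall>c<m. (\<Sum>e\<in>?E i. \<omega> e * (p (other_end G e i) $ c - p i $ c)) = 0"
      using index[OF i] by simp
  next
    assume *: "\<forall>c<m. (\<Sum>e\<in>?E i. \<omega> e * (p (other_end G e i) $ c - p i $ c)) = 0"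
    have "?S i \<in> carrier_vec m" using closed[OF i] by (rule finsum_vec_closed)
    then show "?S i = 0\<^sub>v m" using * index[OF i] by (intro eq_vecI) auto
  qed
  then have eq: "equilibrium_stress m G p \<omega> \<longleftrightarrow>
      (\<forall>i\<in>verts G. \<forall>c<m. (\<Sum>e\<in>?E i. \<omega> e * (p (other_end G e i) $ c - p i $ c)) = 0)"
    by (simp add: equilibrium_stress_def)
  show ?thesis
  proof
    assume "equilibrium_stress m G p \<omega>"
    then show "\<forall>c<m. \<forall>g. energy t h \<omega> (edges G) (\<lambda>v. p v $ c) g = 0"
      unfolding eq by (simp add: energy_by_vertices[OF G th])
  next
    assume *: "\<forall>c<m. \<forall>g. energy t h \<omega> (edges G) (\<lambda>v. p v $ c) g = 0"
    show "equilibrium_stress m G p \<omega>"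
      unfolding eq
    proof (intro ballI allI impI)
      fix i c assume i: "i \<in> verts G" and c: "c < m"
      have "(\<Sum>j\<in>verts G. (if j = i then 1 else 0) *
          (\<Sum>e\<in>?E j. \<omega> e * (p (other_end G e j) $ c - p j $ c))) = 0"
        using *[rule_format, OF c, of "\<lambda>j. if j = i then 1 else 0"]
        unfolding energy_by_vertices[OF G th] by simp
      then show "(\<Sum>e\<in>?E i. \<omega> e * (p (other_end G e i) $ c - p i $ c)) = 0"
        unfolding sum_indicator[OF multigraphD(1)[OF G] i] .
    qed
  qed
qed

lemma affine_spanD:
  assumes "x \<in> affine_span n P" "finite P" "P \<subseteq> carrier_vec n"
  shows "\<exists>c. (\<Sum>z\<in>P. c z) = 1 \<and> (\<forall>j<n. x $ j = (\<Sum>z\<in>P. c z * z $ j))"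
proof -
  obtain c where c: "x = finsum_vec TYPE(real) n (\<lambda>z. c z \<cdot>\<^sub>v z) P" "(\<Sum>z\<in>P. c z) = 1"
    using assms(1) by (auto simp: affine_span_def)
  have "x $ j = (\<Sum>z\<in>P. c z * z $ j)" if "j < n" for j
  proof -
    have "x $ j = (\<Sum>z\<in>P. (c z \<cdot>\<^sub>v z) $ j)"
      unfolding c(1) using assms(2,3) that by (intro index_finsum_vec) auto
    also have "\<dots> = (\<Sum>z\<in>P. c z * z $ j)" using assms(3) that by (intro sum.cong) auto
    finally show ?thesis .
  qed
  then show ?thesis using c(2) by (intro exI[of _ c]) simp
qed

lemma affine_span_closed: "finite P \<Longrightarrow> P \<subseteq> carrier_vec n \<Longrightarrow> affine_span n P \<subseteq> carrier_vec n"
  by (auto simp: affine_span_def intro!: finsum_vec_closed)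

lemma affine_spanI:
  assumes V: "finite V" "\<And>v. v \<in> V \<Longrightarrow> p v \<in> carrier_vec n" and x: "x \<in> carrier_vec n"
    and a: "(\<Sum>v\<in>V. a v) = (1 :: real)" "\<And>j. j < n \<Longrightarrow> x $ j = (\<Sum>v\<in>V. a v * p v $ j)"
  shows "x \<in> affine_span n (p ` V)"
proof -
  \<comment> \<open>Several vertices may share a point, so their coefficients are added up.\<close>
  define c where "c z = (\<Sum>v\<in>{v \<in> V. p v = z}. a v)" for z
  have "(\<Sum>z\<in>p ` V. c z) = 1"
    unfolding c_def using sum.group[OF V(1) finite_imageI[OF V(1)] order_refl, where g = p and h = a] a(1) by simp
  moreover have "x = finsum_vec TYPE(real) n (\<lambda>z. c z \<cdot>\<^sub>v z) (p ` V)"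
  proof (rule eq_vecI)
    have cl: "(\<lambda>z. c z \<cdot>\<^sub>v z) \<in> p ` V \<rightarrow> carrier_vec n" using V(2) by auto
    then have d: "finsum_vec TYPE(real) n (\<lambda>z. c z \<cdot>\<^sub>v z) (p ` V) \<in> carrier_vec n"
      by (rule finsum_vec_closed)
    then show "dim_vec x = dim_vec (finsum_vec TYPE(real) n (\<lambda>z. c z \<cdot>\<^sub>v z) (p ` V))" using x by simp
    fix j assume "j < dim_vec (finsum_vec TYPE(real) n (\<lambda>z. c z \<cdot>\<^sub>v z) (p ` V))"
    then have j: "j < n" using d by simp
    have "finsum_vec TYPE(real) n (\<lambda>z. c z \<cdot>\<^sub>v z) (p ` V) $ j = (\<Sum>z\<in>p ` V. (c z \<cdot>\<^sub>v z) $ j)"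
      using V j cl by (intro index_finsum_vec) auto
    also have "\<dots> = (\<Sum>z\<in>p ` V. \<Sum>v\<in>{v \<in> V. p v = z}. a v * p v $ j)"
      using carrier_vecD[OF V(2)] j by (intro sum.cong) (auto simp: c_def sum_distrib_right)
    also have "\<dots> = (\<Sum>v\<in>V. a v * p v $ j)"
      by (rule sum.group[OF V(1) finite_imageI[OF V(1)] order_refl])
    finally show "x $ j = finsum_vec TYPE(real) n (\<lambda>z. c z \<cdot>\<^sub>v z) (p ` V) $ j"
      using a(2)[OF j] by simp
  qed
  ultimately show ?thesis unfolding affine_span_def by blast
qed

text \<open>Connectedness, stated in terms of potentials instead of walks.\<close>

definition connected_graph :: "('v, 'e) mgraph \<Rightarrow> bool" where
  "connected_graph G \<longleftrightarrow> verts G \<noteq> {} \<and>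
     (\<forall>g :: 'v \<Rightarrow> real. (\<forall>e\<in>edges G. \<forall>i j. ends G e = {i, j} \<longrightarrow> g i = g j) \<longrightarrow>
        (\<forall>u\<in>verts G. \<forall>v\<in>verts G. g u = g v))"

lemma connected_graphD:
  assumes "connected_graph G" "orientation G t h" "\<And>e. e \<in> edges G \<Longrightarrow> g (t e) = (g (h e) :: real)"
    "u \<in> verts G" "v \<in> verts G"
  shows "g u = g v"
proof -
  have "g i = g j" if "e \<in> edges G" "ends G e = {i, j}" for e i j
  proof -
    have "{i, j} = {t e, h e}" using assms(2) that by (simp add: orientation_def)
    then show ?thesis using assms(3)[OF that(1)] by (auto simp: doubleton_eq_iff)
  qed
  then show ?thesis using assms(1,4,5) unfolding connected_graph_def by blast
qed

lemma labelling_exists: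
  assumes "multigraph G"
  obtains l where "bij_betw l (verts G) {..<card (verts G)}"
  using ex_bij_betw_finite_nat[OF multigraphD(1)[OF assms]] by (auto simp: atLeast0LessThan)

text \<open>With all weights 1 the kernel of the Laplacian of a connected graph consists of the
  constants. This makes the set under \<open>Max\<close> in \<open>max_super_stable_dim\<close>
  nonempty.\<close>

lemma super_stable_0:
  assumes G: "multigraph G" and C: "connected_graph G"
  shows "super_stable 0 G (\<lambda>_. 1) (\<lambda>_. 0\<^sub>v 0)"
proof -
  obtain l where l: "bij_betw l (verts G) {..<card (verts G)}" using labelling_exists[OF G] .
  obtain t h where th: "orientation G t h" using orientation_exists[OF G] .
  interpret labelled_graph G l "\<lambda>_. 1" t h by (rule labelled_graph.intro[OF G l th])
  obtain v0 where v0: "v0 \<in> verts G" using C by (auto simp: connected_graph_def)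
  have "kernel_dim L = 1"
  proof (rule kernel_dim_eqI[where u = "\<lambda>_ _. 1"])
    fix f assume "\<And>g. form f g = 0"
    then have "f (t e) = f (h e)" if "e \<in> edges G" for e
      using energy_eq_0D[of "edges G" "\<lambda>_. 1" t h f e] multigraphD(2)[OF G] that by simp
    then have "f v = f v0" if "v \<in> verts G" for v using connected_graphD[OF C th _ that v0] by blast
    then show "\<exists>c. \<forall>v\<in>verts G. f v = (\<Sum>i<(1 :: nat). c i * 1)"
      by (intro exI[of _ "\<lambda>_. f v0"]) simp
  qed (use v0 in \<open>auto simp: energy_def\<close>)
  moreover have "pos_semidef L"
    unfolding pos_semidef_iff by (intro allI energy_nonneg) simp
  moreover have "affine_span 0 ((\<lambda>_. 0\<^sub>v 0) ` verts G) = carrier_vec 0"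
  proof
    show "affine_span 0 ((\<lambda>_. 0\<^sub>v 0) ` verts G) \<subseteq> carrier_vec 0"
      using multigraphD(1)[OF G] by (intro affine_span_closed) auto
    have "x \<in> affine_span 0 ((\<lambda>_. 0\<^sub>v 0) ` verts G)" if "x \<in> carrier_vec 0" for x
      using multigraphD(1)[OF G] that v0
      by (intro affine_spanI[where a = "\<lambda>v. if v = v0 then 1 else 0"]) auto
    then show "carrier_vec 0 \<subseteq> affine_span 0 ((\<lambda>_. 0\<^sub>v 0) ` verts G)" by blast
  qed
  moreover have "equilibrium_stress 0 G (\<lambda>_. 0\<^sub>v 0) (\<lambda>_. 1)"
    by (subst equilibrium_stress_iff[OF G th]) auto
  moreover have "strictly_proper G (\<lambda>_. 1) (\<lambda>_. 1)" by (simp add: strictly_proper_def)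
  ultimately have "\<exists>l \<omega>. bij_betw l (verts G) {..<card (verts G)} \<and>
      equilibrium_stress 0 G (\<lambda>_. 0\<^sub>v 0) \<omega> \<and> strictly_proper G (\<lambda>_. 1) \<omega> \<and>
      pos_semidef (laplacian G l \<omega>) \<and> kernel_dim (laplacian G l \<omega>) = 0 + 1"
    using l by (intro exI[of _ l] exI[of _ "\<lambda>_. 1"]) simp
  moreover have "S = 0\<^sub>m 0 0" if "S \<in> carrier_mat 0 0" for S :: "real mat"
    using that by (intro eq_matI) auto
  moreover note \<open>affine_span 0 ((\<lambda>_. 0\<^sub>v 0) ` verts G) = carrier_vec 0\<close>
  ultimately show ?thesis
    unfolding super_stable_def by (auto simp: realization_def)
qed

section \<open>A super stable realization in the plane\<close>

lemma vec2_quadratic_form: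
  assumes "S \<in> carrier_mat 2 2" "x \<in> carrier_vec 2"
  shows "x \<bullet> (S *\<^sub>v x) = x $ 0 * x $ 0 * S $$ (0, 0) + x $ 0 * x $ 1 * S $$ (0, 1)
    + x $ 1 * x $ 0 * S $$ (1, 0) + (x $ 1 * x $ 1 * S $$ (1, 1) :: real)"
  using assms by (simp add: scalar_prod_def atLeast0_lessThan_Suc numeral_2_eq_2 algebra_simps)

text \<open>In matrix terms: a symmetric 3 by 3 matrix with positive off-diagonal entries agrees off
  the diagonal with a matrix of rank one.\<close>

lemma product_solution:
  assumes "(a :: real) > 0" "b > 0" "c > 0"
  obtains x y z where "x > 0" "y > 0" "z > 0" "x * y = a" "x * z = b" "y * z = c"
proof -
  define x where "x = sqrt (a * b / c)"
  have x: "x > 0" "x * x = a * b / c" using assms by (simp_all add: x_def)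
  have "(a / x) * (b / x) = a * b / (x * x)" by simp
  also have "\<dots> = c" using x(2) assms by simp
  finally show thesis using that[of x "a / x" "b / x"] x(1) assms by simp
qed

text \<open>If \<open>D\<close> consists of the edges \<open>d\<close> with resistance matrix \<open>R\<close>, then \<open>R\<close> plus the rank-one matrix
  \<open>u d * u d'\<close> is diagonal. With its inverse \<open>y\<close>, the conductances \<open>- y d\<close> on \<open>D\<close> make the Laplacian
  positive semidefinite of corank 3.\<close>

lemma super_stable_2_if_resistance_triple:
  assumes G: "multigraph G" and C: "connected_graph G" and th: "orientation G t h"
    and R: "resistance_triple t h w (edges G) D f"
  shows "\<exists>\<sigma> p. super_stable 2 G \<sigma> p"
proof -
  let ?E = "edges G - D"
  let ?B = "energy t h w ?E"
  define dif where "dif g e = g (t e) - g (h e)" for g :: "'a \<Rightarrow> real" and e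
  have finE: "finite (edges G)" and DE: "D \<subseteq> edges G" and D3: "card D = 3"
    and w: "\<And>e. e \<in> ?E \<Longrightarrow> w e > 0"
    and rep: "\<And>d g. d \<in> D \<Longrightarrow> ?B (f d) g = dif g d"
    and neg: "\<And>d d'. d \<in> D \<Longrightarrow> d' \<in> D \<Longrightarrow> d \<noteq> d' \<Longrightarrow> dif (f d) d' < 0"
    using R by (auto simp: resistance_triple_def dif_def)
  have finD: "finite D" using DE finE finite_subset by blast
  obtain d1 d2 d3 where D: "D = {d1, d2, d3}" "d1 \<noteq> d2" "d1 \<noteq> d3" "d2 \<noteq> d3"
    using D3 by (auto simp: card_3_iff)
  \<comment> \<open>Reciprocity of transfer resistances.\<close>
  have sym: "dif (f d) d' = dif (f d') d" if "d \<in> D" "d' \<in> D" for d d'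
    using rep[OF that(1), of "f d'"] rep[OF that(2), of "f d"] energy_commute[of t h w ?E] by metis
  obtain u1 u2 u3 where u123: "u1 > 0" "u2 > 0" "u3 > 0"
      "u1 * u2 = - dif (f d1) d2" "u1 * u3 = - dif (f d1) d3" "u2 * u3 = - dif (f d2) d3"
    using product_solution[of "- dif (f d1) d2" "- dif (f d1) d3" "- dif (f d2) d3"] neg D by auto
  define u where "u d = (if d = d1 then u1 else if d = d2 then u2 else u3)" for d
  have u: "u d1 = u1" "u d2 = u2" "u d3 = u3" using D by (auto simp: u_def)
  have R_off: "dif (f d) d' = - u d * u d'" if "d \<in> D" "d' \<in> D" "d \<noteq> d'" for d d'
    using that u123 u sym D by (auto simp: mult.commute)
  have R_diag: "dif (f d) d \<ge> 0" if "d \<in> D" for d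
    using rep[OF that, of "f d"] energy_nonneg[where E = ?E and w = w and t = t and h = h and f = "f d"] w by simp
  define y where "y d = 1 / (dif (f d) d + u d * u d)" for d
  have upos: "u d > 0" for d using u123 by (simp add: u_def)
  have y: "y d > 0" "dif (f d) d = 1 / y d - u d * u d" if "d \<in> D" for d
    using R_diag[OF that] upos[of d] by (auto simp: y_def add_nonneg_pos)
  \<comment> \<open>Currents \<open>c d\<close> produce the drops given by the resistance matrix,
    which is the diagonal matrix of the \<open>1 / y d\<close> minus the rank-one matrix
    \<open>u d * u d'\<close>.\<close>
  have comb: "dif (\<lambda>x. \<Sum>d'\<in>D. c d' * f d' x) d = c d / y d - u d * (\<Sum>d'\<in>D. u d' * c d')"
    if d: "d \<in> D" for c d
  proof -
    have "dif (\<lambda>x. \<Sum>d'\<in>D. c d' * f d' x) d = (\<Sum>d'\<in>D. c d' * dif (f d') d)"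
      by (simp add: dif_def right_diff_distrib sum_subtractf)
    also have "\<dots> = (\<Sum>d'\<in>D. (if d' = d then c d / y d else 0) - u d * (u d' * c d'))"
      by (intro sum.cong) (auto simp: R_off[OF _ d] y(2)[OF d] right_diff_distrib)
    also have "\<dots> = c d / y d - u d * (\<Sum>d'\<in>D. u d' * c d')"
      using d finD by (simp add: sum_subtractf sum_distrib_left)
    finally show ?thesis .
  qed
  have Bcomb: "?B (\<lambda>x. \<Sum>d\<in>D. c d * f d x) g = (\<Sum>d\<in>D. c d * dif g d)" for c g
  proof -
    have "?B (\<lambda>x. \<Sum>d\<in>D. c d * f d x) g
      = (\<Sum>e\<in>?E. \<Sum>d\<in>D. c d * (w e * (f d (t e) - f d (h e)) * (g (t e) - g (h e))))"
      by (simp add: energy_def sum_subtractf[symmetric] sum_distrib_left sum_distrib_right algebra_simps)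
    also have "\<dots> = (\<Sum>d\<in>D. c d * ?B (f d) g)"
      unfolding energy_def sum_distrib_left by (rule sum.swap)
    also have "\<dots> = (\<Sum>d\<in>D. c d * dif g d)" using rep by simp
    finally show ?thesis .
  qed
  define \<omega> where "\<omega> e = (if e \<in> D then - y e else w e)" for e
  define \<sigma> where "\<sigma> e = (if e \<in> D then - 1 else 1 :: real)" for e
  obtain l where l: "bij_betw l (verts G) {..<card (verts G)}" using labelling_exists[OF G] .
  interpret labelled_graph G l \<omega> t h by (rule labelled_graph.intro[OF G l th])
  have form: "form g k = ?B g k - (\<Sum>d\<in>D. y d * dif g d * dif k d)" for g k
  proof -
    have "form g k = (\<Sum>e\<in>?E. \<omega> e * dif g e * dif k e) + (\<Sum>e\<in>D. \<omega> e * dif g e * dif k e)"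
      unfolding energy_def dif_def using sum.subset_diff[OF DE finE] .
    also have "(\<Sum>e\<in>?E. \<omega> e * dif g e * dif k e) = ?B g k"
      unfolding energy_def dif_def by (intro sum.cong) (auto simp: \<omega>_def)
    also have "(\<Sum>e\<in>D. \<omega> e * dif g e * dif k e) = - (\<Sum>d\<in>D. y d * dif g d * dif k d)"
      by (simp add: \<omega>_def sum_negf)
    finally show ?thesis by simp
  qed
  \<comment> \<open>Chosen so that \<open>?B (r g) k = form g k\<close> for all \<open>k\<close>.
    This completes the square in \<open>form g g\<close>; the remaining part is the square of
    \<open>s g\<close>.\<close>
  define r where "r g x = g x + (- 1) * (\<Sum>d\<in>D. (y d * dif g d) * f d x)" for g x
  define s where "s g = (\<Sum>d\<in>D. u d * (y d * dif g d))" for g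
  have dif_diff: "dif (\<lambda>x. a x + c * b x) e = dif a e + c * dif b e" for a b c e
    by (simp add: dif_def algebra_simps)
  have difr: "dif (r g) d = u d * s g" if d: "d \<in> D" for g d
    using y(1)[OF d] unfolding r_def dif_diff comb[OF d] s_def by simp
  have square: "form g g = ?B (r g) (r g) + s g * s g" for g
  proof -
    have Br: "?B (r g) k = ?B g k - (\<Sum>d\<in>D. (y d * dif g d) * dif k d)" for k
      unfolding r_def energy_add_scaled Bcomb by simp
    have "?B (r g) (r g) = ?B g (r g) - (\<Sum>d\<in>D. (y d * dif g d) * (u d * s g))"
      unfolding Br using difr by simp
    also have "(\<Sum>d\<in>D. (y d * dif g d) * (u d * s g)) = s g * s g"
      unfolding s_def[of g] sum_distrib_right by (intro sum.cong) (simp_all add: mult_ac s_def)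
    also have "?B g (r g) = form g g"
      using Br[of g] energy_commute[of t h w ?E g "r g"] by (simp add: form)
    finally show ?thesis by simp
  qed
  have Bnn: "?B g g \<ge> 0" for g using w by (rule energy_nonneg)
  have psd: "pos_semidef L"
    unfolding pos_semidef_iff square using Bnn by (auto intro: add_nonneg_nonneg)
  obtain v0 where v0: "v0 \<in> verts G" using C by (auto simp: connected_graph_def)
  have kernelD: "s g = 0 \<and> (\<forall>v\<in>verts G. r g v = r g v0)" if g: "\<And>k. form g k = 0" for g
  proof -
    have "?B (r g) (r g) + s g * s g = 0" using square g by metis
    then have 0: "?B (r g) (r g) = 0" "s g = 0"
      using Bnn[of "r g"] zero_le_square[of "s g"] by (auto simp: add_nonneg_eq_0_iff)
    have "r g (t e) = r g (h e)" if "e \<in> edges G" for e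
    proof (cases "e \<in> D")
      case True
      then show ?thesis using difr[OF True, of g] 0(2) by (simp add: dif_def)
    next
      case False
      then show ?thesis
        using energy_eq_0D[where E = ?E and w = w and t = t and h = h and f = "r g" and e = e] finE w 0(1) that by simp
    qed
    then have "r g v = r g v0" if "v \<in> verts G" for v using connected_graphD[OF C th _ that v0] by blast
    then show ?thesis using 0(2) by blast
  qed
  \<comment> \<open>Currents orthogonal to \<open>u\<close> give kernel elements; this plane and the
    constants account for the corank 3.\<close>
  have kernelI: "form (\<lambda>x. \<Sum>d\<in>D. c d * f d x) k = 0" if "(\<Sum>d\<in>D. u d * c d) = 0" for c k
  proof -
    have "(\<Sum>d\<in>D. y d * dif (\<lambda>x. \<Sum>d\<in>D. c d * f d x) d * dif k d) = (\<Sum>d\<in>D. c d * dif k d)"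
    proof (rule sum.cong[OF refl])
      fix d assume d: "d \<in> D"
      show "y d * dif (\<lambda>x. \<Sum>d\<in>D. c d * f d x) d * dif k d = c d * dif k d"
        unfolding comb[OF d] that using y(1)[OF d] by simp
    qed
    then show ?thesis unfolding form Bcomb by simp
  qed
  have D_sum: "(\<Sum>d\<in>D. k d) = k d1 + k d2 + k d3" for k :: "'b \<Rightarrow> real"
    using D by (simp add: add.assoc)
  have inD: "d1 \<in> D" "d2 \<in> D" "d3 \<in> D" using D by auto
  \<comment> \<open>\<open>a\<close> and \<open>b\<close> span the plane orthogonal to
    \<open>u\<close>, normalized so that the edges \<open>d2\<close> and \<open>d3\<close> become
    the two unit vectors of the realization. The edge \<open>d1\<close> then has two nonzero
    coordinates.\<close>
  define a where "a d = (if d = d1 then - y d2 * u2 / u1 else if d = d2 then y d2 else 0)" for d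
  define b where "b d = (if d = d1 then - y d3 * u3 / u1 else if d = d2 then 0 else y d3)" for d
  have ab: "a d1 = - y d2 * u2 / u1" "a d2 = y d2" "a d3 = 0"
      "b d1 = - y d3 * u3 / u1" "b d2 = 0" "b d3 = y d3"
    using D by (auto simp: a_def b_def)
  have a0: "(\<Sum>d\<in>D. u d * a d) = 0" and b0: "(\<Sum>d\<in>D. u d * b d) = 0"
    using u123 by (simp_all add: D_sum u ab)
  define X where "X x = (\<Sum>d\<in>D. a d * f d x)" for x
  define Y where "Y x = (\<Sum>d\<in>D. b d * f d x)" for x
  have difX: "dif X d = a d / y d" and difY: "dif Y d = b d / y d" if "d \<in> D" for d
    unfolding X_def Y_def comb[OF that] a0 b0 by simp_all
  have X: "dif X d1 \<noteq> 0" "dif X d2 = 1" "dif X d3 = 0" and Y: "dif Y d1 \<noteq> 0" "dif Y d2 = 0" "dif Y d3 = 1"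
    using y(1) inD u123 by (simp_all add: difX difY ab less_imp_neq[symmetric])
  define p where "p v = vec 2 (\<lambda>c. if c = 0 then X v else Y v)" for v
  have p: "p v \<in> carrier_vec 2" "p v $ 0 = X v" "p v $ 1 = Y v" for v by (simp_all add: p_def)
  have VD: "t d \<in> verts G" "h d \<in> verts G" if "d \<in> D" for d
    using that DE th multigraphD(3)[OF G] by (auto simp: orientation_def)
  have kerX: "form X g = 0" and kerY: "form Y g = 0" for g
    unfolding X_def Y_def by (intro kernelI a0 b0)+
  have dim: "kernel_dim L = 3"
  proof (rule kernel_dim_eqI[where u = "\<lambda>i x. if i = 0 then 1 else if i = 1 then X x else Y x"])
    fix i :: nat and g
    consider "i = 0" | "i = 1" | "i \<noteq> 0" "i \<noteq> 1" by blast
    then show "form (\<lambda>x. if i = 0 then 1 else if i = 1 then X x else Y x) g = 0"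
      by cases (use kerX kerY in \<open>simp_all add: energy_def\<close>)
  next
    fix c :: "nat \<Rightarrow> real"
    assume "\<And>v. v \<in> verts G \<Longrightarrow> (\<Sum>i<3. c i * (if i = 0 then 1 else if i = 1 then X v else Y v)) = 0"
    then have c: "c 0 + c 1 * X v + c 2 * Y v = 0" if "v \<in> verts G" for v
      using that by (simp add: eval_nat_numeral lessThan_Suc add_ac)
    have "c 1 * dif X d + c 2 * dif Y d = 0" if "d \<in> D" for d
      using c[OF VD(1)[OF that]] c[OF VD(2)[OF that]] by (simp add: dif_def algebra_simps)
    from this[OF inD(2)] this[OF inD(3)] have "c 1 = 0" "c 2 = 0" using X Y by simp_all
    moreover from this have "c 0 = 0" using c[OF v0] by simp
    ultimately show "\<forall>i<3. c i = 0" by (auto simp: eval_nat_numeral less_Suc_eq)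
  next
    fix g assume g: "\<And>k. form g k = 0"
    from kernelD[OF g] have s: "s g = 0" and const: "\<And>v. v \<in> verts G \<Longrightarrow> r g v = r g v0" by auto
    \<comment> \<open>As \<open>s g = 0\<close>, the currents \<open>y d * dif g d\<close> are
      orthogonal to \<open>u\<close>, hence a combination of \<open>a\<close> and \<open>b\<close>;
      the coefficients are read off at \<open>d2\<close> and \<open>d3\<close>.\<close>
    have "g v = r g v0 + dif g d2 * X v + dif g d3 * Y v" if v: "v \<in> verts G" for v
    proof -
      have "u1 * (y d1 * dif g d1) = - (u2 * (y d2 * dif g d2) + u3 * (y d3 * dif g d3))"
        using s by (simp add: s_def D_sum u)
      then have e1: "y d1 * dif g d1 = dif g d2 * a d1 + dif g d3 * b d1"
        using u123 by (simp add: ab field_simps)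
      have "(\<Sum>d\<in>D. (y d * dif g d) * f d v) = dif g d2 * X v + dif g d3 * Y v"
        unfolding X_def Y_def D_sum e1 by (simp add: ab(2,3,5,6) algebra_simps)
      then show ?thesis using const[OF v] by (simp add: r_def)
    qed
    then show "\<exists>c. \<forall>v\<in>verts G. g v = (\<Sum>i<(3 :: nat). c i * (if i = 0 then 1 else if i = 1 then X v else Y v))"
      by (intro exI[of _ "\<lambda>i. if i = 0 then r g v0 else if i = 1 then dif g d2 else dif g d3"])
        (simp add: eval_nat_numeral lessThan_Suc add_ac)
  qed
  have eq: "equilibrium_stress 2 G p \<omega>"
    unfolding equilibrium_stress_iff[OF G th p(1)]
  proof (intro allI impI)
    fix c :: nat and g assume "c < 2"
    then consider "c = 0" | "c = 1" by linarith
    then show "form (\<lambda>v. p v $ c) g = 0" by cases (simp_all only: p kerX kerY)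
  qed
  have proper: "strictly_proper G \<sigma> \<omega>"
    using y(1) w by (auto simp: strictly_proper_def \<sigma>_def \<omega>_def)
  have span: "affine_span 2 (p ` verts G) = carrier_vec 2"
  proof
    show "affine_span 2 (p ` verts G) \<subseteq> carrier_vec 2"
      using multigraphD(1)[OF G] p(1) by (intro affine_span_closed) auto
    show "carrier_vec 2 \<subseteq> affine_span 2 (p ` verts G)"
    proof
      fix x :: "real vec" assume x: "x \<in> carrier_vec 2"
      \<comment> \<open>The edge vectors of \<open>d2\<close> and \<open>d3\<close> are the unit
        vectors, so these are the coordinates of \<open>x\<close> relative to
        \<open>p v0\<close>.\<close>
      define \<alpha> where "\<alpha> = x $ 0 - X v0"
      define \<beta> where "\<beta> = x $ 1 - Y v0"
      let ?\<delta> = "\<lambda>z v. if v = z then 1 else 0 :: real"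
      define c where "c v = ?\<delta> v0 v + \<alpha> * (?\<delta> (t d2) v - ?\<delta> (h d2) v) + \<beta> * (?\<delta> (t d3) v - ?\<delta> (h d3) v)" for v
      have \<delta>: "(\<Sum>v\<in>verts G. ?\<delta> z v * g v) = g z" if "z \<in> verts G" for z and g :: "'a \<Rightarrow> real"
        by (rule sum_indicator[OF multigraphD(1)[OF G] that])
      have c: "(\<Sum>v\<in>verts G. c v * g v) = g v0 + \<alpha> * dif g d2 + \<beta> * dif g d3" for g
      proof -
        have "(\<Sum>v\<in>verts G. c v * g v) = (\<Sum>v\<in>verts G. ?\<delta> v0 v * g v)
          + \<alpha> * ((\<Sum>v\<in>verts G. ?\<delta> (t d2) v * g v) - (\<Sum>v\<in>verts G. ?\<delta> (h d2) v * g v))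
          + \<beta> * ((\<Sum>v\<in>verts G. ?\<delta> (t d3) v * g v) - (\<Sum>v\<in>verts G. ?\<delta> (h d3) v * g v))"
          unfolding sum_distrib_left sum.distrib[symmetric] sum_subtractf[symmetric] c_def
          by (intro sum.cong refl) (simp add: algebra_simps)
        then show ?thesis using v0 VD inD by (simp add: \<delta> dif_def)
      qed
      show "x \<in> affine_span 2 (p ` verts G)"
      proof (rule affine_spanI[where a = c])
        show "(\<Sum>v\<in>verts G. c v) = 1" using c[of "\<lambda>_. 1"] by (simp add: dif_def)
        fix j :: nat assume "j < 2"
        then consider "j = 0" | "j = 1" by linarith
        then show "x $ j = (\<Sum>v\<in>verts G. c v * p v $ j)"
          by cases (simp_all only: p c X Y, simp_all add: \<alpha>_def \<beta>_def)
      qed (use multigraphD(1)[OF G] p x in auto)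
    qed
  qed
  have rigid: "S = 0\<^sub>m 2 2" if S: "S \<in> carrier_mat 2 2" "S\<^sup>T = S"
    "\<And>e i j. e \<in> edges G \<Longrightarrow> ends G e = {i, j} \<Longrightarrow> (p j - p i) \<bullet> (S *\<^sub>v (p j - p i)) = 0" for S
  proof -
    have sym: "S $$ (1, 0) = S $$ (0, 1)"
      using arg_cong[OF S(2), of "\<lambda>A. A $$ (0, 1)"] S(1) by simp
    have q: "dif X d * dif X d * S $$ (0, 0) + 2 * (dif X d * dif Y d * S $$ (0, 1)) + dif Y d * dif Y d * S $$ (1, 1) = 0"
      if d: "d \<in> D" for d
    proof -
      have "ends G d = {h d, t d}" using d DE th by (auto simp: orientation_def)
      then have "(p (t d) - p (h d)) \<bullet> (S *\<^sub>v (p (t d) - p (h d))) = 0" using S(3)[of d] d DE by blast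
      moreover have "p (t d) - p (h d) \<in> carrier_vec 2" using p(1) by simp
      moreover have "(p (t d) - p (h d)) $ 0 = dif X d" "(p (t d) - p (h d)) $ 1 = dif Y d"
        by (simp_all add: p_def dif_def)
      ultimately show ?thesis using vec2_quadratic_form[OF S(1)] sym by (simp add: mult_ac)
    qed
    \<comment> \<open>The unit vectors \<open>d2\<close> and \<open>d3\<close> remove the diagonal
      of \<open>S\<close>; \<open>d1\<close>, having two nonzero coordinates, removes the mixed
      entry.\<close>
    have "S $$ (0, 0) = 0" using q[OF inD(2)] X Y by simp
    moreover have "S $$ (1, 1) = 0" using q[OF inD(3)] X Y by simp
    moreover from calculation have "S $$ (0, 1) = 0" using q[OF inD(1)] X Y by simp
    ultimately show ?thesis
      using S(1) sym by (intro eq_matI) (auto simp: less_2_cases_iff)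
  qed
  have "realization 2 G \<sigma> p" using p by (auto simp: realization_def \<sigma>_def)
  moreover have "\<exists>l \<omega>. bij_betw l (verts G) {..<card (verts G)} \<and> equilibrium_stress 2 G p \<omega> \<and>
      strictly_proper G \<sigma> \<omega> \<and> pos_semidef (laplacian G l \<omega>) \<and> kernel_dim (laplacian G l \<omega>) = 2 + 1"
    using l eq proper psd dim by (intro exI[of _ l] exI[of _ \<omega>]) simp
  ultimately have "super_stable 2 G \<sigma> p"
    unfolding super_stable_def using span rigid by blast
  then show ?thesis by blast
qed

section \<open>Realizations of dimension one\<close>

definition reachable :: "('v, 'e) mgraph \<Rightarrow> 'v \<Rightarrow> 'v set" where
  "reachable G v = {u. (adjacent G)\<^sup>*\<^sup>* v u}"

lemma components_eq: "components G = (\<lambda>v. induced G (reachable G v)) ` verts G"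
  by (simp add: components_def reachable_def)

lemma reachable_subset:
  assumes G: "multigraph G" and v: "v \<in> verts G"
  shows "reachable G v \<subseteq> verts G"
proof
  fix u assume "u \<in> reachable G v"
  then have "(adjacent G)\<^sup>*\<^sup>* v u" by (simp add: reachable_def)
  then show "u \<in> verts G" by induction (use v adjacentD(3)[OF G] in auto)
qed

lemma reachable_closed:
  assumes "e \<in> edges G" "ends G e = {a, b}" "a \<in> reachable G v"
  shows "b \<in> reachable G v"
proof -
  have "adjacent G a b" using assms by (auto simp: adjacent_def)
  then show ?thesis using assms(3) unfolding reachable_def by (simp add: rtranclp.rtrancl_into_rtrancl)
qed

lemma multigraph_induced: "multigraph G \<Longrightarrow> W \<subseteq> verts G \<Longrightarrow> multigraph (induced G W)"
  using induced_minor multigraph_minor by blast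

lemma orientation_induced: "orientation G t h \<Longrightarrow> orientation (induced G W) t h"
  by (simp add: orientation_def)

lemma connected_graph_component:
  assumes "v \<in> verts G"
  shows "connected_graph (induced G (reachable G v))"
  unfolding connected_graph_def
proof (intro conjI allI impI)
  have v: "v \<in> reachable G v" by (simp add: reachable_def)
  then show "verts (induced G (reachable G v)) \<noteq> {}" by auto
  fix g :: "_ \<Rightarrow> real"
  assume g: "\<forall>e\<in>edges (induced G (reachable G v)). \<forall>i j.
      ends (induced G (reachable G v)) e = {i, j} \<longrightarrow> g i = g j"
  have "g u = g v" if "u \<in> reachable G v" for u
  proof -
    have "(adjacent G)\<^sup>*\<^sup>* v u" using that by (simp add: reachable_def)
    then show ?thesis
    proof induction
      case (step y z)
      then obtain e where e: "e \<in> edges G" "ends G e = {y, z}" by (auto simp: adjacent_def)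
      moreover have "y \<in> reachable G v" "z \<in> reachable G v"
        using step by (auto simp: reachable_def)
      ultimately have "e \<in> edges (induced G (reachable G v))" "ends (induced G (reachable G v)) e = {y, z}"
        by simp_all
      then have "g y = g z" using g by blast
      then show ?case using step.IH by simp
    qed simp
  qed
  then show "\<forall>u\<in>verts (induced G (reachable G v)). \<forall>w\<in>verts (induced G (reachable G v)). g u = g w"
    by simp
qed

text \<open>Between edges in different components the transfer resistance would be 0 and not
  negative, so the whole triple lies in one component.\<close>

lemma resistance_triple_component:
  assumes th: "orientation G t h" and R: "resistance_triple t h w (edges G) D f" and d1: "d1 \<in> D"
  shows "resistance_triple t h w (edges (induced G (reachable G (t d1)))) D f"
proof -
  let ?X = "reachable G (t d1)" and ?E = "edges G - D"
  let ?C = "edges (induced G ?X)"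
  have fin: "finite (edges G)" and D: "D \<subseteq> edges G" "card D = 3"
    and w: "\<And>e. e \<in> ?E \<Longrightarrow> w e > 0"
    and rep: "\<And>d g. d \<in> D \<Longrightarrow> energy t h w ?E (f d) g = g (t d) - g (h d)"
    and neg: "\<And>d d'. d \<in> D \<Longrightarrow> d' \<in> D \<Longrightarrow> d \<noteq> d' \<Longrightarrow> f d (t d') - f d (h d') < 0"
    using R by (auto simp: resistance_triple_def)
  have ends: "ends G e = {t e, h e}" "ends G e = {h e, t e}" if "e \<in> edges G" for e
    using th that by (auto simp: orientation_def)
  have both: "t e \<in> ?X \<longleftrightarrow> h e \<in> ?X" if "e \<in> edges G" for e
    using reachable_closed[OF that ends(1)[OF that]] reachable_closed[OF that ends(2)[OF that]] by blast
  have C: "e \<in> ?C \<longleftrightarrow> e \<in> edges G \<and> t e \<in> ?X" for e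
    using both[of e] ends(1)[of e] by auto
  \<comment> \<open>No edge leaves \<open>?X\<close>, so cutting off a function outside
    \<open>?X\<close> can be moved from one argument of the form to the other.\<close>
  define cut where "cut g v = (if v \<in> ?X then g v else 0 :: real)" for g v
  have cut: "energy t h w ?E (cut f') g = energy t h w ?E f' (cut g)" for f' g
    unfolding energy_def by (rule sum.cong) (use both in \<open>auto simp: cut_def\<close>)
  have cut': "energy t h w ?E f' (cut g) = energy t h w (?C - D) f' g" for f' g
  proof -
    have "energy t h w (?C - D) f' g = energy t h w (?C - D) f' (cut g)"
      unfolding energy_def by (rule sum.cong) (use both C in \<open>auto simp: cut_def\<close>)
    also have "\<dots> = energy t h w ?E f' (cut g)"
      unfolding energy_def by (rule sum.mono_neutral_left) (use fin both C in \<open>auto simp: cut_def\<close>)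
    finally show ?thesis by simp
  qed
  have t1: "t d1 \<in> ?X" by (simp add: reachable_def)
  have DX: "t d \<in> ?X" if d: "d \<in> D" for d
  proof (rule ccontr)
    assume no: "t d \<notin> ?X"
    then have no': "h d \<notin> ?X" using both d D by blast
    have ne: "d1 \<noteq> d" using no t1 by blast
    have "f d (t d1) - f d (h d1) = cut (f d) (t d1) - cut (f d) (h d1)"
      using t1 both[of d1] d1 D by (auto simp: cut_def)
    also have "\<dots> = energy t h w ?E (f d1) (cut (f d))" using rep[OF d1] by simp
    also have "\<dots> = energy t h w ?E (f d) (cut (f d1))" using cut energy_commute by metis
    also have "\<dots> = 0" using rep[OF d] no no' by (simp add: cut_def)
    finally show False using neg[OF d d1] ne by simp
  qed
  show ?thesis
    unfolding resistance_triple_def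
  proof (intro conjI ballI allI impI)
    show "finite ?C" using fin by simp
    show "D \<subseteq> ?C" using D DX C by auto
    fix d g assume d: "d \<in> D"
    have "energy t h w (?C - D) (f d) g = cut g (t d) - cut g (h d)"
      unfolding cut'[symmetric] using rep[OF d] by simp
    then show "energy t h w (?C - D) (f d) g = g (t d) - g (h d)"
      using DX[OF d] both[of d] d D by (auto simp: cut_def)
  qed (use D w neg in auto)
qed

lemma super_stable_2_component:
  assumes G: "multigraph G" and T: "has_resistance_triple G"
  shows "\<exists>C\<in>components G. \<exists>\<sigma> p. super_stable 2 C \<sigma> p"
proof -
  obtain t h w D f where th: "orientation G t h" and R: "resistance_triple t h w (edges G) D f"
    using T unfolding has_resistance_triple_def by blast
  then have "D \<noteq> {}" "D \<subseteq> edges G" by (auto simp: resistance_triple_def)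
  then obtain d1 where d1: "d1 \<in> D" "d1 \<in> edges G" by blast
  have v: "t d1 \<in> verts G" using multigraphD(3)[OF G d1(2)] th d1 by (auto simp: orientation_def)
  let ?C = "induced G (reachable G (t d1))"
  have "\<exists>\<sigma> p. super_stable 2 ?C \<sigma> p"
    using super_stable_2_if_resistance_triple[OF multigraph_induced[OF G reachable_subset[OF G v]]
      connected_graph_component[OF v] orientation_induced[OF th] resistance_triple_component[OF th R d1(1)]] .
  then show ?thesis using v by (auto simp: components_eq)
qed

section \<open>Affine dimension\<close>

lemma submodule_span:
  assumes "W \<subseteq> carrier_vec n"
  shows "submodule class_ring (LinearCombinations.module.span class_ring (real_space n) W) (real_space n)"
    and "W \<subseteq> LinearCombinations.module.span class_ring (real_space n) W"
proof -
  interpret vec_space "TYPE(real)" n .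
  show "submodule class_ring (span W) V" using assms by (intro span_is_submodule)
  show "W \<subseteq> span W" using assms by (rule in_own_span)
qed

lemma subspace_dim_mono:
  assumes W1: "submodule class_ring W1 (real_space n)" and W2: "submodule class_ring W2 (real_space n)"
    and sub: "W1 \<subseteq> W2"
  shows "subspace_dim n W1 \<le> subspace_dim n W2"
proof -
  interpret vec_space "TYPE(real)" n .
  interpret A: vectorspace class_ring "V\<lparr>carrier := W1\<rparr>" by (rule subspace_fin_dim(1)[OF W1])
  interpret B: vectorspace class_ring "V\<lparr>carrier := W2\<rparr>" by (rule subspace_fin_dim(1)[OF W2])
  obtain S where S: "finite S" "A.basis S"
    using subspace_fin_dim(2)[OF W1] A.finite_basis_exists by blast
  then have S': "S \<subseteq> W1" "A.lin_indpt S" by (auto simp: A.basis_def)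
  then have "B.lin_indpt S"
    using span_li_not_depend(2)[OF _ W1, of S] span_li_not_depend(2)[OF _ W2, of S] sub by auto
  then have "card S \<le> B.dim" using B.li_le_dim(2)[OF subspace_fin_dim(2)[OF W2], of S] S' sub by auto
  then show ?thesis using A.dim_basis[OF S] by (simp add: subspace_dim_def)
qed

lemma combinations_submodule:
  fixes b :: "nat \<Rightarrow> real vec"
  shows "submodule class_ring {x \<in> carrier_vec n. \<exists>c. \<forall>a<n. x $ a = (\<Sum>i<k. c i * b i $ a)} (real_space n)"
    (is "submodule _ ?U _")
proof -
  interpret vec_space "TYPE(real)" n .
  have UI: "x \<in> ?U" if "x \<in> carrier_vec n" "\<forall>a<n. x $ a = (\<Sum>i<k. c i * b i $ a)" for x c
    by (intro CollectI conjI exI[of _ c] that)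
  have "x + y \<in> ?U" if xy: "x \<in> ?U" "y \<in> ?U" for x y
  proof -
    have car: "x \<in> carrier_vec n" "y \<in> carrier_vec n" using xy by auto
    obtain c c' where "\<And>a. a < n \<Longrightarrow> x $ a = (\<Sum>i<k. c i * b i $ a)"
        "\<And>a. a < n \<Longrightarrow> y $ a = (\<Sum>i<k. c' i * b i $ a)"
      using xy by blast
    then have "\<forall>a<n. (x + y) $ a = (\<Sum>i<k. (c i + c' i) * b i $ a)"
      using car by (simp add: distrib_right sum.distrib)
    then show ?thesis using car by (intro UI[of _ "\<lambda>i. c i + c' i"]) simp_all
  qed
  moreover have "r \<cdot>\<^sub>v x \<in> ?U" if xy: "x \<in> ?U" for r x
  proof -
    have car: "x \<in> carrier_vec n" using xy by auto
    obtain c where "\<And>a. a < n \<Longrightarrow> x $ a = (\<Sum>i<k. c i * b i $ a)" using xy by blast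
    then have "\<forall>a<n. (r \<cdot>\<^sub>v x) $ a = (\<Sum>i<k. (r * c i) * b i $ a)"
      using car by (simp add: sum_distrib_left mult.assoc)
    then show ?thesis using car by (intro UI[of _ "\<lambda>i. r * c i"]) simp_all
  qed
  moreover have "0\<^sub>v n \<in> ?U" by (rule UI[of _ "\<lambda>_. 0"]) simp_all
  ultimately show ?thesis
    unfolding submodule_def using module_axioms by (auto simp: module_vec_simps class_ring_simps)
qed

lemma affine_dim_eq:
  "affine_dim n A = subspace_dim n (LinearCombinations.module.span class_ring (real_space n) {x - y | x y. x \<in> A \<and> y \<in> A})"
  by (simp add: affine_dim_def subspace_dim_def)

text \<open>The points lie in the linear span of the \<open>b i\<close>, hence so do all differences
  of points of their affine span.\<close>

lemma affine_dim_le: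
  assumes P: "finite P" "P \<subseteq> carrier_vec n" and b: "\<And>i. i < k \<Longrightarrow> b i \<in> carrier_vec n"
    and gen: "\<And>x. x \<in> P \<Longrightarrow> \<exists>c. \<forall>a<n. x $ a = (\<Sum>i<k. c i * b i $ a)"
  shows "affine_dim n (affine_span n P) \<le> k"
proof -
  interpret vec_space "TYPE(real)" n .
  let ?U = "{x \<in> carrier_vec n. \<exists>c. \<forall>a<n. x $ a = (\<Sum>i<k. c i * b i $ a)}"
  let ?A = "affine_span n P"
  let ?W = "{x - y | x y. x \<in> ?A \<and> y \<in> ?A}"
  note U = combinations_submodule[where n = n and k = k and b = b]
  have A: "?A \<subseteq> carrier_vec n" using affine_span_closed[OF P] .
  then have W: "?W \<subseteq> carrier_vec n" by (blast intro: minus_carrier_vec)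
  have AU: "x \<in> ?U" if x: "x \<in> ?A" for x
  proof -
    obtain c where c: "\<And>j. j < n \<Longrightarrow> x $ j = (\<Sum>z\<in>P. c z * z $ j)"
      using affine_spanD[OF x P] by blast
    obtain g where g: "\<And>z a. z \<in> P \<Longrightarrow> a < n \<Longrightarrow> z $ a = (\<Sum>i<k. g z i * b i $ a)"
      using gen by metis
    have "x $ a = (\<Sum>i<k. (\<Sum>z\<in>P. c z * g z i) * b i $ a)" if a: "a < n" for a
    proof -
      have "x $ a = (\<Sum>z\<in>P. \<Sum>i<k. c z * (g z i * b i $ a))"
        unfolding c[OF a] using g[OF _ a] by (simp add: sum_distrib_left)
      also have "\<dots> = (\<Sum>i<k. \<Sum>z\<in>P. c z * (g z i * b i $ a))" by (rule sum.swap)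
      also have "\<dots> = (\<Sum>i<k. (\<Sum>z\<in>P. c z * g z i) * b i $ a)"
        by (simp add: sum_distrib_right mult.assoc)
      finally show ?thesis .
    qed
    then show ?thesis using x A
      by (intro CollectI conjI exI[of _ "\<lambda>i. \<Sum>z\<in>P. c z * g z i"] allI impI) auto
  qed
  have "?W \<subseteq> ?U"
  proof
    fix z assume "z \<in> ?W"
    then obtain x y where xy: "z = x - y" "x \<in> ?A" "y \<in> ?A" by blast
    then have "(-1) \<cdot>\<^sub>v y \<in> ?U"
      using submodule.smult_closed[OF U, of "-1" y] AU by (simp add: module_vec_simps)
    then have "x + (-1) \<cdot>\<^sub>v y \<in> ?U"
      using submodule.m_closed[OF U, of x "(-1) \<cdot>\<^sub>v y"] AU[OF xy(2)] by (simp add: module_vec_simps)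
    moreover have "z = x + (-1) \<cdot>\<^sub>v y" using xy A by (intro eq_vecI) auto
    ultimately show "z \<in> ?U" by simp
  qed
  then have "span ?W \<subseteq> ?U" using span_is_subset[OF _ U] by simp
  then have "affine_dim n ?A \<le> subspace_dim n ?U"
    unfolding affine_dim_eq using submodule_span(1)[OF W] U by (intro subspace_dim_mono) simp_all
  also have "\<dots> \<le> k"
  proof (rule generating_family_ge_dim[OF U, of k b])
    fix i assume i: "i < k"
    have "b i $ a = (\<Sum>j<k. (if j = i then 1 else 0) * b j $ a)" for a
      using i by (simp only: sum_indicator[OF finite_lessThan] lessThan_iff)
    then show "b i \<in> ?U" using b[OF i]
      by (intro CollectI conjI exI[of _ "\<lambda>j. if j = i then 1 else 0"] allI impI)
  qed simp
  finally show ?thesis .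
qed

text \<open>A point off the line through \<open>x0\<close> and another point \<open>x1\<close> would
  supply a second independent direction.\<close>

lemma collinear_if_affine_dim_le_1:
  assumes P: "finite P" "P \<subseteq> carrier_vec n" and dim: "affine_dim n (affine_span n P) \<le> 1"
    and x0: "x0 \<in> P"
  shows "\<exists>z. \<forall>x\<in>P. \<exists>c. \<forall>j<n. x $ j = x0 $ j + c * z $ j"
proof (cases "\<exists>x1\<in>P. x1 \<noteq> x0")
  case True
  then obtain x1 where x1: "x1 \<in> P" "x1 \<noteq> x0" by blast
  let ?A = "affine_span n P"
  let ?W = "{x - y | x y. x \<in> ?A \<and> y \<in> ?A}"
  have A: "?A \<subseteq> carrier_vec n" using affine_span_closed[OF P] .
  then have W: "?W \<subseteq> carrier_vec n" by (blast intro: minus_carrier_vec)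
  have PA: "x \<in> ?A" if "x \<in> P" for x
  proof -
    have s: "(\<Sum>z\<in>P. (if z = x then 1 else 0) * g z) = g x" for g :: "real vec \<Rightarrow> real"
      by (rule sum_indicator[OF P(1) that])
    have "x \<in> affine_span n ((\<lambda>z. z) ` P)"
      using P that s[of "\<lambda>_. 1"] s by (intro affine_spanI[where a = "\<lambda>z. if z = x then 1 else 0"]) auto
    then show ?thesis by simp
  qed
  define z where "z = x1 - x0"
  have car: "x0 \<in> carrier_vec n" "x1 \<in> carrier_vec n" using P x0 x1 by auto
  obtain j0 where j0: "j0 < n" "z $ j0 \<noteq> 0"
  proof -
    have "\<exists>j<n. x1 $ j \<noteq> x0 $ j" using x1(2) car by (metis carrier_vecD eq_vecI)
    then show thesis using that car by (auto simp: z_def)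
  qed
  have "\<exists>c. \<forall>j<n. x $ j = x0 $ j + c * z $ j" if x: "x \<in> P" for x
  proof (rule ccontr)
    assume no: "\<not> ?thesis"
    have xc: "x \<in> carrier_vec n" using x P by auto
    let ?b = "\<lambda>i :: nat. if i = 0 then z else x - x0"
    have "independent_family n 2 ?b"
      unfolding independent_family_def
    proof (intro allI impI)
      fix c :: "nat \<Rightarrow> real" and i :: nat
      assume c: "\<forall>a<n. (\<Sum>i<2. c i * ?b i $ a) = 0" and i: "i < 2"
      have c: "c 0 * z $ a + c 1 * (x $ a - x0 $ a) = 0" if "a < n" for a
        using c[rule_format, OF that] that xc car by (simp add: eval_nat_numeral lessThan_Suc)
      have "c 1 = 0"
      proof (rule ccontr)
        assume c1: "c 1 \<noteq> 0"
        have "x $ j = x0 $ j + (- c 0 / c 1) * z $ j" if "j < n" for j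
          using c[OF that] c1 by (simp add: field_simps)
        then have "\<exists>c. \<forall>j<n. x $ j = x0 $ j + c * z $ j" by (intro exI[of _ "- c 0 / c 1"]) blast
        then show False using no by blast
      qed
      moreover have "c 0 = 0" using c[OF j0(1)] j0(2) calculation by simp
      ultimately show "c i = 0" using i by (auto simp: less_2_cases_iff)
    qed
    moreover have "?b i \<in> LinearCombinations.module.span class_ring (real_space n) ?W" for i
      using submodule_span(2)[OF W] PA x x0 x1 by (auto simp: z_def)
    ultimately have "2 \<le> affine_dim n ?A"
      unfolding affine_dim_eq by (intro independent_family_le_dim[OF submodule_span(1)[OF W]])
    then show False using dim by simp
  qed
  then show ?thesis by blast
next
  case False
  then show ?thesis by (intro exI[of _ "0\<^sub>v n"]) (auto intro!: exI[of _ 0])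
qed

section \<open>Euclidean distances and realizability\<close>

lemma vec_dist_sum:
  assumes "x \<in> carrier_vec n" "y \<in> carrier_vec n"
  shows "vec_dist x y = L2_set (\<lambda>j. x $ j - y $ j) {..<n}"
  using assms by (simp add: vec_dist_def L2_set_def scalar_prod_def atLeast0LessThan power2_eq_square)

lemma vec_dist_square:
  assumes "x \<in> carrier_vec n" "y \<in> carrier_vec n"
  shows "(vec_dist x y)\<^sup>2 = (\<Sum>j<n. (x $ j - y $ j)\<^sup>2)"
  unfolding vec_dist_sum[OF assms] L2_set_def by (simp add: sum_nonneg)

lemma vec_dist_nonneg: "x \<in> carrier_vec n \<Longrightarrow> y \<in> carrier_vec n \<Longrightarrow> vec_dist x y \<ge> 0"
  by (simp add: vec_dist_sum L2_set_nonneg)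

lemma pseudometric_vec_dist:
  assumes "\<And>v. p v \<in> carrier_vec n"
  shows "pseudometric (\<lambda>i j. vec_dist (p i) (p j))"
  unfolding pseudometric_def
proof (intro conjI allI)
  fix i j k
  show "vec_dist (p i) (p i) = 0" using assms by (simp add: vec_dist_sum[of _ n] L2_set_def)
  show "vec_dist (p i) (p j) = vec_dist (p j) (p i)"
    using assms by (simp add: vec_dist_sum[of _ n] L2_set_def power2_commute)
  have "vec_dist (p i) (p k) = L2_set (\<lambda>a. (p i $ a - p j $ a) + (p j $ a - p k $ a)) {..<n}"
    using assms by (simp add: vec_dist_sum[of _ n])
  also have "\<dots> \<le> vec_dist (p i) (p j) + vec_dist (p j) (p k)"
    unfolding vec_dist_sum[OF assms assms] by (rule L2_set_triangle_ineq)
  finally show "vec_dist (p i) (p k) \<le> vec_dist (p i) (p j) + vec_dist (p j) (p k)" .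
qed

lemma realizable_1_if_line_realizable:
  assumes G: "multigraph G" and L: "line_realizable G"
  shows "realizable 1 G"
  unfolding realizable_def
proof (intro allI impI)
  fix m \<sigma> p assume R: "realization m G \<sigma> p"
  \<comment> \<open>The pseudometric has to be given on the whole type, also outside the
    vertices.\<close>
  define p' where "p' v = (if v \<in> verts G then p v else 0\<^sub>v m)" for v
  have p': "p' v \<in> carrier_vec m" for v using R by (simp add: p'_def realization_def)
  have "\<exists>s. line_embedding G (\<lambda>e. \<sigma> e = 1) (\<lambda>i j. vec_dist (p' i) (p' j)) s"
    by (rule L[unfolded line_realizable_def, rule_format, OF pseudometric_vec_dist[OF p']])
  then obtain s where s: "line_embedding G (\<lambda>e. \<sigma> e = 1) (\<lambda>i j. vec_dist (p' i) (p' j)) s" ..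
  \<comment> \<open>The line is the first coordinate axis. For \<open>m = 0\<close> there is none,
    but then all distances are 0 and every requirement holds.\<close>
  define q where "q v = s v \<cdot>\<^sub>v unit_vec m 0" for v
  have q: "q v \<in> carrier_vec m" for v by (simp add: q_def)
  have dist_q: "vec_dist (q i) (q j) = (if m = 0 then 0 else \<bar>s i - s j\<bar>)" for i j
  proof (cases m)
    case 0
    then show ?thesis using q by (simp add: vec_dist_sum[of _ m] L2_set_def)
  next
    case (Suc k)
    have "vec_dist (q i) (q j) = L2_set (\<lambda>a. if a = 0 then s i - s j else 0) {..<m}"
      unfolding vec_dist_sum[OF q q] by (rule L2_set_cong) (auto simp: q_def)
    also have "\<dots> = \<bar>s i - s j\<bar>"
      unfolding L2_set_def using Suc by (simp add: if_distrib[of "\<lambda>x. x\<^sup>2"] cong: if_cong)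
    finally show ?thesis using Suc by simp
  qed
  have "deformation m G \<sigma> p q"
    unfolding deformation_def
  proof (intro conjI ballI allI impI)
    fix e i j assume e: "e \<in> edges G" "ends G e = {i, j}"
    have V: "i \<in> verts G" "j \<in> verts G" using multigraphD(6)[OF G e] by auto
    have f: "fits (\<sigma> e = 1) (vec_dist (p i) (p j)) \<bar>s i - s j\<bar>"
      using line_embeddingD[OF s e] V by (simp add: p'_def)
    have m0: "vec_dist (p i) (p j) = 0" if "m = 0"
      using that R V by (simp add: vec_dist_sum[of _ m] realization_def L2_set_def)
    show "vec_dist (q i) (q j) \<le> vec_dist (p i) (p j)" if "\<sigma> e = 1"
      using f that m0 by (auto simp: dist_q fits_def)
    show "vec_dist (q i) (q j) \<ge> vec_dist (p i) (p j)" if "\<sigma> e = -1"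
      using f that m0 by (auto simp: dist_q fits_def)
  qed (rule q)
  moreover have "affine_dim m (affine_span m (q ` verts G)) \<le> 1"
  proof (rule affine_dim_le[where b = "\<lambda>_. unit_vec m 0"])
    fix x assume "x \<in> q ` verts G"
    then obtain v where "x = q v" by blast
    then show "\<exists>c. \<forall>a<m. x $ a = (\<Sum>i<(1 :: nat). c i * unit_vec m 0 $ a)"
      by (intro exI[of _ "\<lambda>_. s v"]) (simp add: q_def)
  qed (use multigraphD(1)[OF G] q in auto)
  ultimately show "\<exists>q. deformation m G \<sigma> p q \<and> affine_dim m (affine_span m (q ` verts G)) \<le> 1" by blast
qed

text \<open>The undeformed placement already has small enough dimension; hence the minimum defining
  \<open>rd\<close> is attained.\<close>

lemma realizable_card:
  assumes G: "multigraph G"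
  shows "realizable (card (verts G)) G"
  unfolding realizable_def
proof (intro allI impI)
  fix m \<sigma> p assume R: "realization m G \<sigma> p"
  then have p: "\<And>v. v \<in> verts G \<Longrightarrow> p v \<in> carrier_vec m" by (simp add: realization_def)
  obtain g where g: "bij_betw g {..<card (verts G)} (verts G)"
    using ex_bij_betw_nat_finite[OF multigraphD(1)[OF G]] by (auto simp: atLeast0LessThan)
  have "affine_dim m (affine_span m (p ` verts G)) \<le> card (verts G)"
  proof (rule affine_dim_le[where b = "p \<circ> g"])
    show "(p \<circ> g) i \<in> carrier_vec m" if "i < card (verts G)" for i
      using p g that by (auto simp: bij_betw_def)
    fix x assume "x \<in> p ` verts G"
    then obtain i where i: "i < card (verts G)" "x = p (g i)" using g by (force simp: bij_betw_def)
    have "x $ a = (\<Sum>j<card (verts G). (if j = i then 1 else 0) * (p \<circ> g) j $ a)" for a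
      using i by (simp only: sum_indicator[OF finite_lessThan] lessThan_iff o_apply)
    then show "\<exists>c. \<forall>a<m. x $ a = (\<Sum>j<card (verts G). c j * (p \<circ> g) j $ a)"
      by (intro exI[of _ "\<lambda>j. if j = i then 1 else 0"]) blast
  qed (use multigraphD(1)[OF G] p in auto)
  moreover have "deformation m G \<sigma> p p" using p by (simp add: deformation_def)
  ultimately show "\<exists>q. deformation m G \<sigma> p q \<and> affine_dim m (affine_span m (q ` verts G)) \<le> card (verts G)"
    by blast
qed

lemma rd_le_1_iff:
  assumes "multigraph G"
  shows "rd G \<le> 1 \<longleftrightarrow> realizable 1 G"
proof
  assume "rd G \<le> 1"
  moreover have "realizable (rd G) G" unfolding rd_def using realizable_card[OF assms] by (rule LeastI)
  ultimately show "realizable 1 G" unfolding realizable_def by (meson order_trans)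
next
  assume "realizable 1 G"
  then show "rd G \<le> 1" unfolding rd_def by (rule Least_le)
qed

section \<open>Dimension bound for super stable realizations\<close>

lemma energy_zero_if_semidefinite:
  assumes psd: "\<And>f. energy t h \<omega> E f f \<ge> 0" and r: "energy t h \<omega> E r r = 0"
  shows "energy t h \<omega> E r g = 0"
proof (rule ccontr)
  let ?B = "energy t h \<omega> E"
  assume ne: "?B r g \<noteq> 0"
  \<comment> \<open>As \<open>r\<close> has energy 0, the energy of \<open>g + a * r\<close> is
    affine in the scalar \<open>a\<close>, with slope \<open>2 * ?B r g\<close>; this choice makes
    it -1.\<close>
  define a where "a = - (?B g g + 1) / (2 * ?B r g)"
  have "?B (\<lambda>x. g x + a * r x) (\<lambda>x. g x + a * r x) = ?B g g + a * ?B r g + a * (?B r g + a * ?B r r)"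
    unfolding energy_add_scaled energy_commute[of t h \<omega> E g "\<lambda>x. g x + a * r x"]
      energy_commute[of t h \<omega> E r "\<lambda>x. g x + a * r x"]
    by (simp add: energy_commute[of t h \<omega> E g r])
  also have "\<dots> = ?B g g + 2 * ?B r g * a" using r by simp
  also have "\<dots> = - 1" using ne by (simp add: a_def)
  finally show False using psd[of "\<lambda>x. g x + a * r x"] by simp
qed

lemma super_stable_dim_le_1:
  assumes G: "multigraph G" and real: "realizable 1 G" and X: "X \<subseteq> verts G" "X \<noteq> {}"
    and S: "super_stable d (induced G X) \<sigma> p"
  shows "d \<le> 1"
proof (rule ccontr)
  assume "\<not> d \<le> 1"
  then have d: "d \<ge> 2" by simp
  let ?C = "induced G X"
  have C: "multigraph ?C" using multigraph_induced[OF G X(1)] .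
  obtain t h where th: "orientation ?C t h" using orientation_exists[OF C] .
  have p: "p v \<in> carrier_vec d" if "v \<in> X" for v using S that by (simp add: super_stable_def realization_def)
  have \<sigma>: "\<sigma> e \<in> {1, -1}" if "e \<in> edges ?C" for e using S that by (simp add: super_stable_def realization_def)
  have span: "affine_span d (p ` X) = carrier_vec d" using S by (simp add: super_stable_def)
  obtain l \<omega> where l: "bij_betw l (verts ?C) {..<card (verts ?C)}" and
    eq: "equilibrium_stress d ?C p \<omega>" and proper: "strictly_proper ?C \<sigma> \<omega>" and
    psd: "pos_semidef (laplacian ?C l \<omega>)" and dim: "kernel_dim (laplacian ?C l \<omega>) = d + 1"
    using S unfolding super_stable_def by blast
  have rigid: "M = 0\<^sub>m d d" if "M \<in> carrier_mat d d" "M\<^sup>T = M"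
    "\<And>e i j. e \<in> edges ?C \<Longrightarrow> ends ?C e = {i, j} \<Longrightarrow> (p j - p i) \<bullet> (M *\<^sub>v (p j - p i)) = 0" for M
    using S that unfolding super_stable_def by blast
  interpret labelled_graph ?C l \<omega> t h by (rule labelled_graph.intro[OF C l th])
  have finX: "finite X" by (rule finite_subset[OF X(1) multigraphD(1)[OF G]])
  have form_nonneg: "form f f \<ge> 0" for f using psd by (simp add: pos_semidef_iff)
  have form_p: "form (\<lambda>v. p v $ c) g = 0" if "c < d" for c g
    using eq that equilibrium_stress_iff[OF C th, of p d \<omega>] p by auto
  \<comment> \<open>Super stability concerns only the induced subgraph, realizability the whole of
    \<open>G\<close>. The realization is therefore extended by the zero vector and the sign
    +.\<close>
  define p' where "p' v = (if v \<in> X then p v else 0\<^sub>v d)" for v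
  define \<sigma>' where "\<sigma>' e = (if e \<in> edges ?C then \<sigma> e else 1)" for e
  have "realization d G \<sigma>' p'" using p \<sigma> by (auto simp: realization_def p'_def \<sigma>'_def)
  then obtain q where q: "deformation d G \<sigma>' p' q" and q1: "affine_dim d (affine_span d (q ` verts G)) \<le> 1"
    using real unfolding realizable_def by blast
  have qV: "q v \<in> carrier_vec d" if "v \<in> verts G" for v using q that by (simp add: deformation_def)
  obtain v0 where v0: "v0 \<in> X" using X(2) by blast
  obtain z where z: "\<And>x. x \<in> q ` verts G \<Longrightarrow> \<exists>c. \<forall>j<d. x $ j = q v0 $ j + c * z $ j"
    using collinear_if_affine_dim_le_1[OF _ _ q1, of "q v0"] multigraphD(1)[OF G] qV v0 X(1) by blast
  then have "\<forall>v\<in>verts G. \<exists>c. \<forall>j<d. q v $ j = q v0 $ j + c * z $ j" by blast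
  then obtain s where s: "\<And>v j. v \<in> verts G \<Longrightarrow> j < d \<Longrightarrow> q v $ j = q v0 $ j + s v * z $ j" by metis
  define Z where "Z = (\<Sum>j<d. (z $ j)\<^sup>2)"
  have Z: "Z \<ge> 0" by (simp add: Z_def sum_nonneg)
  \<comment> \<open>The direction \<open>z\<close> need not have length 1; the factor turns
    differences of \<open>r\<close> into distances up to sign.\<close>
  define r where "r v = s v * sqrt Z" for v
  have endsX: "t e \<in> X" "h e \<in> X" "ends G e = {t e, h e}" "e \<in> edges G" if "e \<in> edges ?C" for e
    using that th by (auto simp: orientation_def)
  have dist_q: "(vec_dist (q i) (q j))\<^sup>2 = (r i - r j)\<^sup>2" if "i \<in> X" "j \<in> X" for i j
  proof -
    have V: "i \<in> verts G" "j \<in> verts G" using that X by auto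
    have "(vec_dist (q i) (q j))\<^sup>2 = (\<Sum>c<d. (s i - s j)\<^sup>2 * (z $ c)\<^sup>2)"
      unfolding vec_dist_square[OF qV[OF V(1)] qV[OF V(2)]]
      by (rule sum.cong) (simp_all add: s[OF V(1)] s[OF V(2)] power_mult_distrib[symmetric] left_diff_distrib)
    also have "\<dots> = (s i - s j)\<^sup>2 * Z" by (simp add: Z_def sum_distrib_left)
    also have "\<dots> = (r i - r j)\<^sup>2"
      using Z by (simp add: r_def left_diff_distrib[symmetric] power_mult_distrib)
    finally show ?thesis .
  qed
  \<comment> \<open>The change of squared length. Properness makes each
    \<open>\<omega> e * \<Delta> e\<close> nonpositive. In their sum the contribution of
    \<open>p\<close> vanishes by equilibrium, which leaves \<open>form r r\<close>; so the sum is 0,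
    and every term with it.\<close>
  define \<Delta> where "\<Delta> e = (r (t e) - r (h e))\<^sup>2 - (\<Sum>c<d. (p (t e) $ c - p (h e) $ c)\<^sup>2)" for e
  have nonpos: "\<omega> e * \<Delta> e \<le> 0" if e: "e \<in> edges ?C" for e
  proof -
    note E = endsX[OF e]
    have \<Delta>: "\<Delta> e = (vec_dist (q (t e)) (q (h e)))\<^sup>2 - (vec_dist (p (t e)) (p (h e)))\<^sup>2"
      by (simp add: \<Delta>_def dist_q[OF E(1,2)] vec_dist_square[OF p[OF E(1)] p[OF E(2)]])
    have nn: "vec_dist (q (t e)) (q (h e)) \<ge> 0" "vec_dist (p (t e)) (p (h e)) \<ge> 0"
      using vec_dist_nonneg qV p E X(1) by blast+
    have def: "(\<sigma> e = 1 \<longrightarrow> vec_dist (q (t e)) (q (h e)) \<le> vec_dist (p (t e)) (p (h e))) \<and>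
        (\<sigma> e = -1 \<longrightarrow> vec_dist (q (t e)) (q (h e)) \<ge> vec_dist (p (t e)) (p (h e)))"
    proof -
      have "(\<sigma>' e = 1 \<longrightarrow> vec_dist (q (t e)) (q (h e)) \<le> vec_dist (p' (t e)) (p' (h e))) \<and>
        (\<sigma>' e = -1 \<longrightarrow> vec_dist (q (t e)) (q (h e)) \<ge> vec_dist (p' (t e)) (p' (h e)))"
        using q E(3,4) unfolding deformation_def by blast
      moreover have "\<sigma>' e = \<sigma> e" "p' (t e) = p (t e)" "p' (h e) = p (h e)"
        using e E(1,2) by (simp_all add: p'_def \<sigma>'_def)
      ultimately show ?thesis by simp
    qed
    have "\<sigma> e * \<omega> e > 0" using proper e by (simp add: strictly_proper_def)
    consider "\<sigma> e = 1" | "\<sigma> e = -1" using \<sigma>[OF e] by auto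
    then show ?thesis
    proof cases
      case 1
      then have "\<omega> e > 0" using \<open>\<sigma> e * \<omega> e > 0\<close> by simp
      moreover have "\<Delta> e \<le> 0" using def 1 nn by (simp add: \<Delta>)
      ultimately show ?thesis by (simp add: mult_nonneg_nonpos)
    next
      case 2
      then have "\<omega> e < 0" using \<open>\<sigma> e * \<omega> e > 0\<close> by simp
      moreover have "\<Delta> e \<ge> 0" using def 2 nn by (simp add: \<Delta>)
      ultimately show ?thesis by (simp add: mult_nonpos_nonneg)
    qed
  qed
  have total: "(\<Sum>e\<in>edges ?C. \<omega> e * \<Delta> e) = form r r"
  proof -
    have swap: "(\<Sum>c<d. form (\<lambda>v. p v $ c) (\<lambda>v. p v $ c)) = (\<Sum>e\<in>edges ?C. \<Sum>c<d.
        \<omega> e * (p (t e) $ c - p (h e) $ c) * (p (t e) $ c - p (h e) $ c))"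
      unfolding energy_def by (rule sum.swap)
    have "(\<Sum>e\<in>edges ?C. \<omega> e * \<Delta> e) = form r r - (\<Sum>c<d. form (\<lambda>v. p v $ c) (\<lambda>v. p v $ c))"
      unfolding swap unfolding energy_def sum_subtractf[symmetric] \<Delta>_def
      by (rule sum.cong[OF refl], subst right_diff_distrib)
        (simp add: sum_distrib_left power2_eq_square mult.assoc)
    also have "\<dots> = form r r" using form_p by simp
    finally show ?thesis .
  qed
  have finE: "finite (edges ?C)" using multigraphD(2)[OF C] .
  have "(\<Sum>e\<in>edges ?C. \<omega> e * \<Delta> e) \<le> 0" using nonpos by (rule sum_nonpos)
  then have r0: "form r r = 0" using total form_nonneg[of r] by simp
  have \<Delta>0: "\<Delta> e = 0" if e: "e \<in> edges ?C" for e
  proof -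
    have "(\<Sum>e\<in>edges ?C. - (\<omega> e * \<Delta> e)) = 0" using total r0 by (simp add: sum_negf)
    then have "- (\<omega> e * \<Delta> e) = 0"
      using sum_nonneg_eq_0_iff[OF finE, of "\<lambda>e. - (\<omega> e * \<Delta> e)"] nonpos e by simp
    moreover have "\<omega> e \<noteq> 0" using proper e by (auto simp: strictly_proper_def)
    ultimately show ?thesis by simp
  qed
  \<comment> \<open>The constant and the coordinates of \<open>p\<close> are \<open>d + 1\<close>
    kernel elements, independent because the points span affinely. By the dimension of the kernel
    they generate \<open>r\<close>.\<close>
  let ?u = "\<lambda>i v. if i = 0 then 1 else p v $ (i - 1)"
  have "\<exists>c. \<forall>v\<in>verts ?C. r v = (\<Sum>i<d + 1. c i * ?u i v)"
  proof (rule kernel_dim_generates[OF dim])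
    fix i :: nat and g assume i: "i < d + 1"
    show "form (?u i) g = 0"
    proof (cases "i = 0")
      case True
      then show ?thesis by (simp add: energy_def)
    next
      case False
      then show ?thesis using form_p[of "i - 1"] i by simp
    qed
  next
    fix c :: "nat \<Rightarrow> real"
    assume c: "\<And>v. v \<in> verts ?C \<Longrightarrow> (\<Sum>i<d + 1. c i * ?u i v) = 0"
    have c: "c 0 + (\<Sum>i<d. c (Suc i) * p v $ i) = 0" if "v \<in> X" for v
      using c[of v] that unfolding Suc_eq_plus1[symmetric] sum.lessThan_Suc_shift by simp
    \<comment> \<open>An affine relation satisfied by all points extends to their affine span, which
      is the whole space, and can be tested at 0 and at the unit vectors.\<close>
    have x: "c 0 + (\<Sum>i<d. c (Suc i) * x $ i) = 0" if "x \<in> carrier_vec d" for x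
    proof -
      have "x \<in> affine_span d (p ` X)" using that span by simp
      then obtain b where b: "(\<Sum>y\<in>p ` X. b y) = 1" "\<And>j. j < d \<Longrightarrow> x $ j = (\<Sum>y\<in>p ` X. b y * y $ j)"
        using affine_spanD[of x d "p ` X"] finX p by blast
      have "(\<Sum>i<d. c (Suc i) * x $ i) = (\<Sum>i<d. \<Sum>y\<in>p ` X. b y * (c (Suc i) * y $ i))"
        by (rule sum.cong) (simp_all add: b(2) sum_distrib_left mult_ac)
      also have "\<dots> = (\<Sum>y\<in>p ` X. \<Sum>i<d. b y * (c (Suc i) * y $ i))" by (rule sum.swap)
      also have "\<dots> = (\<Sum>y\<in>p ` X. b y * (\<Sum>i<d. c (Suc i) * y $ i))" by (simp add: sum_distrib_left)
      also have "\<dots> = (\<Sum>y\<in>p ` X. b y * (- c 0))"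
        using c by (intro sum.cong refl) (auto simp: add_eq_0_iff)
      also have "\<dots> = - c 0" unfolding sum_distrib_right[symmetric] b(1) by simp
      finally show ?thesis by simp
    qed
    have "c 0 = 0" using x[of "0\<^sub>v d"] by simp
    moreover have "c (Suc i) = 0" if i: "i < d" for i
    proof -
      have "(\<Sum>j<d. c (Suc j) * unit_vec d i $ j) = (\<Sum>j<d. if j = i then c (Suc j) else 0)"
        using i by (intro sum.cong) auto
      then show ?thesis using x[of "unit_vec d i"] \<open>c 0 = 0\<close> i by simp
    qed
    ultimately show "\<forall>i<d + 1. c i = 0" by (auto simp: less_Suc_eq_0_disj)
  next
    show "form r g = 0" for g using energy_zero_if_semidefinite[OF form_nonneg r0] .
  qed
  then obtain c where c: "\<And>v. v \<in> X \<Longrightarrow> r v = (\<Sum>i<d + 1. c i * ?u i v)" by auto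
  define a where "a i = c (Suc i)" for i
  have r: "r v = c 0 + (\<Sum>i<d. a i * p v $ i)" if "v \<in> X" for v
    using c[OF that] unfolding Suc_eq_plus1[symmetric] sum.lessThan_Suc_shift by (simp add: a_def)
  define M where "M = mat d d (\<lambda>(i, j). a i * a j - (if i = j then 1 else 0))"
  have M: "M \<in> carrier_mat d d" by (simp add: M_def)
  have M_form: "x \<bullet> (M *\<^sub>v x) = (\<Sum>i<d. a i * x $ i)\<^sup>2 - (\<Sum>i<d. (x $ i)\<^sup>2)" if x: "x \<in> carrier_vec d" for x
  proof -
    have "x \<bullet> (M *\<^sub>v x) = (\<Sum>i<d. x $ i * (\<Sum>j<d. (a i * a j - (if i = j then 1 else 0)) * x $ j))"
      using x by (simp add: scalar_prod_def M_def atLeast0LessThan)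
    also have "\<dots> = (\<Sum>i<d. x $ i * ((\<Sum>j<d. a i * a j * x $ j) - x $ i))"
    proof (intro sum.cong refl)
      fix i assume i: "i \<in> {..<d}"
      have "(\<Sum>j<d. (a i * a j - (if i = j then 1 else 0)) * x $ j)
        = (\<Sum>j<d. a i * a j * x $ j - (if j = i then x $ j else 0))"
        by (intro sum.cong) (auto simp: left_diff_distrib)
      then show "x $ i * (\<Sum>j<d. (a i * a j - (if i = j then 1 else 0)) * x $ j)
        = x $ i * ((\<Sum>j<d. a i * a j * x $ j) - x $ i)" using i by (simp add: sum_subtractf)
    qed
    also have "\<dots> = (\<Sum>i<d. a i * x $ i)\<^sup>2 - (\<Sum>i<d. (x $ i)\<^sup>2)"
      by (simp add: power2_eq_square right_diff_distrib sum_subtractf sum_product sum_distrib_left mult_ac)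
    finally show ?thesis .
  qed
  have "M = 0\<^sub>m d d"
  proof (rule rigid[OF M])
    show "M\<^sup>T = M" by (rule eq_matI) (auto simp: M_def)
    fix e i j assume e: "e \<in> edges ?C" "ends ?C e = {i, j}"
    have ij: "i \<in> X" "j \<in> X" using e by auto
    have "{i, j} = {t e, h e}" using e th by (auto simp: orientation_def)
    then have "(r j - r i)\<^sup>2 = (\<Sum>c<d. (p i $ c - p j $ c)\<^sup>2)"
      using \<Delta>0[OF e(1)] by (auto simp: \<Delta>_def doubleton_eq_iff power2_commute)
    moreover have "r j - r i = (\<Sum>k<d. a k * (p j - p i) $ k)"
      using p[OF ij(1)] p[OF ij(2)] by (simp add: r ij right_diff_distrib sum_subtractf)
    moreover have "(\<Sum>k<d. ((p j - p i) $ k)\<^sup>2) = (\<Sum>c<d. (p i $ c - p j $ c)\<^sup>2)"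
      using p[OF ij(1)] p[OF ij(2)] by (intro sum.cong) (auto simp: power2_commute)
    ultimately show "(p j - p i) \<bullet> (M *\<^sub>v (p j - p i)) = 0"
      using M_form[of "p j - p i"] p[OF ij(1)] p[OF ij(2)] by simp
  qed
  \<comment> \<open>For \<open>d \<ge> 2\<close> the identity is not of rank one, as its upper left
    2 by 2 block shows.\<close>
  then have "M $$ (0, 0) = 0" "M $$ (1, 1) = 0" "M $$ (0, 1) = 0" using d by auto
  then have "a 0 * a 0 = 1" "a 1 * a 1 = 1" "a 0 * a 1 = 0" using d by (simp_all add: M_def)
  then show False by auto
qed

text \<open>Makes the set under \<open>Max\<close> in \<open>max_super_stable_dim\<close>
  finite.\<close>

lemma super_stable_dim_le_card:
  assumes G: "multigraph G" and S: "super_stable d G \<sigma> p"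
  shows "d \<le> card (verts G)"
proof -
  obtain l \<omega> where l: "bij_betw l (verts G) {..<card (verts G)}" and
    dim: "kernel_dim (laplacian G l \<omega>) = d + 1"
    using S unfolding super_stable_def by blast
  obtain t h where th: "orientation G t h" using orientation_exists[OF G] .
  interpret labelled_graph G l \<omega> t h by (rule labelled_graph.intro[OF G l th])
  show ?thesis using kernel_dim_le_card dim by simp
qed

theorem theorem6p3:
  fixes G :: "('v, 'e) mgraph"
  assumes "multigraph G"
  shows "(rd G \<le> 1 \<longleftrightarrow> graph_lambda G \<le> 1) \<and>
         (graph_lambda G \<le> 1 \<longleftrightarrow> \<not> has_minor G K4 \<and> \<not> has_minor G doubled_K3)"
proof -
  note G = assms
  let ?S = "\<lambda>C. {d. \<exists>\<sigma> p. super_stable d C \<sigma> p}"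
  have comp: "\<exists>v\<in>verts G. C = induced G (reachable G v)" if "C \<in> components G" for C
    using that by (auto simp: components_eq)
  have mC: "multigraph C" if "C \<in> components G" for C
    using comp[OF that] multigraph_induced[OF G] reachable_subset[OF G] by blast
  have finC: "finite (components G)" using multigraphD(1)[OF G] by (simp add: components_def)
  have fin: "finite (?S C)" if "C \<in> components G" for C
    by (rule finite_subset[of _ "{..card (verts C)}"]) (use super_stable_dim_le_card[OF mC[OF that]] in auto)
  have ne: "?S C \<noteq> {}" if C: "C \<in> components G" for C
  proof -
    obtain v where v: "v \<in> verts G" "C = induced G (reachable G v)" using comp[OF C] by blast
    then have "super_stable 0 C (\<lambda>_. 1) (\<lambda>_. 0\<^sub>v 0)"
      using super_stable_0[OF mC[OF C]] connected_graph_component[OF v(1)] by simp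
    then show ?thesis by blast
  qed
  have lambda: "graph_lambda G \<le> 1 \<longleftrightarrow> (\<forall>C\<in>components G. \<forall>d \<sigma> p. super_stable d C \<sigma> p \<longrightarrow> d \<le> 1)"
  proof -
    have "graph_lambda G \<le> 1 \<longleftrightarrow> (\<forall>C\<in>components G. max_super_stable_dim C \<le> 1)"
    proof (cases "components G = {}")
      \<comment> \<open>The null graph: the supremum over no components is 0.\<close>
      case True
      then show ?thesis by (simp add: graph_lambda_def)
    next
      case False
      then show ?thesis
        unfolding graph_lambda_def using finC by (subst cSUP_le_iff) auto
    qed
    also have "\<dots> \<longleftrightarrow> (\<forall>C\<in>components G. \<forall>d\<in>?S C. d \<le> 1)"
      unfolding max_super_stable_dim_def using Max_le_iff[OF fin ne] by blast
    finally show ?thesis by blast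
  qed
  have "rd G \<le> 1 \<Longrightarrow> graph_lambda G \<le> 1"
    unfolding lambda
  proof (intro ballI allI impI)
    fix C d \<sigma> p assume rd: "rd G \<le> 1" and C: "C \<in> components G" and S: "super_stable d C \<sigma> p"
    obtain v where v: "v \<in> verts G" "C = induced G (reachable G v)" using comp[OF C] by blast
    have "v \<in> reachable G v" by (simp add: reachable_def)
    then show "d \<le> 1"
      using super_stable_dim_le_1[OF G _ reachable_subset[OF G v(1)]] S v rd rd_le_1_iff[OF G] by blast
  qed
  moreover have "graph_lambda G \<le> 1 \<Longrightarrow> \<not> has_minor G K4 \<and> \<not> has_minor G doubled_K3"
    unfolding lambda
    using super_stable_2_component[OF G has_resistance_triple_if_minor[OF G]] by fastforce
  moreover have "\<not> has_minor G K4 \<and> \<not> has_minor G doubled_K3 \<Longrightarrow> rd G \<le> 1"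
    using line_realizable_if_no_minor[OF G] realizable_1_if_line_realizable[OF G] rd_le_1_iff[OF G] by blast
  ultimately show ?thesis by blast
qed

end
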